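(* Let $k$ be a positive integer and let $a_1,\dots,a_k$ and $p_1,\dots,p_k$ be positive integers with $(a_j,p_j)=1$ for $1\le j\le k$. Let $$\mathbb{S}(a_1,\dots,a_k;p_1,\dots,p_k;x):={\sum_{1\le n_1n_2\cdots n_k\le x}}^{\!\!\!\!\prime}\; n_1n_2\cdots n_k\,\sin(2\pi n_1a_1/p_1)\sin(2\pi n_2a_2/p_2)\cdots\sin(2\pi n_ka_k/p_k).$$ Then for every $\epsilon>0$, as $x\to\infty$, $$\mathbb{S}(a_1,\dots,a_k;p_1,\dots,p_k;x)=O\left(x^{2k/(k+1)+\epsilon}\right).$$
   Context: The sum is over $k$-tuples of positive integers $n_1,\dots,n_k$; the prime means that if $x$ is an integer, the terms with $n_1n_2\cdots n_k=x$ are multiplied by $\tfrac12$. The implied constant may depend on $\epsilon$, $k$, the $a_j$ and the $p_j$. *)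

theory Defs
  imports Complex_Main "HOL-Library.FuncSet" "HOL-Library.Landau_Symbols"
begin

text \<open>
  A \<open>k\<close>-tuple \<open>(n\<^sub>1, \<dots>, n\<^sub>k)\<close> is an extensional function on \<open>{1..k}\<close>; extensionality makes each
  tuple occur exactly once.
\<close>

definition tuples_upto :: "nat \<Rightarrow> real \<Rightarrow> (nat \<Rightarrow> nat) set" where
  "tuples_upto k x =
     {n \<in> {1..k} \<rightarrow>\<^sub>E {1..}. 1 \<le> (\<Prod>j=1..k. n j) \<and> real (\<Prod>j=1..k. n j) \<le> x}"

text \<open>The sum below would silently be \<open>0\<close> over an infinite index set.\<close>

lemma finite_tuples_upto: "finite (tuples_upto k x)"
proof (rule finite_subset)
  show "tuples_upto k x \<subseteq> {1..k} \<rightarrow>\<^sub>E {..nat \<lfloor>x\<rfloor>}"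
  proof
    fix n assume n: "n \<in> tuples_upto k x"
    then have E: "n \<in> {1..k} \<rightarrow>\<^sub>E {1..}" and le: "real (\<Prod>j=1..k. n j) \<le> x"
      by (auto simp: tuples_upto_def)
    have "n i \<le> nat \<lfloor>x\<rfloor>" if i: "i \<in> {1..k}" for i
    proof -
      have "1 \<le> (\<Prod>j=1..k. n j)" using n by (simp add: tuples_upto_def)
      moreover have "n i dvd (\<Prod>j=1..k. n j)" using i by (intro dvd_prodI) auto
      ultimately have "n i \<le> (\<Prod>j=1..k. n j)" by (intro dvd_imp_le) linarith+
      then show ?thesis using le by linarith
    qed
    then show "n \<in> {1..k} \<rightarrow>\<^sub>E {..nat \<lfloor>x\<rfloor>}" using E by (auto simp: PiE_iff)
  qed
  show "finite ({1..k} \<rightarrow>\<^sub>E {..nat \<lfloor>x\<rfloor>})" by (intro finite_PiE) auto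
qed

text \<open>
  The primed sum: if \<open>x\<close> is an integer, the terms with \<open>n\<^sub>1 \<cdots> n\<^sub>k = x\<close> are counted with
  weight \<open>1/2\<close>.
\<close>

definition sine_sum :: "nat \<Rightarrow> (nat \<Rightarrow> nat) \<Rightarrow> (nat \<Rightarrow> nat) \<Rightarrow> real \<Rightarrow> real" where
  "sine_sum k a p x =
     (\<Sum>n\<in>tuples_upto k x.
        (if real (\<Prod>j=1..k. n j) = x then 1 / 2 else 1) *
        (real (\<Prod>j=1..k. n j) *
         (\<Prod>j=1..k. sin (2 * pi * real (n j) * real (a j) / real (p j)))))"

end

theory Submission
  imports Defs "HOL-Complex_Analysis.Complex_Analysis"
begin

text \<open>
  Write \<open>L(\<alpha>, s)\<close> for the Dirichlet series with coefficients \<open>sin(2 pi n \<alpha>)\<close>. The summands of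
  \<open>sine_sum\<close> are the coefficients of the product of the \<open>L(a_j/p_j, s - 1)\<close>, so the sum is an inverse
  Mellin transform of that product. The estimate balances two errors, which depend on a smoothing
  parameter \<open>h\<close>.

  \<^bold>\<open>Smoothing.\<close> The sharp cut-off at \<open>x\<close> has the Mellin kernel \<open>1/s\<close>. It is replaced by
  \<open>1/(s (1 + h s)^r)\<close>, whose only other pole lies far to the left, at \<open>-1/h\<close>. The resulting smooth
  weight is \<open>0\<close> beyond \<open>x\<close> and differs appreciably from \<open>1\<close> only where the product \<open>n_1 ... n_k\<close> lies
  within about \<open>h x\<close> of \<open>x\<close> (\<open>smooth_step_small\<close>, \<open>smooth_step_large\<close>). By the divisor bound
  \<open>card_factorizations_bound\<close> there are about \<open>h x^(1 + \<epsilon>)\<close> such tuples, so the change of weight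
  costs about \<open>h x^(2 + \<epsilon>)\<close> (\<open>tuples_weighted_sum_bound\<close>, \<open>sine_sum_approx\<close>).

  \<^bold>\<open>Shifting the contour.\<close> \<open>L(\<alpha>, s)\<close> has no pole, so the line of integration can be moved
  from \<open>Re s = 3\<close> to \<open>Re s = 1 - \<delta>\<close> without collecting residues. There the functional equation
  \<open>sine_L_functional_equation\<close> turns every \<open>L(\<alpha>, s - 1)\<close> into a gamma factor \<open>G\<close>, which is the same
  for all \<open>\<alpha>\<close>, times an absolutely convergent series of exponentials in \<open>t = Im s\<close>. By
  \<open>sine_gamma_factor_asymptotic\<close>, \<open>G(-\<delta> + i t)\<close> has size \<open>t^(1/2 + \<delta>)\<close> and phase
  \<open>-(t ln t - t)\<close>. All other factors have phases that are linear in \<open>t\<close>. Hence the second derivative of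
  the total phase is \<open>-k/t\<close>, and the second derivative test saves a factor \<open>t^(1/2)\<close> over the trivial
  bound: the shifted integral is \<open>O(x^(1 - \<delta>) h^(-(k - 1)/2 - (k + 1) \<delta>))\<close>
  (\<open>left_line_integral_bound\<close>). Because the bound for a single frequency is uniform in the frequency, a
  product of \<open>k\<close> series of exponentials is handled as a multiplier (\<open>fourier_multiplier_prod\<close>), and the
  multiple sum over dual frequencies is never expanded.

  \<^bold>\<open>Balance.\<close> With \<open>h = x^(-2/(k + 1))\<close> both errors have the order \<open>x^(2k/(k + 1))\<close>, up to the
  arbitrarily small exponents \<open>\<epsilon>\<close> and \<open>\<delta>\<close>.
\<close>

section \<open>The divisor bound\<close>

text \<open>
  A divisor is determined by its exponents, each of which is at most the corresponding exponent of \<open>m\<close>.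
\<close>

lemma card_divisors_le_prod:
  fixes m :: nat
  assumes "m > 0"
  shows "card {d. d dvd m} \<le> (\<Prod>p\<in>prime_factors m. multiplicity p m + 1)"
proof -
  let ?P = "prime_factors m"
  let ?F = "\<lambda>d. restrict (\<lambda>p. multiplicity p d) ?P"
  have "inj_on ?F {d. d dvd m}"
  proof (rule inj_onI)
    fix d e assume d: "d \<in> {d. d dvd m}" and e: "e \<in> {d. d dvd m}" and eq: "?F d = ?F e"
    have *: "multiplicity p d = multiplicity p e" if "prime p" for p
    proof (cases "p dvd m")
      case True
      then have "p \<in> ?P" using that assms by (simp add: prime_factors_dvd)
      then show ?thesis using fun_cong[OF eq, of p] by simp
    next
      case False
      then have "\<not> p dvd d" "\<not> p dvd e" using d e dvd_trans by auto
      then show ?thesis by (simp add: not_dvd_imp_multiplicity_0)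
    qed
    have "d > 0" "e > 0" using d e assms by (auto intro!: Nat.gr0I)
    then show "d = e" by (rule multiplicity_eq_nat) (rule *)
  qed
  moreover have "?F ` {d. d dvd m} \<subseteq> PiE ?P (\<lambda>p. {..multiplicity p m})"
  proof (rule image_subsetI)
    fix d assume "d \<in> {d. d dvd m}"
    then have le: "multiplicity p d \<le> multiplicity p m" for p
      using assms by (intro dvd_imp_multiplicity_le) simp_all
    show "?F d \<in> PiE ?P (\<lambda>p. {..multiplicity p m})"
      by (rule restrict_PiE_iff[THEN iffD2]) (simp add: le)
  qed
  moreover have "finite (PiE ?P (\<lambda>p. {..multiplicity p m}))"
    by (intro finite_PiE) auto
  ultimately have "card {d. d dvd m} \<le> card (PiE ?P (\<lambda>p. {..multiplicity p m}))"
    by (rule card_inj_on_le)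
  also have "\<dots> = (\<Prod>p\<in>?P. multiplicity p m + 1)"
    by (simp add: card_PiE)
  finally show ?thesis .
qed

text \<open>
  The quotient of the two sides factors over primes into terms \<open>(e + 1) / p^(\<epsilon> e)\<close>. Such a term is at most
  \<open>1\<close> as soon as \<open>p^\<epsilon> \<ge> 2\<close>, and for each of the finitely many smaller primes it is bounded by a
  constant independent of the exponent \<open>e\<close>.
\<close>

lemma card_divisors_bound:
  fixes \<epsilon> :: real
  assumes "\<epsilon> > 0"
  obtains C where "C \<ge> 1" "\<And>m::nat. m > 0 \<Longrightarrow> real (card {d. d dvd m}) \<le> C * real m powr \<epsilon>"
proof -
  \<comment> \<open>c bounds (e + 1) / p^(\<epsilon> e) for all primes p, because 2^(\<epsilon> e) \<ge> 1 + \<epsilon> e ln 2; beyond N the bound 1 holds.\<close>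
  define c where "c = max 1 (1 / (\<epsilon> * ln 2))"
  define N where "N = nat \<lceil>2 powr (1/\<epsilon>)\<rceil>"
  have c1: "c \<ge> 1" by (simp add: c_def)
  have small: "real a + 1 \<le> c * real p powr (\<epsilon> * real a)" if p: "p \<ge> 2" for a p :: nat
  proof -
    have "real a + 1 \<le> c * (1 + \<epsilon> * real a * ln 2)"
    proof -
      have "1 \<le> c * (\<epsilon> * ln 2)"
        using assms by (simp add: c_def max_def field_simps)
      then have "real a * 1 \<le> real a * (c * (\<epsilon> * ln 2))" by (intro mult_left_mono) auto
      then show ?thesis using c1 by (simp add: algebra_simps)
    qed
    also have "1 + \<epsilon> * real a * ln 2 \<le> exp (\<epsilon> * real a * ln 2)" by (rule exp_ge_add_one_self)
    also have "\<dots> = 2 powr (\<epsilon> * real a)" by (simp add: powr_def)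
    also have "\<dots> \<le> real p powr (\<epsilon> * real a)" using p assms by (intro powr_mono2) auto
    finally show ?thesis using c1 by simp
  qed
  have large: "real a + 1 \<le> real p powr (\<epsilon> * real a)" if p: "p > N" for a p :: nat
  proof -
    have "2 powr (1/\<epsilon>) \<le> real p" using p unfolding N_def by linarith
    then have "(2 powr (1/\<epsilon>)) powr \<epsilon> \<le> real p powr \<epsilon>" using assms by (intro powr_mono2) auto
    then have "2 \<le> real p powr \<epsilon>" using assms by (simp add: powr_powr)
    then have "2 ^ a \<le> (real p powr \<epsilon>) ^ a" by (intro power_mono) auto
    also have "\<dots> = real p powr (\<epsilon> * real a)"
      using p by (simp add: powr_powr flip: powr_realpow)
    finally have "2 ^ a \<le> real p powr (\<epsilon> * real a)" .
    moreover have "real a + 1 \<le> 2 ^ a"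
    proof -
      have "a + 1 \<le> 2 ^ a" using less_exp[of a] by linarith
      then have "real (a + 1) \<le> real (2 ^ a)" by (rule of_nat_mono)
      then show ?thesis by simp
    qed
    ultimately show ?thesis by linarith
  qed
  define w where "w p = (if p \<le> N then c else 1)" for p
  show ?thesis
  proof
    show "c ^ (N + 1) \<ge> 1" using c1 by (rule one_le_power)
    fix m :: nat assume m: "m > 0"
    let ?P = "prime_factors m"
    have "real (card {d. d dvd m}) \<le> real (\<Prod>p\<in>?P. multiplicity p m + 1)"
      using card_divisors_le_prod[OF m] by (rule of_nat_mono)
    also have "\<dots> = (\<Prod>p\<in>?P. real (multiplicity p m) + 1)" by (simp add: add.commute)
    also have "\<dots> \<le> (\<Prod>p\<in>?P. w p * real p powr (\<epsilon> * real (multiplicity p m)))"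
    proof (rule prod_mono)
      fix p assume "p \<in> ?P"
      then have "p \<ge> 2" by (auto intro: prime_ge_2_nat)
      then show "0 \<le> real (multiplicity p m) + 1 \<and>
        real (multiplicity p m) + 1 \<le> w p * real p powr (\<epsilon> * real (multiplicity p m))"
        using small[of p] large[of p] by (auto simp: w_def not_le)
    qed
    also have "\<dots> = (\<Prod>p\<in>?P. w p) * (\<Prod>p\<in>?P. real p powr (\<epsilon> * real (multiplicity p m)))"
      by (rule prod.distrib)
    also have "(\<Prod>p\<in>?P. real p powr (\<epsilon> * real (multiplicity p m))) =
               (\<Prod>p\<in>?P. (real p ^ multiplicity p m) powr \<epsilon>)"
      by (intro prod.cong refl) (auto simp: powr_powr mult.commute in_prime_factors_iff prime_gt_0_nat
            simp flip: powr_realpow)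
    also have "\<dots> = (\<Prod>p\<in>?P. real p ^ multiplicity p m) powr \<epsilon>"
      by (rule prod_powr_distrib[symmetric])
    also have "(\<Prod>p\<in>?P. real p ^ multiplicity p m) = real (\<Prod>p\<in>?P. p ^ multiplicity p m)"
      by simp
    also have "(\<Prod>p\<in>?P. p ^ multiplicity p m) = m"
      using m by (simp add: prime_factorization_nat[symmetric])
    also have "(\<Prod>p\<in>?P. w p) \<le> c ^ (N + 1)"
    proof -
      have "(\<Prod>p\<in>?P. w p) = (\<Prod>p\<in>?P \<inter> {..N}. c)"
        by (subst prod.inter_restrict) (auto simp: w_def)
      also have "\<dots> = c ^ card (?P \<inter> {..N})" by simp
      also have "\<dots> \<le> c ^ (N + 1)"
        using c1 card_mono[of "{..N}" "?P \<inter> {..N}"] by (intro power_increasing) auto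
      finally show ?thesis .
    qed
    finally show "real (card {d. d dvd m}) \<le> c ^ (N + 1) * real m powr \<epsilon>"
      by (simp add: mult_right_mono)
  qed
qed

text \<open>
  All factors of a factorization of \<open>m\<close> divide \<open>m\<close>, so there are at most \<open>d(m)^k\<close> factorizations into
  \<open>k\<close> factors.
\<close>

lemma card_factorizations_bound:
  fixes \<epsilon> :: real and k :: nat
  assumes "\<epsilon> > 0"
  obtains C where "C \<ge> 1" "\<And>m::nat. m > 0 \<Longrightarrow>
    real (card {n \<in> {1..k} \<rightarrow>\<^sub>E {1..}. (\<Prod>j=1..k. n j) = m}) \<le> C * real m powr \<epsilon>"
proof -
  define \<eta> where "\<eta> = \<epsilon> / (k + 1)"
  have "\<eta> > 0" using assms by (simp add: \<eta>_def)
  then obtain C where C: "C \<ge> 1" "\<And>m::nat. m > 0 \<Longrightarrow> real (card {d. d dvd m}) \<le> C * real m powr \<eta>"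
    using card_divisors_bound by metis
  show ?thesis
  proof
    show "C ^ k \<ge> 1" using C by simp
    fix m :: nat assume m: "m > 0"
    have "{n \<in> {1..k} \<rightarrow>\<^sub>E {1..}. (\<Prod>j=1..k. n j) = m} \<subseteq> {1..k} \<rightarrow>\<^sub>E {d. d dvd m}"
      by (intro subsetI PiE_I) (auto simp: PiE_iff extensional_def intro: dvd_prodI)
    then have "card {n \<in> {1..k} \<rightarrow>\<^sub>E {1..}. (\<Prod>j=1..k. n j) = m} \<le> card ({1..k} \<rightarrow>\<^sub>E {d. d dvd m})"
      using m by (intro card_mono finite_PiE) auto
    also have "\<dots> = card {d. d dvd m} ^ k" by (simp add: card_PiE)
    finally have "real (card {n \<in> {1..k} \<rightarrow>\<^sub>E {1..}. (\<Prod>j=1..k. n j) = m}) \<le> real (card {d. d dvd m}) ^ k"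
      by (simp only: of_nat_power [symmetric] of_nat_le_iff)
    also have "\<dots> \<le> (C * real m powr \<eta>) ^ k" by (rule power_mono[OF C(2)[OF m]]) simp
    also have "\<dots> = C ^ k * real m powr (\<eta> * k)"
      using m by (simp add: power_mult_distrib powr_powr flip: powr_realpow)
    also have "\<dots> \<le> C ^ k * real m powr \<epsilon>"
      using C m assms by (intro mult_left_mono powr_mono) (auto simp: \<eta>_def field_simps)
    finally show "real (card {n \<in> {1..k} \<rightarrow>\<^sub>E {1..}. (\<Prod>j=1..k. n j) = m}) \<le> C ^ k * real m powr \<epsilon>" .
  qed
qed

section \<open>Oscillatory integrals\<close>

lemma has_vector_derivative_cis:
  assumes "(\<theta> has_field_derivative d) (at t within S)"
  shows "((\<lambda>t. cis (\<theta> t)) has_vector_derivative of_real d * (\<i> * cis (\<theta> t))) (at t within S)"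
proof -
  have "((\<lambda>t. cis (\<theta> t)) has_derivative (\<lambda>h. (d * h) *\<^sub>R (\<i> * cis (\<theta> t)))) (at t within S)"
    using assms by (intro has_derivative_cis) (simp add: has_field_derivative_def)
  then show ?thesis
    by (simp add: has_vector_derivative_def scaleR_conv_of_real mult_ac)
qed

text \<open>
  Up to a term with \<open>\<theta>'' / \<theta>'^2\<close>, the integrand is the derivative of \<open>cis \<theta> / (i \<theta>')\<close>. As
  \<open>\<theta>''\<close> has constant sign, the modulus of that term integrates to a difference of values of
  \<open>1 / \<theta>'\<close>.
\<close>

lemma first_derivative_test:
  fixes \<theta> \<theta>' \<theta>'' :: "real \<Rightarrow> real"
  assumes "p \<le> q" "m > 0"
    and d1: "\<And>t. t \<in> {p..q} \<Longrightarrow> (\<theta> has_field_derivative \<theta>' t) (at t)"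
    and d2: "\<And>t. t \<in> {p..q} \<Longrightarrow> (\<theta>' has_field_derivative \<theta>'' t) (at t)"
    and neg: "\<And>t. t \<in> {p..q} \<Longrightarrow> \<theta>'' t \<le> 0"
    and cont: "continuous_on {p..q} \<theta>''"
    and big: "(\<forall>t\<in>{p..q}. \<theta>' t \<ge> m) \<or> (\<forall>t\<in>{p..q}. \<theta>' t \<le> -m)"
  shows "norm (integral {p..q} (\<lambda>t. cis (\<theta> t))) \<le> 3 / m"
proof -
  have nz: "\<theta>' t \<noteq> 0" if "t \<in> {p..q}" for t using big that \<open>m > 0\<close> by force
  have am: "\<bar>\<theta>' t\<bar> \<ge> m" if "t \<in> {p..q}" for t using big that \<open>m > 0\<close> by force
  have c0: "continuous_on {p..q} \<theta>"
    by (rule DERIV_continuous_on[OF has_field_derivative_at_within[OF d1]])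
  have c1: "continuous_on {p..q} \<theta>'"
    by (rule DERIV_continuous_on[OF has_field_derivative_at_within[OF d2]])
  define F where "F t = cis (\<theta> t) * of_real (1 / \<theta>' t) / \<i>" for t
  define g where "g t = cis (\<theta> t) * of_real (\<theta>'' t / (\<theta>' t)\<^sup>2) / \<i>" for t
  have dinv: "((\<lambda>t. 1 / \<theta>' t) has_field_derivative - \<theta>'' t / (\<theta>' t)\<^sup>2) (at t within {p..q})"
    if t: "t \<in> {p..q}" for t
    using DERIV_divide[OF DERIV_const[of 1] has_field_derivative_at_within[OF d2[OF t], of "{p..q}"] nz[OF t]]
    by (simp add: power2_eq_square)
  have dF: "(F has_vector_derivative (cis (\<theta> t) - g t)) (at t within {p..q})"
    if t: "t \<in> {p..q}" for t
  proof -
    have "(F has_vector_derivative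
        (cis (\<theta> t) * of_real (- \<theta>'' t / (\<theta>' t)\<^sup>2) +
         of_real (\<theta>' t) * (\<i> * cis (\<theta> t)) * of_real (1 / \<theta>' t)) / \<i>) (at t within {p..q})"
      unfolding F_def
      by (intro has_vector_derivative_divide has_vector_derivative_mult has_vector_derivative_of_real
            has_vector_derivative_cis dinv[OF t] has_field_derivative_at_within[OF d1[OF t]])
    also have "(cis (\<theta> t) * of_real (- \<theta>'' t / (\<theta>' t)\<^sup>2) +
         of_real (\<theta>' t) * (\<i> * cis (\<theta> t)) * of_real (1 / \<theta>' t)) / \<i> = cis (\<theta> t) - g t"
      using nz[OF t] by (simp add: g_def add_divide_distrib ring_distribs)
    finally show ?thesis .
  qed
  have I1: "((\<lambda>t. cis (\<theta> t) - g t) has_integral (F q - F p)) {p..q}"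
    by (rule fundamental_theorem_of_calculus[OF \<open>p \<le> q\<close> dF])
  have cg: "continuous_on {p..q} g"
    unfolding g_def using nz by (intro continuous_intros c0 c1 cont continuous_on_cis) auto
  have ig: "g integrable_on {p..q}" by (rule integrable_continuous_real[OF cg])
  have "((\<lambda>t. (cis (\<theta> t) - g t) + g t) has_integral (F q - F p) + integral {p..q} g) {p..q}"
    by (intro has_integral_add I1 integrable_integral ig)
  then have eq: "integral {p..q} (\<lambda>t. cis (\<theta> t)) = (F q - F p) + integral {p..q} g"
    by (simp add: integral_unique)
  have I2: "((\<lambda>t. - \<theta>'' t / (\<theta>' t)\<^sup>2) has_integral (1 / \<theta>' q - 1 / \<theta>' p)) {p..q}"
    using dinv by (intro fundamental_theorem_of_calculus[OF \<open>p \<le> q\<close>])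
      (simp add: has_real_derivative_iff_has_vector_derivative)
  have "norm (integral {p..q} g) \<le> integral {p..q} (\<lambda>t. - \<theta>'' t / (\<theta>' t)\<^sup>2)"
  proof (intro integral_norm_bound_integral ig has_integral_integrable[OF I2])
    fix t assume "t \<in> {p..q}"
    then show "norm (g t) \<le> - \<theta>'' t / (\<theta>' t)\<^sup>2"
      using neg[of t] by (simp add: g_def norm_mult norm_divide norm_power abs_of_nonpos)
  qed
  also have "\<dots> = 1 / \<theta>' q - 1 / \<theta>' p" using I2 by (rule integral_unique)
  also have "\<dots> \<le> 1 / m"
    using big
  proof
    assume *: "\<forall>t\<in>{p..q}. \<theta>' t \<ge> m"
    then have "\<theta>' q \<ge> m" "\<theta>' p \<ge> m" using \<open>p \<le> q\<close> by auto
    then have "1 / \<theta>' q \<le> 1 / m" "1 / \<theta>' p \<ge> 0"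
      using \<open>m > 0\<close> by (auto intro!: divide_left_mono mult_pos_pos)
    then show ?thesis by linarith
  next
    assume *: "\<forall>t\<in>{p..q}. \<theta>' t \<le> - m"
    then have "\<theta>' q \<le> -m" "\<theta>' p \<le> -m" using \<open>p \<le> q\<close> by auto
    then have "1 / \<theta>' q \<le> 0" "- (1 / \<theta>' p) \<le> 1 / m"
      using \<open>m > 0\<close> frac_le[of 1 1 m "- \<theta>' p"] by (auto simp: divide_le_0_iff)
    then show ?thesis by linarith
  qed
  finally have B: "norm (integral {p..q} g) \<le> 1 / m" .
  have Fb: "norm (F t) \<le> 1 / m" if "t \<in> {p..q}" for t
    using am[OF that] \<open>m > 0\<close> by (auto simp: F_def norm_mult norm_divide intro!: divide_left_mono mult_pos_pos)
  have "norm (integral {p..q} (\<lambda>t. cis (\<theta> t))) \<le> norm (F q) + norm (F p) + norm (integral {p..q} g)"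
    unfolding eq by (rule order_trans[OF norm_triangle_ineq add_right_mono[OF norm_triangle_ineq4]])
  also have "\<dots> \<le> 1 / m + 1 / m + 1 / m"
    using Fb \<open>p \<le> q\<close> B by (intro add_mono) auto
  finally show ?thesis by simp
qed

text \<open>
  The slope \<open>\<theta>'\<close> decreases at rate at least \<open>\<mu>\<close>, so it is smaller than \<open>sqrt \<mu>\<close> in modulus only
  within distance \<open>1 / sqrt \<mu>\<close> of one point. Near that point the integrand is bounded trivially, elsewhere
  the first derivative test applies.
\<close>

lemma second_derivative_test:
  fixes \<theta> \<theta>' \<theta>'' :: "real \<Rightarrow> real"
  assumes "p \<le> q" "\<mu> > 0"
    and d1: "\<And>t. t \<in> {p..q} \<Longrightarrow> (\<theta> has_field_derivative \<theta>' t) (at t)"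
    and d2: "\<And>t. t \<in> {p..q} \<Longrightarrow> (\<theta>' has_field_derivative \<theta>'' t) (at t)"
    and neg: "\<And>t. t \<in> {p..q} \<Longrightarrow> \<theta>'' t \<le> - \<mu>"
    and cont: "continuous_on {p..q} \<theta>''"
  shows "norm (integral {p..q} (\<lambda>t. cis (\<theta> t))) \<le> 8 / sqrt \<mu>"
proof -
  have c0: "continuous_on {p..q} \<theta>"
    by (rule DERIV_continuous_on[OF has_field_derivative_at_within[OF d1]])
  have c1: "continuous_on {p..q} \<theta>'"
    by (rule DERIV_continuous_on[OF has_field_derivative_at_within[OF d2]])
  have int: "(\<lambda>t. cis (\<theta> t)) integrable_on {u..v}" if "p \<le> u" "v \<le> q" for u v
    using that by (intro integrable_continuous_real continuous_on_cis continuous_on_subset[OF c0]) auto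
  have slope: "\<theta>' v \<le> \<theta>' u - \<mu> * (v - u)" if "p \<le> u" "u \<le> v" "v \<le> q" for u v
  proof (cases "u = v")
    case False
    have "\<exists>z>u. z < v \<and> \<theta>' v - \<theta>' u = (v - u) * \<theta>'' z"
    proof (rule MVT2)
      show "u < v" using False that by simp
      fix x assume "u \<le> x" "x \<le> v"
      then show "(\<theta>' has_field_derivative \<theta>'' x) (at x)" using that by (intro d2) auto
    qed
    then obtain z where z: "u < z" "z < v" "\<theta>' v - \<theta>' u = (v - u) * \<theta>'' z" by blast
    then have "(v - u) * \<theta>'' z \<le> (v - u) * (- \<mu>)" using that by (intro mult_left_mono neg) auto
    then show ?thesis using z by (simp add: algebra_simps)
  qed simp
  have neg0: "\<theta>'' t \<le> 0" if "t \<in> {p..q}" for t using neg[OF that] \<open>\<mu> > 0\<close> by linarith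
  \<comment> \<open>The zero of \<theta>', or the end point closest to where it would lie.\<close>
  obtain s where s: "s \<in> {p..q}" "\<theta>' s \<le> 0 \<or> s = q" "\<theta>' s \<ge> 0 \<or> s = p"
  proof -
    consider "\<theta>' p \<le> 0" | "\<theta>' q \<ge> 0" | "\<theta>' p > 0" "\<theta>' q < 0" by linarith
    then show ?thesis
    proof cases
      case 3
      have "\<exists>x\<ge>p. x \<le> q \<and> \<theta>' x = 0"
        using 3 \<open>p \<le> q\<close> c1 by (intro IVT2') auto
      then show ?thesis using that by force
    qed (use that \<open>p \<le> q\<close> in force)+
  qed
  define \<eta> where "\<eta> = 1 / sqrt \<mu>"
  have \<eta>: "\<eta> > 0" and mu_eta: "\<mu> * \<eta> = sqrt \<mu>"
    using \<open>\<mu> > 0\<close> by (simp_all add: \<eta>_def real_div_sqrt)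
  define u where "u = max p (s - \<eta>)"
  define v where "v = min q (s + \<eta>)"
  have order: "p \<le> u" "u \<le> s" "s \<le> v" "v \<le> q" using s \<eta> by (auto simp: u_def v_def)
  have 1: "norm (integral {p..u} (\<lambda>t. cis (\<theta> t))) \<le> 3 / sqrt \<mu>"
  proof (cases "p = u")
    case False
    then have u: "u = s - \<eta>" "p < u" by (auto simp: u_def)
    then have "s \<noteq> p" using \<eta> by auto
    then have "\<theta>' s \<ge> 0" using s by simp
    have "\<theta>' t \<ge> sqrt \<mu>" if "t \<in> {p..u}" for t
    proof -
      have "0 \<le> \<theta>' t - \<mu> * (s - t)" using slope[of t s] that order \<open>\<theta>' s \<ge> 0\<close> by auto
      moreover have "\<mu> * (s - t) \<ge> \<mu> * \<eta>" using that u \<open>\<mu> > 0\<close> by simp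
      ultimately show ?thesis using mu_eta by linarith
    qed
    then show ?thesis
      using order \<open>\<mu> > 0\<close> neg0 d1 d2
      by (intro first_derivative_test[of p u "sqrt \<mu>" \<theta> \<theta>' \<theta>''] continuous_on_subset[OF cont])
        auto
  qed (use \<open>\<mu> > 0\<close> in simp)
  have 2: "norm (integral {v..q} (\<lambda>t. cis (\<theta> t))) \<le> 3 / sqrt \<mu>"
  proof (cases "v = q")
    case False
    then have u: "v = s + \<eta>" "v < q" by (auto simp: v_def)
    then have "s \<noteq> q" using \<eta> by auto
    then have "\<theta>' s \<le> 0" using s by simp
    have "\<theta>' t \<le> - sqrt \<mu>" if "t \<in> {v..q}" for t
    proof -
      have "\<theta>' t \<le> 0 - \<mu> * (t - s)" using slope[of s t] that order \<open>\<theta>' s \<le> 0\<close> by auto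
      moreover have "\<mu> * (t - s) \<ge> \<mu> * \<eta>" using that u \<open>\<mu> > 0\<close> by simp
      ultimately show ?thesis using mu_eta by linarith
    qed
    then show ?thesis
      using order \<open>\<mu> > 0\<close> neg0 d1 d2
      by (intro first_derivative_test[of v q "sqrt \<mu>" \<theta> \<theta>' \<theta>''] continuous_on_subset[OF cont])
        auto
  qed (use \<open>\<mu> > 0\<close> in simp)
  have 3: "norm (integral {u..v} (\<lambda>t. cis (\<theta> t))) \<le> 2 / sqrt \<mu>"
  proof -
    have "norm (integral {u..v} (\<lambda>t. cis (\<theta> t))) \<le> 1 * (v - u)"
      using order by (intro integral_bound continuous_on_cis continuous_on_subset[OF c0]) auto
    also have "\<dots> \<le> 2 * \<eta>" by (simp add: u_def v_def)
    finally show ?thesis by (simp add: \<eta>_def)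
  qed
  have "integral {p..q} (\<lambda>t. cis (\<theta> t)) = integral {p..u} (\<lambda>t. cis (\<theta> t)) +
      (integral {u..v} (\<lambda>t. cis (\<theta> t)) + integral {v..q} (\<lambda>t. cis (\<theta> t)))"
    using order int by (simp add: Henstock_Kurzweil_Integration.integral_combine)
  also have "norm \<dots> \<le> 3 / sqrt \<mu> + (2 / sqrt \<mu> + 3 / sqrt \<mu>)"
    by (intro order_trans[OF norm_triangle_ineq] add_mono 1 2 3)
  finally show ?thesis by simp
qed

text \<open>
  Each term of the series only changes the frequency, and the assumed bound is uniform in the frequency.
\<close>

lemma fourier_bound_mult_exp_series:
  fixes g :: "real \<Rightarrow> complex" and c :: "nat \<Rightarrow> complex" and \<beta> :: "nat \<Rightarrow> real"
  assumes g: "continuous_on {p..q} g"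
    and B: "\<And>\<beta>. norm (integral {p..q} (\<lambda>t. g t * cis (\<beta> * t))) \<le> B"
    and c: "summable (\<lambda>n. norm (c n))"
  shows "norm (integral {p..q} (\<lambda>t. g t * (\<Sum>n. c n * cis (\<beta> n * t)) * cis (\<gamma> * t))) \<le> (\<Sum>n. norm (c n)) * B"
    (is "?L \<le> _")
    and "continuous_on {p..q} (\<lambda>t. \<Sum>n. c n * cis (\<beta> n * t))"
proof -
  have ul: "uniform_limit {p..q} (\<lambda>N t. \<Sum>n<N. c n * cis (\<beta> n * t)) (\<lambda>t. \<Sum>n. c n * cis (\<beta> n * t)) sequentially"
    by (rule Weierstrass_m_test[OF _ c]) (auto simp: norm_mult)
  show cD: "continuous_on {p..q} (\<lambda>t. \<Sum>n. c n * cis (\<beta> n * t))"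
    by (rule uniform_limit_theorem[OF _ ul])
      (auto intro!: always_eventually continuous_intros continuous_on_cis)
  have bg: "bounded (g ` {p..q})" by (intro compact_imp_bounded compact_continuous_image g) auto
  have bD: "bounded ((\<lambda>t. \<Sum>n. c n * cis (\<beta> n * t)) ` {p..q})"
    by (intro compact_imp_bounded compact_continuous_image cD) auto
  have "uniform_limit {p..q} (\<lambda>N t. (g t * cis (\<gamma> * t)) * (\<Sum>n<N. c n * cis (\<beta> n * t)))
      (\<lambda>t. (g t * cis (\<gamma> * t)) * (\<Sum>n. c n * cis (\<beta> n * t))) sequentially"
    by (intro uniform_lim_mult uniform_limit_const ul bD)
      (auto intro!: compact_imp_bounded compact_continuous_image continuous_intros continuous_on_cis g)
  then obtain I J where IJ: "\<And>N. ((\<lambda>t. (g t * cis (\<gamma> * t)) * (\<Sum>n<N. c n * cis (\<beta> n * t))) has_integral I N) {p..q}"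
    "((\<lambda>t. (g t * cis (\<gamma> * t)) * (\<Sum>n. c n * cis (\<beta> n * t))) has_integral J) {p..q}" "I \<longlonglongrightarrow> J"
    by (rule uniform_limit_integral) (auto intro!: continuous_intros continuous_on_cis g)
  have "norm (I N) \<le> (\<Sum>n. norm (c n)) * B" for N
  proof -
    have "I N = integral {p..q} (\<lambda>t. \<Sum>n<N. c n * (g t * cis ((\<gamma> + \<beta> n) * t)))"
      using IJ(1)[of N] by (simp add: integral_unique[symmetric] sum_distrib_left mult_ac ring_distribs flip: cis_mult)
    also have "\<dots> = (\<Sum>n<N. c n * integral {p..q} (\<lambda>t. g t * cis ((\<gamma> + \<beta> n) * t)))"
      by (subst integral_sum) (auto intro!: integrable_continuous_real continuous_intros continuous_on_cis g)
    also have "norm \<dots> \<le> (\<Sum>n<N. norm (c n) * B)"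
      by (intro sum_norm_le) (auto simp: norm_mult intro!: mult_left_mono B)
    also have "\<dots> = (\<Sum>n<N. norm (c n)) * B" by (simp add: sum_distrib_right)
    also have "\<dots> \<le> (\<Sum>n. norm (c n)) * B"
      using B[of 0] norm_ge_zero order_trans by (intro mult_right_mono sum_le_suminf c) (auto intro: order_trans[OF norm_ge_zero])
    finally show ?thesis .
  qed
  then have "norm J \<le> (\<Sum>n. norm (c n)) * B"
    using IJ(3) by (intro LIMSEQ_le_const2[OF tendsto_norm]) auto
  then show "?L \<le> (\<Sum>n. norm (c n)) * B"
    using IJ(2) by (simp add: integral_unique mult_ac)
qed

section \<open>A smooth cut-off\<close>

text \<open>
  The horizontal sides contribute at most \<open>M (b - a)\<close> each. The number \<open>c\<close> is the sum of the residues
  inside the rectangle; it is kept abstract so that the cases with and without a pole are both instances.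
\<close>

lemma rectangle_contour_shift:
  fixes g :: "complex \<Rightarrow> complex" and c :: complex
  assumes "a < b" "R > 0" "M \<ge> 0"
    and g: "(g has_contour_integral 2 * pi * \<i> * c) (rectpath (Complex a (-R)) (Complex b R))"
    and top: "\<And>\<sigma>. a \<le> \<sigma> \<Longrightarrow> \<sigma> \<le> b \<Longrightarrow> norm (g (Complex \<sigma> R)) \<le> M"
    and bot: "\<And>\<sigma>. a \<le> \<sigma> \<Longrightarrow> \<sigma> \<le> b \<Longrightarrow> norm (g (Complex \<sigma> (-R))) \<le> M"
  shows "norm (integral {-R..R} (\<lambda>t. g (Complex b t)) - integral {-R..R} (\<lambda>t. g (Complex a t)) - 2 * pi * c)
    \<le> 2 * M * (b - a)"
proof -
  define a1 a2 a3 a4 where "a1 = Complex a (-R)" and "a2 = Complex b (-R)" and "a3 = Complex b R" and "a4 = Complex a R"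
  have rp: "rectpath a1 a3 = linepath a1 a2 +++ linepath a2 a3 +++ linepath a3 a4 +++ linepath a4 a1"
    by (simp add: rectpath_def Let_def a1_def a2_def a3_def a4_def)
  have "g contour_integrable_on rectpath a1 a3"
    using g unfolding a1_def a3_def by (auto simp: contour_integrable_on_def)
  then have int: "g contour_integrable_on linepath a1 a2" "g contour_integrable_on linepath a2 a3"
    "g contour_integrable_on linepath a3 a4" "g contour_integrable_on linepath a4 a1"
    unfolding rp by simp_all
  have "2 * pi * \<i> * c = contour_integral (rectpath a1 a3) g"
    using contour_integral_unique[OF g] by (simp add: a1_def a3_def)
  also have "\<dots> = contour_integral (linepath a1 a2) g + contour_integral (linepath a2 a3) g
      + contour_integral (linepath a3 a4) g + contour_integral (linepath a4 a1) g"
    unfolding rp using int by simp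
  also have "contour_integral (linepath a2 a3) g = \<i> * integral {-R..R} (\<lambda>t. g (Complex b t))"
    using assms by (intro contour_integral_linepath_same_Re) (auto simp: a2_def a3_def)
  also have "contour_integral (linepath a4 a1) g = - contour_integral (linepath a1 a4) g"
    by (metis contour_integral_reversepath reversepath_linepath valid_path_linepath)
  also have "contour_integral (linepath a1 a4) g = \<i> * integral {-R..R} (\<lambda>t. g (Complex a t))"
    using assms by (intro contour_integral_linepath_same_Re) (auto simp: a1_def a4_def)
  finally have "\<i> * (integral {-R..R} (\<lambda>t. g (Complex b t)) - integral {-R..R} (\<lambda>t. g (Complex a t)) - 2 * pi * c)
      = - (contour_integral (linepath a1 a2) g + contour_integral (linepath a3 a4) g)"
    by (simp add: algebra_simps)
  then have "norm (integral {-R..R} (\<lambda>t. g (Complex b t)) - integral {-R..R} (\<lambda>t. g (Complex a t)) - 2 * pi * c)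
      = norm (contour_integral (linepath a1 a2) g + contour_integral (linepath a3 a4) g)"
    by (metis norm_ii norm_minus_cancel norm_mult mult_1)
  also have "\<dots> \<le> M * norm (a2 - a1) + M * norm (a4 - a3)"
  proof (intro order_trans[OF norm_triangle_ineq] add_mono)
    show "norm (contour_integral (linepath a1 a2) g) \<le> M * norm (a2 - a1)"
    proof (rule contour_integral_bound_linepath[OF int(1) \<open>M \<ge> 0\<close>])
      fix x assume "x \<in> closed_segment a1 a2"
      then have "x = Complex (Re x) (-R)" "a \<le> Re x" "Re x \<le> b"
        using \<open>a < b\<close> by (auto simp: a1_def a2_def closed_segment_same_Im closed_segment_eq_real_ivl complex_eq_iff)
      then show "norm (g x) \<le> M" using bot by metis
    qed
    show "norm (contour_integral (linepath a3 a4) g) \<le> M * norm (a4 - a3)"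
    proof (rule contour_integral_bound_linepath[OF int(3) \<open>M \<ge> 0\<close>])
      fix x assume "x \<in> closed_segment a3 a4"
      then have "x = Complex (Re x) R" "a \<le> Re x" "Re x \<le> b"
        using \<open>a < b\<close> by (auto simp: a3_def a4_def closed_segment_same_Im closed_segment_eq_real_ivl complex_eq_iff)
      then show "norm (g x) \<le> M" using top by metis
    qed
  qed
  also have "M * norm (a2 - a1) + M * norm (a4 - a3) = 2 * M * (b - a)"
    using \<open>a < b\<close> by (auto simp: a1_def a2_def a3_def a4_def cmod_def)
  finally show ?thesis .
qed

lemma cbox_Complex_subset_halfplane:
  assumes "e < a"
  shows "cbox (Complex a c) (Complex b d) \<subseteq> {z. Re z > e}"
  using assms by (auto simp: in_cbox_complex_iff)

lemma vertical_line_shift: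
  fixes g :: "complex \<Rightarrow> complex"
  assumes "a < b" "R > 0" "M \<ge> 0" "e < a"
    and g: "g holomorphic_on {z. Re z > e}"
    and top: "\<And>\<sigma>. a \<le> \<sigma> \<Longrightarrow> \<sigma> \<le> b \<Longrightarrow> norm (g (Complex \<sigma> R)) \<le> M"
    and bot: "\<And>\<sigma>. a \<le> \<sigma> \<Longrightarrow> \<sigma> \<le> b \<Longrightarrow> norm (g (Complex \<sigma> (-R))) \<le> M"
  shows "norm (integral {-R..R} (\<lambda>t. g (Complex b t)) - integral {-R..R} (\<lambda>t. g (Complex a t))) \<le> 2 * M * (b - a)"
proof -
  have "(g has_contour_integral 0) (rectpath (Complex a (-R)) (Complex b R))"
  proof (rule Cauchy_theorem_convex_simple[OF g convex_halfspace_Re_gt])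
    show "path_image (rectpath (Complex a (-R)) (Complex b R)) \<subseteq> {z. Re z > e}"
      using assms by (intro order_trans[OF path_image_rectpath_subset_cbox cbox_Complex_subset_halfplane[OF \<open>e < a\<close>]]) auto
  qed auto
  from rectangle_contour_shift[where c = 0, OF assms(1-3) _ top bot] this show ?thesis by simp
qed

text \<open>
  The residue of \<open>f(s)/s\<close> at \<open>0\<close> comes from the Cauchy integral formula for \<open>f\<close>.
\<close>

lemma vertical_line_shift_pole:
  fixes f :: "complex \<Rightarrow> complex"
  assumes "a < 0" "0 < b" "R > 0" "M \<ge> 0" "e < a"
    and f: "f holomorphic_on {z. Re z > e}"
    and top: "\<And>\<sigma>. a \<le> \<sigma> \<Longrightarrow> \<sigma> \<le> b \<Longrightarrow> norm (f (Complex \<sigma> R) / Complex \<sigma> R) \<le> M"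
    and bot: "\<And>\<sigma>. a \<le> \<sigma> \<Longrightarrow> \<sigma> \<le> b \<Longrightarrow> norm (f (Complex \<sigma> (-R)) / Complex \<sigma> (-R)) \<le> M"
  shows "norm (integral {-R..R} (\<lambda>t. f (Complex b t) / Complex b t)
    - integral {-R..R} (\<lambda>t. f (Complex a t) / Complex a t) - 2 * pi * f 0) \<le> 2 * M * (b - a)"
proof -
  let ?\<gamma> = "rectpath (Complex a (-R)) (Complex b R)"
  have box: "0 \<in> box (Complex a (-R)) (Complex b R)"
    using assms by (auto simp: in_box_complex_iff)
  have im: "path_image ?\<gamma> = cbox (Complex a (-R)) (Complex b R) - box (Complex a (-R)) (Complex b R)"
    using assms by (intro path_image_rectpath_cbox_minus_box) auto
  have "((\<lambda>w. f w / (w - 0)) has_contour_integral (2 * pi * \<i> * winding_number ?\<gamma> 0 * f 0)) ?\<gamma>"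
  proof (rule Cauchy_integral_formula_convex_simple[OF convex_halfspace_Re_gt f])
    show "0 \<in> interior {z. Re z > e}"
      using assms by (simp add: interior_open open_halfspace_Re_gt)
    show "path_image ?\<gamma> \<subseteq> {z. Re z > e} - {0}"
      unfolding im using box cbox_Complex_subset_halfplane[OF \<open>e < a\<close>] by blast
  qed auto
  then have I: "((\<lambda>w. f w / w) has_contour_integral (2 * pi * \<i> * f 0)) ?\<gamma>"
    using winding_number_rectpath[OF box] by simp
  show ?thesis
    using rectangle_contour_shift[OF _ \<open>R > 0\<close> \<open>M \<ge> 0\<close> I] top bot assms by fastforce
qed

text \<open>
  The factor \<open>1/s\<close> is the Mellin kernel of the sharp cut-off. Every factor \<open>1/(1 + h s)\<close> averages over a
  logarithmic scale \<open>h\<close> and improves the decay in vertical direction by one power of \<open>|Im s|\<close>.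
\<close>

definition riesz_kernel :: "real \<Rightarrow> nat \<Rightarrow> complex \<Rightarrow> complex" where
  "riesz_kernel h r s = 1 / (s * (1 + of_real h * s) ^ r)"

text \<open>
  The inverse Mellin transform of the kernel, truncated at height \<open>R\<close>. On the abscissa \<open>3\<close> a Dirichlet
  series with coefficients of size \<open>n\<close> has terms of size \<open>n^(-2)\<close> and converges absolutely.
\<close>

definition smooth_step :: "real \<Rightarrow> nat \<Rightarrow> real \<Rightarrow> real \<Rightarrow> complex" where
  "smooth_step h r R y =
     integral {-R..R} (\<lambda>t. of_real y powr Complex 3 t * riesz_kernel h r (Complex 3 t)) / (2 * pi)"

lemma riesz_kernel_denominator:
  assumes "h > 0"
  shows "h * \<bar>Im s\<bar> \<le> norm (1 + of_real h * s)"
    and "Re s \<ge> 0 \<Longrightarrow> 1 \<le> norm (1 + of_real h * s)"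
    and "Re s > 0 \<Longrightarrow> s \<noteq> 0" "Re s > 0 \<Longrightarrow> 1 + of_real h * s \<noteq> 0"
proof -
  show "h * \<bar>Im s\<bar> \<le> norm (1 + of_real h * s)"
    using abs_Im_le_cmod[of "1 + of_real h * s"] assms by (simp add: abs_mult)
  show "1 \<le> norm (1 + of_real h * s)" if "Re s \<ge> 0"
    using complex_Re_le_cmod[of "1 + of_real h * s"] that assms by (simp add: order_trans[rotated])
  show "s \<noteq> 0" if "Re s > 0" using that by auto
  show "1 + of_real h * s \<noteq> 0" if "Re s > 0"
  proof -
    have "Re (1 + of_real h * s) > 0" using that assms by (simp add: add_pos_pos)
    then show ?thesis by (metis less_irrefl zero_complex.sel(1))
  qed
qed

lemma holomorphic_riesz_kernel:
  assumes "h > 0"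
  shows "riesz_kernel h r holomorphic_on {s. Re s > 0}"
  unfolding riesz_kernel_def[abs_def] using riesz_kernel_denominator(3,4)[OF assms]
  by (intro holomorphic_intros) auto

lemma continuous_on_riesz_kernel_line:
  assumes "h > 0" "c > 0"
  shows "continuous_on S (\<lambda>t. riesz_kernel h r (Complex c t))"
  by (rule continuous_on_compose2[OF holomorphic_on_imp_continuous_on[OF holomorphic_riesz_kernel[OF assms(1)]]])
    (use assms in \<open>auto intro!: continuous_intros\<close>)

lemma norm_riesz_kernel_le:
  assumes "h > 0" "r \<ge> 1" "Re s \<ge> 0" "norm s \<ge> R" "R > 0"
  shows "norm (riesz_kernel h r s) \<le> 1 / (h * R\<^sup>2)"
proof -
  have "h * R \<le> norm (of_real h * s)" using assms by (simp add: norm_mult)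
  also have "\<dots> \<le> norm (1 + of_real h * s)"
  proof -
    have "(h * Re s)\<^sup>2 \<le> (1 + h * Re s)\<^sup>2" using assms by (intro power_mono) auto
    then show ?thesis by (simp add: cmod_def)
  qed
  also have "\<dots> = norm (1 + of_real h * s) ^ 1" by simp
  also have "\<dots> \<le> norm (1 + of_real h * s) ^ r"
    using riesz_kernel_denominator(2)[OF \<open>h > 0\<close>] assms by (intro power_increasing) auto
  finally have *: "h * R \<le> norm (1 + of_real h * s) ^ r" .
  have "h * R\<^sup>2 = R * (h * R)" by (simp add: power2_eq_square)
  also have "\<dots> \<le> norm s * norm (1 + of_real h * s) ^ r"
    using * assms by (intro mult_mono) auto
  finally have "h * R\<^sup>2 \<le> norm s * norm (1 + of_real h * s) ^ r" .
  then show ?thesis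
    using assms frac_le[of 1 1 "h * R\<^sup>2" "norm s * norm (1 + of_real h * s) ^ r"]
    by (simp add: riesz_kernel_def norm_divide norm_mult norm_power)
qed

text \<open>
  To the right of the abscissa \<open>3\<close> there are no poles, so the line can be moved as far as \<open>Re s = R\<close>, where
  both the kernel and \<open>y^s\<close> are small.
\<close>

lemma smooth_step_small:
  assumes "h > 0" "r \<ge> 1" "R \<ge> 4" "0 < y" "y < 1"
  shows "norm (smooth_step h r R y) \<le> y ^ 3 / (h * R)"
proof -
  let ?g = "\<lambda>s. of_real y powr s * riesz_kernel h r s"
  define M where "M = y ^ 3 / (h * R\<^sup>2)"
  have M: "norm (?g s) \<le> M" if "Re s \<ge> 3" "norm s \<ge> R" for s
  proof -
    have "norm (?g s) = y powr Re s * norm (riesz_kernel h r s)"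
      using assms by (simp add: norm_mult norm_powr_real_powr)
    also have "\<dots> \<le> y ^ 3 * (1 / (h * R\<^sup>2))"
    proof (intro mult_mono norm_riesz_kernel_le)
      have "y powr Re s \<le> y powr 3" using assms that by (intro powr_mono') auto
      then show "y powr Re s \<le> y ^ 3" using assms by (simp add: powr_realpow[of y 3, simplified])
    qed (use assms that in auto)
    finally show ?thesis by (simp add: M_def)
  qed
  have M0: "M \<ge> 0" using assms by (simp add: M_def)
  have hol: "?g holomorphic_on {z. Re z > 0}"
    using assms by (intro holomorphic_intros holomorphic_riesz_kernel) auto
  have "norm (integral {-R..R} (\<lambda>t. ?g (Complex R t)) - integral {-R..R} (\<lambda>t. ?g (Complex 3 t))) \<le> 2 * M * (R - 3)"
  proof (rule vertical_line_shift[OF _ _ M0 _ hol])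
    fix \<sigma> assume "3 \<le> \<sigma>" "\<sigma> \<le> R"
    show "norm (?g (Complex \<sigma> R)) \<le> M"
      using \<open>3 \<le> \<sigma>\<close> assms abs_Im_le_cmod[of "Complex \<sigma> R"] by (intro M) auto
    show "norm (?g (Complex \<sigma> (-R))) \<le> M"
      using \<open>3 \<le> \<sigma>\<close> assms abs_Im_le_cmod[of "Complex \<sigma> (-R)"] by (intro M) auto
  qed (use assms in auto)
  moreover have "norm (integral {-R..R} (\<lambda>t. ?g (Complex R t))) \<le> M * (R - (-R))"
  proof (rule integral_bound)
    show "continuous_on {-R..R} (\<lambda>t. ?g (Complex R t))"
      using assms by (intro continuous_on_compose2[OF holomorphic_on_imp_continuous_on[OF hol]] continuous_intros) auto
    fix t show "norm (?g (Complex R t)) \<le> M"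
      using assms abs_Re_le_cmod[of "Complex R t"] by (intro M) auto
  qed (use assms in auto)
  ultimately have "norm (integral {-R..R} (\<lambda>t. ?g (Complex 3 t))) \<le> 2 * M * (R - 3) + 2 * M * R"
    using norm_triangle_ineq4[of "integral {-R..R} (\<lambda>t. ?g (Complex R t))"
      "integral {-R..R} (\<lambda>t. ?g (Complex R t)) - integral {-R..R} (\<lambda>t. ?g (Complex 3 t))"]
    by simp
  also have "\<dots> \<le> 4 * M * R" using M0 by (simp add: algebra_simps)
  also have "\<dots> = 4 * (y ^ 3 / (h * R))"
    using assms by (simp add: M_def power2_eq_square)
  also have "\<dots> \<le> (2 * pi) * (y ^ 3 / (h * R))"
    using assms pi_gt3 by (intro mult_right_mono) auto
  finally show ?thesis
    unfolding smooth_step_def norm_divide by (simp add: field_simps norm_mult)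
qed

text \<open>
  Moving the line to the left passes the pole at \<open>0\<close>, whose residue is the main term \<open>1\<close>. The new line is
  placed halfway to the next pole \<open>-1/h\<close>. There \<open>|1 + h s| = h |s|\<close>, and the integrand is dominated by the
  derivative of an arctangent, which bounds the integral independently of \<open>h\<close> and \<open>R\<close>.
\<close>

lemma smooth_step_large:
  assumes "h > 0" "r \<ge> 1" "R \<ge> 4" "h * R \<ge> 1" "1 \<le> y"
  shows "norm (smooth_step h r R y - 1) \<le> 2 ^ r * y powr (-1 / (2 * h)) + y ^ 3 / (h * R)"
proof -
  \<comment> \<open>Halfway between the poles at 0 and -1/h.\<close>
  define a where "a = - 1 / (2 * h)"
  have a: "a < 0" "-1 / h < a" using assms by (auto simp: a_def field_simps)
  let ?f = "\<lambda>s::complex. of_real y powr s / (1 + of_real h * s) ^ r"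
  define M where "M = y ^ 3 / (h * R\<^sup>2)"
  have M0: "M \<ge> 0" using assms by (simp add: M_def)
  have nz: "1 + of_real h * s \<noteq> 0" if "Re s > -1/h" for s :: complex
  proof
    assume "1 + of_real h * s = 0"
    then have "Re (1 + of_real h * s) = 0" by simp
    then show False using that assms by (simp add: field_simps)
  qed
  have hol: "?f holomorphic_on {z. Re z > -1/h}"
    using assms nz by (intro holomorphic_intros) auto
  have M: "norm (?f s / s) \<le> M" if s: "Re s \<le> 3" "\<bar>Im s\<bar> = R" for s
  proof -
    have "y powr Re s \<le> y powr 3" using assms s by (intro powr_mono) auto
    then have y: "y powr Re s \<le> y ^ 3" using assms by (simp add: powr_realpow[of y 3, simplified])
    have 1: "R \<le> norm s" using abs_Im_le_cmod[of s] s by simp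
    have 2: "h * R \<le> norm (1 + of_real h * s)" using riesz_kernel_denominator(1)[of h s] s assms by simp
    also have "norm (1 + of_real h * s) \<le> norm (1 + of_real h * s) ^ r"
      using assms 2 power_increasing[of 1 r "norm (1 + of_real h * s)"] by simp
    finally have 3: "h * R \<le> norm (1 + of_real h * s) ^ r" .
    have "norm (?f s / s) = y powr Re s / (norm (1 + of_real h * s) ^ r * norm s)"
      using assms by (simp add: norm_divide norm_mult norm_power norm_powr_real_powr)
    also have "\<dots> \<le> y ^ 3 / (h * R * R)"
      using assms y 1 3 by (intro frac_le mult_mono) auto
    finally show ?thesis by (simp add: M_def power2_eq_square mult_ac)
  qed
  have shift: "norm (integral {-R..R} (\<lambda>t. ?f (Complex 3 t) / Complex 3 t)
    - integral {-R..R} (\<lambda>t. ?f (Complex a t) / Complex a t) - 2 * pi * ?f 0) \<le> 2 * M * (3 - a)"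
    by (rule vertical_line_shift_pole[OF _ _ _ M0 a(2) hol]) (use assms a M in auto)
  have left: "norm (integral {-R..R} (\<lambda>t. ?f (Complex a t) / Complex a t)) \<le> 2 * pi * (2 ^ r * y powr a)"
  proof -
    have der: "((\<lambda>t. 2 * arctan (2 * h * t)) has_real_derivative h / (1/4 + h\<^sup>2 * t\<^sup>2)) (at t within {-R..R})" for t
    proof -
      have "1 + (2 * h * t)\<^sup>2 > 0" by (rule add_pos_nonneg) auto
      then have "2 * (inverse (1 + (2 * h * t)\<^sup>2) * (2 * h)) = h / (1/4 + h\<^sup>2 * t\<^sup>2)"
        by (simp add: divide_simps power_mult_distrib)
      then show ?thesis by (auto intro!: derivative_eq_intros)
    qed
    have I: "((\<lambda>t. h / (1/4 + h\<^sup>2 * t\<^sup>2)) has_integral 2 * arctan (2 * h * R) - 2 * arctan (2 * h * (-R))) {-R..R}"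
      using assms der by (intro fundamental_theorem_of_calculus) (auto simp: has_real_derivative_iff_has_vector_derivative)
    have I': "((\<lambda>t. 2 ^ r * y powr a * (h / (1/4 + h\<^sup>2 * t\<^sup>2))) has_integral 2 ^ r * y powr a * (2 * arctan (2 * h * R) - 2 * arctan (2 * h * (-R)))) {-R..R}"
      by (rule has_integral_mult_right[OF I])
    have cont: "continuous_on {-R..R} (\<lambda>t. ?f (Complex a t) / Complex a t)"
      using a assms by (intro continuous_on_divide continuous_on_compose2[OF holomorphic_on_imp_continuous_on[OF hol]] continuous_intros)
        (auto simp: complex_eq_iff)
    have "norm (integral {-R..R} (\<lambda>t. ?f (Complex a t) / Complex a t)) \<le> integral {-R..R} (\<lambda>t. 2 ^ r * y powr a * (h / (1/4 + h\<^sup>2 * t\<^sup>2)))"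
    proof (intro integral_norm_bound_integral integrable_continuous_real[OF cont] has_integral_integrable[OF I'])
      fix t
      define n where "n = norm (Complex (1/2) (h * t))"
      have n2: "n\<^sup>2 = 1/4 + h\<^sup>2 * t\<^sup>2" unfolding n_def cmod_power2 by (simp add: power_mult_distrib power2_eq_square)
      have n: "n \<ge> 1/2" using abs_Re_le_cmod[of "Complex (1/2) (h * t)"] by (simp add: n_def)
      have n1: "norm (1 + of_real h * Complex a t) = n"
      proof -
        have "1 + of_real h * Complex a t = Complex (1/2) (h * t)" using assms by (simp add: complex_eq_iff a_def)
        then show ?thesis by (simp add: n_def)
      qed
      \<comment> \<open>h s is the reflection of 1 + h s in the imaginary axis.\<close>
      have n3: "norm (Complex a t) = n / h"
      proof -
        have "of_real h * Complex a t = - cnj (Complex (1/2) (h * t))" using assms by (simp add: complex_eq_iff a_def)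
        then have "h * norm (Complex a t) = n"
          using assms unfolding n_def by (metis abs_of_pos complex_mod_cnj norm_minus_cancel norm_mult norm_of_real)
        then show ?thesis using assms by (simp add: field_simps)
      qed
      have "norm (?f (Complex a t) / Complex a t) = y powr a * (h / (n ^ r * n))"
        using assms by (simp add: norm_divide norm_mult norm_power norm_powr_real_powr n1 n3)
      moreover have "h / (n ^ r * n) \<le> h / ((1/2) ^ r * n\<^sup>2)"
      proof (rule divide_left_mono)
        obtain r' where r': "r = Suc r'" using assms by (cases r) auto
        have "(1/2) ^ r * n\<^sup>2 \<le> (1/2) ^ r' * n\<^sup>2" by (simp add: r')
        also have "\<dots> \<le> n ^ r' * n\<^sup>2" using n by (intro mult_right_mono power_mono) auto
        also have "\<dots> = n ^ r * n" by (simp add: r' power2_eq_square mult_ac)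
        finally show "(1/2) ^ r * n\<^sup>2 \<le> n ^ r * n" .
      qed (use assms n in auto)
      moreover have "h / ((1/2) ^ r * n\<^sup>2) = 2 ^ r * (h / (1/4 + h\<^sup>2 * t\<^sup>2))"
        by (simp add: n2 power_one_over divide_simps)
      ultimately have "norm (?f (Complex a t) / Complex a t) \<le> y powr a * (2 ^ r * (h / (1/4 + h\<^sup>2 * t\<^sup>2)))"
        by (simp only:) (rule mult_left_mono, simp_all)
      then show "norm (?f (Complex a t) / Complex a t) \<le> 2 ^ r * y powr a * (h / (1/4 + h\<^sup>2 * t\<^sup>2))"
        by (simp only: mult_ac)
    qed
    also have "\<dots> = 2 ^ r * y powr a * (4 * arctan (2 * h * R))"
      using I' by (simp add: integral_unique arctan_minus)
    also have "\<dots> \<le> 2 ^ r * y powr a * (2 * pi)"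
      using arctan_ubound[of "2 * h * R"] by (intro mult_left_mono) auto
    finally show ?thesis by (simp add: mult_ac)
  qed
  have "2 * M * (3 - a) \<le> 2 * pi * (y ^ 3 / (h * R))"
  proof -
    have "3 - a \<le> R + R / 2"
    proof -
      have "1 / h \<le> R" using assms by (simp add: field_simps)
      then show ?thesis using assms unfolding a_def by simp
    qed
    then have "2 * M * (3 - a) \<le> 2 * M * (R + R / 2)" using M0 by (intro mult_left_mono) auto
    also have "\<dots> = 3 * (y ^ 3 / (h * R))" using assms by (simp add: M_def power2_eq_square)
    also have "\<dots> \<le> (2 * pi) * (y ^ 3 / (h * R))" using assms pi_gt3 by (intro mult_right_mono) auto
    finally show ?thesis .
  qed
  moreover have "?f 0 = 1" using assms by simp
  ultimately have "norm (integral {-R..R} (\<lambda>t. ?f (Complex 3 t) / Complex 3 t) - 2 * pi)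
      \<le> 2 * pi * (2 ^ r * y powr a) + 2 * pi * (y ^ 3 / (h * R))"
    using shift left norm_triangle_ineq[of "integral {-R..R} (\<lambda>t. ?f (Complex a t) / Complex a t)"
       "integral {-R..R} (\<lambda>t. ?f (Complex 3 t) / Complex 3 t) - integral {-R..R} (\<lambda>t. ?f (Complex a t) / Complex a t) - 2 * pi"]
    by (simp add: algebra_simps)
  also have "\<dots> = 2 * pi * (2 ^ r * y powr a + y ^ 3 / (h * R))" by (simp add: algebra_simps)
  finally have A: "norm (integral {-R..R} (\<lambda>t. ?f (Complex 3 t) / Complex 3 t) - 2 * pi)
      \<le> 2 * pi * (2 ^ r * y powr a + y ^ 3 / (h * R))" .
  have "smooth_step h r R y - 1 = (integral {-R..R} (\<lambda>t. ?f (Complex 3 t) / Complex 3 t) - 2 * pi) / (2 * pi)"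
    by (simp add: smooth_step_def riesz_kernel_def diff_divide_distrib mult_ac)
  also have "norm \<dots> = norm (integral {-R..R} (\<lambda>t. ?f (Complex 3 t) / Complex 3 t) - 2 * pi) / (2 * pi)"
    by (simp add: norm_divide norm_mult)
  also have "\<dots> \<le> 2 ^ r * y powr a + y ^ 3 / (h * R)" using A by (simp add: field_simps)
  finally show ?thesis by (simp add: a_def)
qed

section \<open>Analytic continuation of the polylogarithm\<close>

text \<open>
  Two summations by parts replace the terms \<open>n^(-s)\<close> of the polylogarithm by these second differences,
  which are smaller by a factor \<open>n^2\<close>. At \<open>n = 0\<close> the convention \<open>0 powr w = 0\<close> drops the last summand, as
  it has to for a series that starts with \<open>n = 1\<close>.
\<close>

definition second_diff_powr :: "nat \<Rightarrow> complex \<Rightarrow> complex" where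
  "second_diff_powr n s = of_nat (n + 2) powr (- s) - 2 * of_nat (n + 1) powr (- s) + of_nat n powr (- s)"

text \<open>
  Two applications of the mean value inequality on the half-line \<open>[n, \<infinity>)\<close>, where the second derivative
  \<open>s (s + 1) z^(-s - 2)\<close> is largest at \<open>n\<close>.
\<close>

lemma norm_second_diff_powr_le:
  assumes "n \<ge> 1" "Re s \<ge> - 2"
  shows "norm (second_diff_powr n s) \<le> norm s * norm (s + 1) * real n powr (- Re s - 2)"
proof -
  define B where "B = norm s * norm (s + 1) * real n powr (- Re s - 2)"
  define S where "S = complex_of_real ` {real n..}"
  have cS: "convex S" unfolding S_def by (intro convex_linear_image) auto
  have S: "z \<notin> \<real>\<^sub>\<le>\<^sub>0" if "z \<in> S" for z
    using that assms by (auto simp: S_def complex_nonpos_Reals_iff)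
  have S1: "z + 1 \<in> S" if "z \<in> S" for z
  proof -
    from that obtain u where "u \<ge> real n" "z = of_real u" by (auto simp: S_def)
    then show ?thesis unfolding S_def by (intro image_eqI[of _ _ "u + 1"]) auto
  qed
  have d2: "((\<lambda>z. - s * z powr (- s - 1)) has_field_derivative s * (s + 1) * z powr (- s - 2)) (at z within S)"
    if "z \<in> S" for z
    using S[OF that] by (auto intro!: derivative_eq_intros simp: algebra_simps)
  have b2: "norm (s * (s + 1) * z powr (- s - 2)) \<le> B" if "z \<in> S" for z
  proof -
    from that obtain u where u: "u \<ge> real n" "z = of_real u" by (auto simp: S_def)
    have "norm (z powr (- s - 2)) = u powr (- Re s - 2)"
      using u assms by (simp add: norm_powr_real_powr)
    also have "\<dots> \<le> real n powr (- Re s - 2)"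
      using u assms by (intro powr_mono2') auto
    finally show ?thesis unfolding B_def norm_mult by (intro mult_left_mono) auto
  qed
  define g where "g z = (z + 1) powr (- s) - z powr (- s)" for z :: complex
  have d1: "(g has_field_derivative (- s * (z + 1) powr (- s - 1)) - (- s * z powr (- s - 1))) (at z within S)"
    if "z \<in> S" for z
    unfolding g_def using S[OF that] S[OF S1[OF that]]
    by (auto intro!: derivative_eq_intros)
  have b1: "norm ((- s * (z + 1) powr (- s - 1)) - (- s * z powr (- s - 1))) \<le> B" if "z \<in> S" for z
    using field_differentiable_bound[OF cS d2 b2 S1[OF that] that] by simp
  have nS: "of_nat n \<in> S" unfolding S_def by (intro image_eqI[of _ _ "real n"]) auto
  have "norm (g (of_nat n + 1) - g (of_nat n)) \<le> B * norm (of_nat n + 1 - of_nat n :: complex)"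
    by (rule field_differentiable_bound[OF cS d1 b1 S1[OF nS] nS])
  then show ?thesis by (simp add: B_def g_def second_diff_powr_def add_ac)
qed

lemma summable_const_mult_powr:
  assumes "\<sigma> < 1" "M \<ge> 0"
  shows "summable (\<lambda>n. M * real n powr (\<sigma> - 2))"
  using assms by (intro summable_mult) (simp add: summable_real_powr_iff)

lemma norm_second_diff_powr_le':
  assumes "n \<ge> 1" "Re s \<ge> - \<sigma>" "norm s \<le> M" "\<sigma> \<le> 2"
  shows "norm (second_diff_powr n s) \<le> M * (M + 1) * real n powr (\<sigma> - 2)"
proof -
  have "norm (second_diff_powr n s) \<le> norm s * norm (s + 1) * real n powr (- Re s - 2)"
    using assms by (intro norm_second_diff_powr_le) auto
  also have "\<dots> \<le> M * (M + 1) * real n powr (\<sigma> - 2)"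
  proof -
    have "M \<ge> 0" using assms(3) norm_ge_zero order_trans by blast
    then show ?thesis
      using assms norm_triangle_ineq[of s 1] by (intro mult_mono powr_mono mult_nonneg_nonneg) auto
  qed
  finally show ?thesis .
qed

text \<open>
  The analytic continuation of \<open>\<Sum> z^n n^(-s)\<close> to \<open>Re s > -1\<close>, for \<open>z \<noteq> 1\<close> on the unit circle.
\<close>

definition polylog_cont :: "complex \<Rightarrow> complex \<Rightarrow> complex" where
  "polylog_cont z s = (z + (\<Sum>n. z ^ (n + 2) * second_diff_powr n s)) / (1 - z)\<^sup>2"

lemma summable_polylog_cont:
  assumes "norm z = 1" "Re s > -1"
  shows "summable (\<lambda>n. norm (z ^ (n + 2) * second_diff_powr n s))"
proof (rule summable_comparison_test_ev)
  show "summable (\<lambda>n. norm s * (norm s + 1) * real n powr (- Re s - 2))"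
    using summable_const_mult_powr[of "- Re s" "norm s * (norm s + 1)"] assms by simp
  show "\<forall>\<^sub>F n in sequentially. norm (norm (z ^ (n + 2) * second_diff_powr n s)) \<le> norm s * (norm s + 1) * real n powr (- Re s - 2)"
    using eventually_ge_at_top[of 1]
  proof eventually_elim
    case (elim n)
    then show ?case using norm_second_diff_powr_le'[of n "- Re s" s "norm s"] assms
      by (simp add: norm_mult norm_power)
  qed
qed

lemma holomorphic_polylog_cont:
  assumes "norm z = 1" "z \<noteq> 1"
  shows "polylog_cont z holomorphic_on {s. Re s > -1}"
proof -
  have "(\<lambda>s. \<Sum>n. z ^ (n + 2) * second_diff_powr n s) holomorphic_on {s. Re s > -1}"
  proof (rule holomorphic_uniform_sequence[OF open_halfspace_Re_gt])
    fix N
    have "second_diff_powr n holomorphic_on {s. Re s > -1}" for n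
    proof (cases "n = 0")
      case True
      then show ?thesis unfolding second_diff_powr_def by (auto intro!: holomorphic_intros)
    qed (auto simp: second_diff_powr_def[abs_def] intro!: holomorphic_intros)
    then show "(\<lambda>s. \<Sum>n<N. z ^ (n + 2) * second_diff_powr n s) holomorphic_on {s. Re s > -1}"
      by (intro holomorphic_intros)
  next
    fix s0 :: complex assume s0: "s0 \<in> {s. Re s > -1}"
    define d where "d = (Re s0 + 1) / 2"
    have d: "d > 0" using s0 by (simp add: d_def)
    have cb: "Re s \<ge> -(1 - d) \<and> norm s \<le> norm s0 + d" if "s \<in> cball s0 d" for s
    proof
      have "norm (s - s0) \<le> d" using that by (simp add: dist_norm norm_minus_commute)
      then have "\<bar>Re (s - s0)\<bar> \<le> d" using abs_Re_le_cmod order_trans by blast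
      then have "Re s0 - Re s \<le> d" by simp
      then show "Re s \<ge> -(1 - d)" unfolding d_def by (simp add: field_simps)
      show "norm s \<le> norm s0 + d"
        using \<open>norm (s - s0) \<le> d\<close> norm_triangle_ineq2[of s s0] by linarith
    qed
    have "uniform_limit (cball s0 d) (\<lambda>N s. \<Sum>n<N. z ^ (n + 2) * second_diff_powr n s)
        (\<lambda>s. \<Sum>n. z ^ (n + 2) * second_diff_powr n s) sequentially"
    proof (rule Weierstrass_m_test_ev)
      let ?M = "norm s0 + d"
      show "summable (\<lambda>n. ?M * (?M + 1) * real n powr ((1 - d) - 2))"
        using d by (intro summable_const_mult_powr) auto
      show "\<forall>\<^sub>F n in sequentially. \<forall>s\<in>cball s0 d. norm (z ^ (n + 2) * second_diff_powr n s) \<le> ?M * (?M + 1) * real n powr ((1 - d) - 2)"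
        using eventually_ge_at_top[of 1]
      proof eventually_elim
        case (elim n)
        show ?case
        proof
          fix s assume "s \<in> cball s0 d"
          from cb[OF this] show "norm (z ^ (n + 2) * second_diff_powr n s) \<le> ?M * (?M + 1) * real n powr ((1 - d) - 2)"
            using norm_second_diff_powr_le'[OF elim, of "1 - d" s ?M] d assms by (simp add: norm_mult norm_power)
        qed
      qed
    qed
    moreover have "cball s0 d \<subseteq> {s. Re s > -1}" using cb d by force
    ultimately show "\<exists>d>0. cball s0 d \<subseteq> {s. Re s > -1} \<and> uniform_limit (cball s0 d) (\<lambda>N s. \<Sum>n<N. z ^ (n + 2) * second_diff_powr n s)
        (\<lambda>s. \<Sum>n. z ^ (n + 2) * second_diff_powr n s) sequentially"
      using d by blast
  qed
  then show ?thesis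
    unfolding polylog_cont_def[abs_def] using assms by (intro holomorphic_intros) auto
qed

text \<open>
  The factor \<open>s (s + 1)\<close> in the bound for the second differences is the only source of growth.
\<close>

lemma polylog_cont_polynomial_growth:
  assumes "norm z = 1" "z \<noteq> 1"
  obtains C where "C > 0" "\<And>s. Re s \<ge> -1/2 \<Longrightarrow> norm (polylog_cont z s) \<le> C * (1 + norm s) ^ 2"
proof -
  define Z where "Z = (\<Sum>n. real (Suc n) powr (1/2 - 2))"
  have sumZ: "summable (\<lambda>n. real (Suc n) powr (1/2 - 2))"
    using summable_const_mult_powr[of "1/2" 1] summable_Suc_iff[of "\<lambda>n. real n powr (1/2 - 2)"] by simp
  have Z: "Z \<ge> 0" unfolding Z_def by (intro suminf_nonneg sumZ) auto
  have *: "norm (\<Sum>n. z ^ (n + 2) * second_diff_powr n s) \<le> (4 + Z) * (1 + norm s) ^ 2" if s: "Re s \<ge> -1/2" for s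
  proof -
    let ?f = "\<lambda>n. z ^ (n + 2) * second_diff_powr n s"
    have sm: "summable (\<lambda>n. norm (?f n))" using s assms by (intro summable_polylog_cont) auto
    then have sm1: "summable (\<lambda>n. norm (?f (Suc n)))" by (subst summable_Suc_iff)
    have "norm (\<Sum>n. ?f n) \<le> (\<Sum>n. norm (?f n))" by (rule summable_norm[OF sm])
    also have "\<dots> = norm (?f 0) + (\<Sum>n. norm (?f (Suc n)))" using suminf_split_head[OF sm] by simp
    also have "norm (?f 0) \<le> 4 * (1 + norm s) ^ 2"
    proof -
      have "norm (second_diff_powr 0 s) \<le> norm ((2::complex) powr (- s)) + 2"
        unfolding second_diff_powr_def using norm_triangle_ineq4[of "(2::complex) powr (- s)" 2] by simp
      also have "norm ((2::complex) powr (- s)) = 2 powr (- Re s)"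
        using norm_powr_real_powr[of 2 "- s"] by simp
      also have "\<dots> \<le> 2 powr 1" using s by (intro powr_mono) auto
      finally have "norm (second_diff_powr 0 s) \<le> 4" by simp
      also have "4 \<le> 4 * (1 + norm s) ^ 2" by (simp add: power2_eq_square algebra_simps)
      finally show ?thesis using assms by (simp add: norm_mult norm_power)
    qed
    also have "(\<Sum>n. norm (?f (Suc n))) \<le> (\<Sum>n. (1 + norm s) ^ 2 * real (Suc n) powr (1/2 - 2))"
    proof (intro suminf_le sm1 summable_mult sumZ)
      fix n
      have "norm (?f (Suc n)) \<le> norm s * (norm s + 1) * real (Suc n) powr (1/2 - 2)"
        using norm_second_diff_powr_le'[of "Suc n" "1/2" s "norm s"] s assms
        by (simp add: norm_mult norm_power del: of_nat_Suc)
      also have "\<dots> \<le> (1 + norm s) ^ 2 * real (Suc n) powr (1/2 - 2)"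
        by (intro mult_right_mono) (auto simp: power2_eq_square algebra_simps)
      finally show "norm (?f (Suc n)) \<le> (1 + norm s) ^ 2 * real (Suc n) powr (1/2 - 2)" .
    qed
    also have "\<dots> = (1 + norm s) ^ 2 * Z" unfolding Z_def by (rule suminf_mult[OF sumZ])
    finally show ?thesis by (simp add: algebra_simps)
  qed
  show ?thesis
  proof
    let ?C = "(5 + Z) / norm (1 - z) ^ 2"
    show "?C > 0" using Z assms by (intro divide_pos_pos) auto
    fix s :: complex assume s: "Re s \<ge> -1/2"
    have "1 \<le> (1 + norm s) ^ 2" by simp
    then have "norm (z + (\<Sum>n. z ^ (n + 2) * second_diff_powr n s)) \<le> (1 + norm s) ^ 2 + (4 + Z) * (1 + norm s) ^ 2"
      using *[OF s] assms by (intro order_trans[OF norm_triangle_ineq] add_mono) auto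
    also have "\<dots> = (5 + Z) * (1 + norm s) ^ 2" by (simp add: algebra_simps)
    finally show "norm (polylog_cont z s) \<le> ?C * (1 + norm s) ^ 2"
      unfolding polylog_cont_def norm_divide norm_power using assms by (simp add: divide_right_mono)
  qed
qed

text \<open>
  Multiplying the Dirichlet series by \<open>(1 - z)^2\<close> and collecting equal powers of \<open>z\<close> produces the
  second differences.
\<close>

lemma polylog_cont_eq_Dirichlet_series:
  assumes "norm z = 1" "z \<noteq> 1" "Re s > 1"
  shows "(\<lambda>n. z ^ n * of_nat n powr (- s)) sums polylog_cont z s"
    and "summable (\<lambda>n. norm (z ^ n * of_nat n powr (- s)))"
proof -
  define u where "u n = z ^ n * of_nat n powr (- s)" for n
  have "norm (u n) = real n powr (- Re s)" for n
    using assms by (simp add: u_def norm_mult norm_power norm_powr_real_powr)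
  then have sm: "summable (\<lambda>n. norm (u n))" using assms by (simp add: summable_real_powr_iff)
  then show "summable (\<lambda>n. norm (z ^ n * of_nat n powr (- s)))" by (simp add: u_def)
  define U where "U = suminf u"
  have u0: "u sums U" unfolding U_def using summable_norm_cancel[OF sm] by (rule summable_sums)
  have u00: "u 0 = 0" and u01: "u 1 = z" by (simp_all add: u_def)
  have u1: "(\<lambda>n. u (n + 1)) sums U" using sums_split_initial_segment[OF u0, of 1] u00 by simp
  have u2: "(\<lambda>n. u (n + 2)) sums (U - z)"
    using sums_split_initial_segment[OF u0, of 2] u00 u01 by (simp add: numeral_2_eq_2)
  have "(\<lambda>n. u (n + 2) - 2 * z * u (n + 1) + z\<^sup>2 * u n) sums ((U - z) - 2 * z * U + z\<^sup>2 * U)"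
    by (intro sums_add sums_diff sums_mult u0 u1 u2)
  also have "(\<lambda>n. u (n + 2) - 2 * z * u (n + 1) + z\<^sup>2 * u n) = (\<lambda>n. z ^ (n + 2) * second_diff_powr n s)"
    by (simp add: fun_eq_iff u_def second_diff_powr_def power2_eq_square algebra_simps)
  finally have "(\<Sum>n. z ^ (n + 2) * second_diff_powr n s) = (U - z) - 2 * z * U + z\<^sup>2 * U"
    by (simp add: sums_iff)
  then have "z + (\<Sum>n. z ^ (n + 2) * second_diff_powr n s) = (1 - z)\<^sup>2 * U"
    by (simp add: power2_eq_square algebra_simps)
  then have "polylog_cont z s = U" using assms by (simp add: polylog_cont_def)
  then show "(\<lambda>n. z ^ n * of_nat n powr (- s)) sums polylog_cont z s"
    using u0 by (simp add: u_def[abs_def])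
qed

lemma polylog_cont_cnj:
  assumes "norm z = 1" "Re s > -1"
  shows "cnj (polylog_cont z s) = polylog_cont (cnj z) (cnj s)"
proof -
  have c: "cnj (of_nat n powr (- s)) = of_nat n powr (- cnj s)" for n
    by (cases "n = 0") (auto simp: cnj_powr)
  have "summable (\<lambda>n. z ^ (n + 2) * second_diff_powr n s)"
    using summable_norm_cancel[OF summable_polylog_cont] assms by blast
  then have "cnj (\<Sum>n. z ^ (n + 2) * second_diff_powr n s) = (\<Sum>n. cnj (z ^ (n + 2) * second_diff_powr n s))"
    by (rule bounded_linear.suminf[OF bounded_linear_cnj])
  also have "\<dots> = (\<Sum>n. cnj z ^ (n + 2) * second_diff_powr n (cnj s))"
    by (simp only: second_diff_powr_def c complex_cnj_mult complex_cnj_power complex_cnj_add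
          complex_cnj_diff complex_cnj_numeral)
  finally show ?thesis by (simp add: polylog_cont_def)
qed

section \<open>Integrals over the half-line\<close>

text \<open>
  Dominated convergence for the restrictions of \<open>f\<close> to an exhausting sequence of compact intervals.
\<close>

lemma improper_integral_dominated:
  fixes f :: "real \<Rightarrow> complex"
  assumes h: "h integrable_on {0<..}" and le: "\<And>x. x > 0 \<Longrightarrow> norm (f x) \<le> h x"
    and f: "\<And>k. f integrable_on {u k..v k}" and u0: "\<And>k. u k > 0"
    and u: "u \<longlonglongrightarrow> 0" and v: "filterlim v at_top sequentially"
  shows "f integrable_on {0<..}" "(\<lambda>k. integral {u k..v k} f) \<longlonglongrightarrow> integral {0<..} f"
proof -
  define g where "g k x = (if x \<in> {u k..v k} then f x else 0)" for k x
  have sub: "{u k..v k} \<subseteq> {0<..}" for k using u0[of k] by auto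
  have gi: "(g k has_integral integral {u k..v k} f) {0<..}" for k
    unfolding g_def by (rule iffD2[OF has_integral_restrict[OF sub] integrable_integral[OF f]])
  have gl: "norm (g k x) \<le> h x" if "x \<in> {0<..}" for k x
    using le[of x] that by (auto simp: g_def intro: order_trans[OF norm_ge_zero])
  have conv: "(\<lambda>k. g k x) \<longlonglongrightarrow> f x" if "x \<in> {0<..}" for x
  proof (rule tendsto_eventually)
    have "\<forall>\<^sub>F k in sequentially. u k < x" using that order_tendstoD(2)[OF u, of x] by simp
    moreover have "\<forall>\<^sub>F k in sequentially. v k > x" using v by (simp add: filterlim_at_top_dense)
    ultimately show "\<forall>\<^sub>F k in sequentially. g k x = f x"
      by eventually_elim (simp add: g_def)
  qed
  note D = dominated_convergence[of g, OF has_integral_integrable[OF gi] h gl conv]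
  show "f integrable_on {0<..}" by (rule D(1))
  show "(\<lambda>k. integral {u k..v k} f) \<longlonglongrightarrow> integral {0<..} f"
    using D(2) by (simp add: integral_unique[OF gi])
qed

text \<open>
  Monotone convergence along the exhaustion of the half-line by the intervals \<open>[1/(k + 1), k + 1]\<close>.
\<close>

lemma improper_integrable_bounded:
  fixes h :: "real \<Rightarrow> real"
  assumes h: "\<And>k. h integrable_on {1 / real (Suc k)..real (Suc k)}" and nonneg: "\<And>x. x > 0 \<Longrightarrow> h x \<ge> 0"
    and B: "\<And>k. integral {1 / real (Suc k)..real (Suc k)} h \<le> B"
  shows "h integrable_on {0<..}"
proof -
  define E where "E k = {1 / real (Suc k)..real (Suc k)}" for k
  define g where "g k x = (if x \<in> E k then h x else 0)" for k x
  have sub: "E k \<subseteq> {0<..}" for k by (auto simp: E_def intro: less_le_trans[rotated])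
  have gi: "(g k has_integral integral (E k) h) {0<..}" for k
    unfolding g_def
    by (rule iffD2[OF has_integral_restrict[OF sub] integrable_integral[OF h[folded E_def]]])
  have mono: "E k \<subseteq> E (Suc k)" for k by (auto simp: E_def field_simps intro: order_trans)
  have "h integrable_on {0<..} \<and> ((\<lambda>k. integral {0<..} (g k)) \<longlongrightarrow> integral {0<..} h) sequentially"
  proof (rule monotone_convergence_increasing)
    show "g k integrable_on {0<..}" for k by (rule has_integral_integrable[OF gi])
    show "g k x \<le> g (Suc k) x" if "x \<in> {0<..}" for k x
      using nonneg[of x] that mono[of k] by (auto simp: g_def)
    show "(\<lambda>k. g k x) \<longlonglongrightarrow> h x" if "x \<in> {0<..}" for x
    proof (rule tendsto_eventually)
      have "(\<lambda>k. 1 / real (Suc k)) \<longlonglongrightarrow> 0" by (rule lim_1_over_n[THEN LIMSEQ_Suc])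
      then have "\<forall>\<^sub>F k in sequentially. 1 / real (Suc k) < x" using that by (intro order_tendstoD(2)) auto
      moreover have "\<forall>\<^sub>F k in sequentially. real (Suc k) > x"
        using filterlim_compose[OF filterlim_real_sequentially filterlim_Suc]
        by (simp add: filterlim_at_top_dense)
      ultimately show "\<forall>\<^sub>F k in sequentially. g k x = h x"
        by eventually_elim (simp add: g_def E_def)
    qed
    have "0 \<le> integral {0<..} (g k)" for k
      using nonneg by (intro integral_nonneg has_integral_integrable[OF gi]) (auto simp: g_def)
    then show "bounded (range (\<lambda>k. integral {0<..} (g k)))"
      using B integral_unique[OF gi] by (intro boundedI[of _ B]) (auto simp: E_def)
  qed
  then show ?thesis ..
qed

text \<open>
  On compact intervals this is the usual substitution rule. Applied to \<open>|f|\<close> it bounds the integrals of the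
  modulus of the new integrand, which gives absolute integrability; then the limit can be taken for \<open>f\<close> itself.
\<close>

lemma has_integral_substitution_halfline:
  fixes f :: "real \<Rightarrow> complex" and g g' :: "real \<Rightarrow> real"
  assumes f: "f absolutely_integrable_on {0<..}" and cf: "continuous_on {0<..} f"
    and g: "\<And>x. x > 0 \<Longrightarrow> (g has_field_derivative g' x) (at x)" and cg': "continuous_on {0<..} g'"
    and pos: "\<And>x. x > 0 \<Longrightarrow> g x > 0" "\<And>x. x > 0 \<Longrightarrow> g' x \<ge> 0"
    and mono: "\<And>x y. 0 < x \<Longrightarrow> x \<le> y \<Longrightarrow> g x \<le> g y"
    and lim0: "(\<lambda>k. g (1 / real (Suc k))) \<longlonglongrightarrow> 0" and lim1: "filterlim (\<lambda>k. g (real (Suc k))) at_top sequentially"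
  shows "(\<lambda>x. of_real (g' x) * f (g x)) absolutely_integrable_on {0<..}"
    and "integral {0<..} (\<lambda>x. of_real (g' x) * f (g x)) = integral {0<..} f"
proof -
  define u v where "u k = 1 / real (Suc k)" and "v k = real (Suc k)" for k
  have uv: "0 < u k" "u k \<le> v k" for k by (auto simp: u_def v_def field_simps)
  have nf: "(\<lambda>x. norm (f x)) integrable_on {0<..}" and fi: "f integrable_on {0<..}"
    using f by (auto simp: absolutely_integrable_on_def)
  have subst: "((\<lambda>x. g' x *\<^sub>R \<phi> (g x)) has_integral integral {g (u k)..g (v k)} \<phi>) {u k..v k}"
    if "continuous_on {0<..} \<phi>" for \<phi> :: "real \<Rightarrow> 'b::euclidean_space" and k
  proof (rule has_integral_substitution_strong[of "{}" _ _ _ "g (u k)" "g (v k)"])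
    show "continuous_on {u k..v k} g"
      by (rule DERIV_continuous_on[OF has_field_derivative_at_within[OF g]]) (use uv(1)[of k] in auto)
    show "continuous_on {g (u k)..g (v k)} \<phi>"
      by (rule continuous_on_subset[OF that]) (use pos(1)[OF uv(1)[of k]] in auto)
    show "(g has_real_derivative g' x) (at x within {u k..v k})" if x: "x \<in> {u k..v k} - {}" for x
    proof (rule has_field_derivative_at_within[OF g])
      show "x > 0" using x less_le_trans[OF uv(1)[of k], of x] by simp
    qed
    show "g ` {u k..v k} \<subseteq> {g (u k)..g (v k)}"
    proof (rule image_subsetI)
      fix x assume x: "x \<in> {u k..v k}"
      then have "x > 0" using less_le_trans[OF uv(1)[of k], of x] by simp
      then show "g x \<in> {g (u k)..g (v k)}" using x mono[OF uv(1)[of k], of x] mono[of x "v k"] by simp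
    qed
    show "u k \<le> v k" by (rule uv(2))
    show "g (u k) \<le> g (v k)" by (rule mono[OF uv])
  qed simp
  have cnf: "continuous_on {0<..} (\<lambda>x. norm (f x))" by (intro continuous_intros cf)
  have n: "(\<lambda>x. g' x *\<^sub>R norm (f (g x))) integrable_on {0<..}"
  proof (rule improper_integrable_bounded)
    fix k
    show "(\<lambda>x. g' x *\<^sub>R norm (f (g x))) integrable_on {1 / real (Suc k)..real (Suc k)}"
      using subst[OF cnf, of k] by (auto simp: u_def v_def)
    have "integral {u k..v k} (\<lambda>x. g' x *\<^sub>R norm (f (g x))) = integral {g (u k)..g (v k)} (\<lambda>x. norm (f x))"
      by (rule integral_unique[OF subst[OF cnf]])
    also have "\<dots> \<le> integral {0<..} (\<lambda>x. norm (f x))"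
    proof (rule integral_subset_le)
      show sub: "{g (u k)..g (v k)} \<subseteq> {0<..}" using pos(1)[OF uv(1)[of k]] by auto
      show "(\<lambda>x. norm (f x)) integrable_on {g (u k)..g (v k)}"
        by (intro integrable_continuous_real continuous_on_subset[OF cnf] sub)
    qed (use nf in auto)
    finally show "integral {1 / real (Suc k)..real (Suc k)} (\<lambda>x. g' x *\<^sub>R norm (f (g x))) \<le> integral {0<..} (\<lambda>x. norm (f x))"
      by (simp add: u_def v_def)
  qed (use pos in auto)
  have ik: "(\<lambda>x. of_real (g' x) * f (g x)) integrable_on {u k..v k}" for k
    using subst[OF cf, of k] by (auto simp: scaleR_conv_of_real)
  have u0: "u \<longlonglongrightarrow> 0" unfolding u_def by (rule lim_1_over_n[THEN LIMSEQ_Suc])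
  have v1: "filterlim v at_top sequentially" unfolding v_def by (rule filterlim_compose[OF filterlim_real_sequentially filterlim_Suc])
  have le: "norm (of_real (g' x) * f (g x)) \<le> g' x *\<^sub>R norm (f (g x))" if "x > 0" for x
    using pos(2)[OF that] by (simp add: norm_mult)
  note D = improper_integral_dominated[OF n le ik uv(1) u0 v1]
  show "(\<lambda>x. of_real (g' x) * f (g x)) absolutely_integrable_on {0<..}"
    using D(1) n le by (intro absolutely_integrable_integrable_bound) auto
  have "(\<lambda>k. integral {g (u k)..g (v k)} f) \<longlonglongrightarrow> integral {0<..} f"
  proof (rule improper_integral_dominated(2)[OF nf order_refl])
    show "f integrable_on {g (u k)..g (v k)}" for k
      using pos(1)[OF uv(1)[of k]] by (intro integrable_continuous_real continuous_on_subset[OF cf]) auto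
  qed (use pos(1) uv lim0 lim1 in \<open>auto simp: u_def v_def\<close>)
  moreover have "integral {u k..v k} (\<lambda>x. of_real (g' x) * f (g x)) = integral {g (u k)..g (v k)} f" for k
    using integral_unique[OF subst[OF cf, of k]] by (simp add: scaleR_conv_of_real)
  ultimately show "integral {0<..} (\<lambda>x. of_real (g' x) * f (g x)) = integral {0<..} f"
    using D(2) LIMSEQ_unique by simp
qed

text \<open>
  The sum of the norms dominates the partial sums, and it is integrable by monotone convergence.
\<close>

lemma has_integral_suminf:
  fixes f :: "nat \<Rightarrow> real \<Rightarrow> complex"
  assumes f: "\<And>n. (f n has_integral I n) S" and nf: "\<And>n. ((\<lambda>x. norm (f n x)) has_integral J n) S"
    and J: "summable J" and sm: "\<And>x. x \<in> S \<Longrightarrow> summable (\<lambda>n. norm (f n x))"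
  shows "((\<lambda>x. \<Sum>n. f n x) has_integral (\<Sum>n. I n)) S" "summable I"
proof -
  have h: "((\<lambda>x. \<Sum>n. norm (f n x)) has_integral (\<Sum>n. J n)) S"
  proof (rule has_integral_monotone_convergence_increasing)
    show "((\<lambda>x. \<Sum>n<k. norm (f n x)) has_integral (\<Sum>n<k. J n)) S" for k
      by (intro has_integral_sum nf) auto
    show "(\<lambda>k. \<Sum>n<k. norm (f n x)) \<longlonglongrightarrow> (\<Sum>n. norm (f n x))" if "x \<in> S" for x
      using sm[OF that] by (rule summable_LIMSEQ)
    show "(\<lambda>k. \<Sum>n<k. J n) \<longlonglongrightarrow> (\<Sum>n. J n)" using J by (rule summable_LIMSEQ)
  qed auto
  have part: "((\<lambda>x. \<Sum>n<k. f n x) has_integral (\<Sum>n<k. I n)) S" for k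
    by (intro has_integral_sum f) auto
  have le: "norm (\<Sum>n<k. f n x) \<le> (\<Sum>n. norm (f n x))" if "x \<in> S" for k x
    using sum_le_suminf[OF sm[OF that], of "{..<k}"] norm_sum[of "\<lambda>n. f n x" "{..<k}"] by simp
  have conv: "(\<lambda>k. \<Sum>n<k. f n x) \<longlonglongrightarrow> (\<Sum>n. f n x)" if "x \<in> S" for x
    using summable_norm_cancel[OF sm[OF that]] by (rule summable_LIMSEQ)
  note D = dominated_convergence[of "\<lambda>k x. \<Sum>n<k. f n x", OF has_integral_integrable[OF part] has_integral_integrable[OF h] le conv]
  have "I sums integral S (\<lambda>x. \<Sum>n. f n x)"
    using D(2) by (simp add: integral_unique[OF part] sums_def)
  then show "summable I" "((\<lambda>x. \<Sum>n. f n x) has_integral (\<Sum>n. I n)) S"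
    using D(1) by (auto simp: sums_iff has_integral_iff)
qed

text \<open>
  The power \<open>u^(p - 1)\<close> is written with the exponential of a real logarithm here and below, since in this
  form its Borel measurability is immediate.
\<close>

lemma set_integrable_Gamma_complex:
  assumes "Re p > 0" "a > 0"
  shows "set_integrable lborel {0<..} (\<lambda>u. exp ((p - 1) * of_real (ln u)) * of_real (exp (- a * u)) :: complex)"
proof -
  have eq: "complex_of_real u powr (p - 1) / of_real (exp (a * u)) = exp ((p - 1) * of_real (ln u)) * of_real (exp (- a * u))"
    if "u \<in> {0<..}" for u :: real
    using that by (simp add: powr_def Ln_of_real exp_minus field_simps)
  have "(\<lambda>u. exp ((p - 1) * of_real (ln u)) * of_real (exp (- a * u)) :: complex) absolutely_integrable_on {0<..}"
    by (rule iffD1[OF set_integrable_cong[OF refl refl eq] absolutely_integrable_Gamma_integral[OF assms]])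
  then show ?thesis
    unfolding set_integrable_def by (subst (asm) integrable_completion) auto
qed

lemma Gamma_scaled_integral:
  assumes "Re p > 0" "a > 0"
  shows "(LINT u:{0<..}|lborel. exp ((p - 1) * of_real (ln u)) * of_real (exp (- a * u)) :: complex)
    = Gamma p * exp (- p * of_real (ln a))"
proof -
  define f where "f u = exp ((p - 1) * of_real (ln u)) * of_real (exp (- u))" for u :: real
  have 1: "(LINT u:{0<..}|lborel. f u) = Gamma p"
  proof -
    have "set_integrable lborel {0<..} f" using set_integrable_Gamma_complex[OF assms(1), of 1] by (simp add: f_def[abs_def])
    then have "(LINT u:{0<..}|lborel. f u) = integral {0<..} f" by (rule set_borel_integral_eq_integral)
    also have "\<dots> = integral {0<..} (\<lambda>t. complex_of_real t powr (p - 1) / complex_of_real (exp t))"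
      by (intro integral_cong) (auto simp: f_def powr_def Ln_of_real exp_minus field_simps)
    also have "\<dots> = Gamma p" using Gamma_integral_complex'[OF assms(1)] by (rule integral_unique)
    finally show ?thesis .
  qed
  have "(LINT u:{0<..}|lborel. f u) = a *\<^sub>R (LINT u|lborel. indicator {0<..} (0 + a * u) *\<^sub>R f (0 + a * u))"
    unfolding set_lebesgue_integral_def using assms lborel_integral_real_affine[of a "\<lambda>u. indicator {0<..} u *\<^sub>R f u" 0] by simp
  also have "(LINT u|lborel. indicator {0<..} (0 + a * u) *\<^sub>R f (0 + a * u)) =
    (LINT u|lborel. exp ((p - 1) * of_real (ln a)) * (indicator {0<..} u *\<^sub>R (exp ((p - 1) * of_real (ln u)) * of_real (exp (- a * u)))))"
  proof (rule Bochner_Integration.integral_cong)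
    fix u :: real
    have "ln (a * u) = ln a + ln u" if "u > 0" using assms that by (simp add: ln_mult)
    then show "indicator {0<..} (0 + a * u) *\<^sub>R f (0 + a * u) = exp ((p - 1) * of_real (ln a)) * (indicator {0<..} u *\<^sub>R (exp ((p - 1) * of_real (ln u)) * of_real (exp (- a * u))))"
      using assms by (auto simp: f_def indicator_def zero_less_mult_iff distrib_left exp_add)
  qed simp
  finally have "(LINT u:{0<..}|lborel. f u) = of_real a * (exp ((p - 1) * of_real (ln a)) * (LINT u:{0<..}|lborel. exp ((p - 1) * of_real (ln u)) * of_real (exp (- a * u))))"
    by (simp add: set_lebesgue_integral_def scaleR_conv_of_real)
  with 1 have "Gamma p = of_real a * (exp ((p - 1) * of_real (ln a)) * (LINT u:{0<..}|lborel. exp ((p - 1) * of_real (ln u)) * of_real (exp (- a * u))))"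
    by simp
  also have "\<dots> = exp (p * of_real (ln a)) * (LINT u:{0<..}|lborel. exp ((p - 1) * of_real (ln u)) * of_real (exp (- a * u)))"
  proof -
    have "exp (of_real (ln a)) = complex_of_real a" using assms by (simp only: exp_of_real exp_ln)
    then show ?thesis using assms by (simp add: left_diff_distrib exp_diff)
  qed
  finally show ?thesis by (simp add: exp_minus field_simps)
qed

text \<open>
  Fubini's theorem for \<open>u^(p - 1) e^(-q (1 + u))\<close> on the quadrant \<open>q, u > 0\<close>: integration over \<open>q\<close>
  gives \<open>u^(p - 1)/(1 + u)\<close>, integration over \<open>u\<close> gives \<open>\<Gamma>(p) q^(-p) e^(-q)\<close>.
\<close>

lemma beta_integral_Gamma:
  fixes p :: complex
  assumes "0 < Re p" "Re p < 1"
  shows "set_integrable lborel {0<..} (\<lambda>u. exp ((p - 1) * of_real (ln u)) / of_real (1 + u))"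
    and "(LINT u:{0<..}|lborel. exp ((p - 1) * of_real (ln u)) / of_real (1 + u)) = Gamma p * Gamma (1 - p)"
proof -
  define I where "I = (indicator {0<..} :: real \<Rightarrow> real)"
  define f where "f q u = (I q * I u) *\<^sub>R (exp ((p - 1) * of_real (ln u)) * of_real (exp (- q * (1 + u))) :: complex)" for q u
  have fm: "(\<lambda>(q, u). f q u) \<in> borel_measurable (lborel \<Otimes>\<^sub>M lborel)"
    unfolding f_def I_def by measurable
  have Gs: "(LINT u|lborel. I u *\<^sub>R (exp ((w - 1) * of_real (ln u)) * of_real (exp (- a * u)))) = Gamma w * exp (- w * of_real (ln a))"
    and Si: "integrable lborel (\<lambda>u. I u *\<^sub>R (exp ((w - 1) * of_real (ln u)) * of_real (exp (- a * u)) :: complex))"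
    if "Re w > 0" "a > 0" for w a
    using Gamma_scaled_integral[OF that] set_integrable_Gamma_complex[OF that]
    by (simp_all only: set_lebesgue_integral_def set_integrable_def I_def)
  have inner: "(I q * I u) *\<^sub>R (exp ((w - 1) * of_real (ln u)) * of_real (exp (- q * (1 + u))) :: complex)
    = I q *\<^sub>R (of_real (exp (- q)) * (I u *\<^sub>R (exp ((w - 1) * of_real (ln u)) * of_real (exp (- q * u)))))" for q u w
    by (simp add: scaleR_conv_of_real mult_ac distrib_left exp_add exp_minus exp_diff field_simps)
  have inner_u: "f q u = I q *\<^sub>R (of_real (exp (- q)) * (I u *\<^sub>R (exp ((p - 1) * of_real (ln u)) * of_real (exp (- q * u)))))" for q u
    unfolding f_def by (rule inner)
  have int_u: "integrable lborel (\<lambda>u. f q u)" for q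
  proof (cases "q > 0")
    case True
    show ?thesis unfolding inner_u
      by (intro integrable_scaleR_right integrable_mult_right Si assms True)
  qed (simp add: f_def I_def)
  have val_u: "(LINT u|lborel. f q u) = I q *\<^sub>R (of_real (exp (- q)) * (Gamma p * exp (- p * of_real (ln q))))" for q
  proof (cases "q > 0")
    case True
    show ?thesis
      by (simp only: inner_u integral_scaleR_right integral_mult_right_zero Gs[OF assms(1) True])
  qed (simp add: f_def I_def)
  have norm_f: "norm (f q u) = Re ((I q * I u) *\<^sub>R (exp ((of_real (Re p) - 1) * of_real (ln u)) * of_real (exp (- q * (1 + u)))))" for q u
    by (simp add: f_def I_def norm_mult Re_exp indicator_def)
  have norm_val: "(LINT u|lborel. norm (f q u)) = I q * (exp (- q) * Re (Gamma (of_real (Re p)) * exp (- of_real (Re p) * of_real (ln q))))" for q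
  proof (cases "q > 0")
    case True
    have r: "Re (of_real (Re p)) > 0" using assms by simp
    have "integrable lborel (\<lambda>u. (I q * I u) *\<^sub>R (exp ((of_real (Re p) - 1) * of_real (ln u)) * of_real (exp (- q * (1 + u))) :: complex))"
      unfolding inner by (intro integrable_scaleR_right integrable_mult_right Si r True)
    moreover have "(LINT u|lborel. (I q * I u) *\<^sub>R (exp ((of_real (Re p) - 1) * of_real (ln u)) * of_real (exp (- q * (1 + u))) :: complex)) =
        I q *\<^sub>R (of_real (exp (- q)) * (Gamma (of_real (Re p)) * exp (- of_real (Re p) * of_real (ln q))))"
      by (simp only: inner integral_scaleR_right integral_mult_right_zero Gs[OF r True])
    ultimately have "(LINT u|lborel. Re ((I q * I u) *\<^sub>R (exp ((of_real (Re p) - 1) * of_real (ln u)) * of_real (exp (- q * (1 + u)))))) =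
       Re (I q *\<^sub>R (of_real (exp (- q)) * (Gamma (of_real (Re p)) * exp (- of_real (Re p) * of_real (ln q)))))"
      by (simp only: integral_Re)
    then show ?thesis unfolding norm_f by simp
  qed (simp add: f_def I_def)
  have int_norm: "integrable lborel (\<lambda>q. LINT u|lborel. norm (f q u))"
  proof -
    have "integrable lborel (\<lambda>q. norm (Gamma (of_real (Re p)) * (I q *\<^sub>R (exp ((of_real (1 - Re p) - 1) * of_real (ln q)) * of_real (exp (- 1 * q)))) :: complex))"
      using assms by (intro integrable_norm integrable_mult_right Si) auto
    also have "(\<lambda>q. norm (Gamma (of_real (Re p)) * (I q *\<^sub>R (exp ((of_real (1 - Re p) - 1) * of_real (ln q)) * of_real (exp (- 1 * q)))) :: complex)) = (\<lambda>q. LINT u|lborel. norm (f q u))"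
    proof
      fix q
      have G: "Gamma (of_real (Re p)) = (of_real (Gamma (Re p)) :: complex)" "Gamma (Re p) > 0"
        using assms by (auto simp: Gamma_complex_of_real Gamma_real_pos)
      show "norm (Gamma (of_real (Re p)) * (I q *\<^sub>R (exp ((of_real (1 - Re p) - 1) * of_real (ln q)) * of_real (exp (- 1 * q)))) :: complex) = (LINT u|lborel. norm (f q u))"
        unfolding norm_val G using G(2) by (simp add: norm_mult I_def Re_exp indicator_def mult_ac)
    qed
    finally show ?thesis .
  qed
  have fint: "integrable (lborel \<Otimes>\<^sub>M lborel) (\<lambda>(q, u). f q u)"
    using int_u int_norm by (intro lborel_pair.Fubini_integrable fm) auto
  have inner_q: "(LINT q|lborel. f q u) = I u *\<^sub>R (exp ((p - 1) * of_real (ln u)) / of_real (1 + u))" for u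
  proof (cases "u > 0")
    case True
    have "(LINT q|lborel. f q u) = (LINT q|lborel. exp ((p - 1) * of_real (ln u)) * (I q *\<^sub>R (exp ((1 - 1) * of_real (ln q)) * of_real (exp (- (1 + u) * q)))))"
      using True by (intro Bochner_Integration.integral_cong) (auto simp: f_def I_def algebra_simps indicator_def)
    also have "\<dots> = exp ((p - 1) * of_real (ln u)) * (Gamma 1 * exp (- 1 * of_real (ln (1 + u))))"
      using True by (simp only: integral_mult_right_zero) (subst Gs, simp_all)
    also have "exp (- 1 * of_real (ln (1 + u)) :: complex) = 1 / of_real (1 + u)"
    proof -
      have "exp (of_real (ln (1 + u))) = complex_of_real (1 + u)" using True by (simp only: exp_of_real exp_ln)
      then show ?thesis by (simp add: exp_minus inverse_eq_divide)
    qed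
    finally show ?thesis using True by (simp add: I_def)
  qed (simp add: f_def I_def)
  have "integrable lborel (\<lambda>u. LINT q|lborel. f q u)"
    using lborel_pair.integrable_snd[OF fint] by simp
  then show "set_integrable lborel {0<..} (\<lambda>u. exp ((p - 1) * of_real (ln u)) / of_real (1 + u))"
    unfolding inner_q set_integrable_def I_def .
  have "(LINT u:{0<..}|lborel. exp ((p - 1) * of_real (ln u)) / of_real (1 + u)) = (LINT u|lborel. LINT q|lborel. f q u)"
    unfolding inner_q set_lebesgue_integral_def I_def ..
  also have "\<dots> = (LINT q|lborel. LINT u|lborel. f q u)"
    by (rule lborel_pair.Fubini_integral[OF fint])
  also have "\<dots> = (LINT q|lborel. Gamma p * (I q *\<^sub>R (exp (((1 - p) - 1) * of_real (ln q)) * of_real (exp (- 1 * q)))))"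
    unfolding val_u by (intro Bochner_Integration.integral_cong) (auto simp: mult_ac)
  also have "\<dots> = Gamma p * Gamma (1 - p)"
    using assms by (simp only: integral_mult_right_zero) (subst Gs, simp_all)
  finally show "(LINT u:{0<..}|lborel. exp ((p - 1) * of_real (ln u)) / of_real (1 + u)) = Gamma p * Gamma (1 - p)" .
qed

section \<open>The gamma factor and its asymptotics\<close>

text \<open>
  The error of the trapezoidal rule for the integral of \<open>1/z\<close> from \<open>w\<close> to \<open>w + 1\<close>. As a function of the upper
  end point \<open>w + z\<close> it vanishes at \<open>z = 0\<close> and has the derivative \<open>z^2 / (2 w (w + z)^2)\<close>.
\<close>

lemma log_trapezoid_error:
  fixes w :: complex
  assumes "Im w \<noteq> 0" "m > 0" "\<And>\<tau>. 0 \<le> \<tau> \<Longrightarrow> \<tau> \<le> 1 \<Longrightarrow> norm (w + of_real \<tau>) \<ge> m"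
  shows "norm (1 / (2 * w) + 1 / (2 * (w + 1)) - (Ln (w + 1) - Ln w)) \<le> 1 / (2 * norm w * m\<^sup>2)"
proof -
  \<comment> \<open>The trapezoidal error with variable upper end point w + z.\<close>
  define E where "E z = 1 / 2 * (z * (1 / w + inverse (w + z))) - (Ln (w + z) - Ln w)" for z
  define S where "S = complex_of_real ` {0..1}"
  have cS: "convex S" unfolding S_def by (intro convex_linear_image) auto
  have dE: "(E has_field_derivative (z\<^sup>2 / 2) / (w * (w + z)\<^sup>2)) (at z within S)" if "z \<in> S" for z
  proof -
    from that have "Im (w + z) \<noteq> 0" using assms by (auto simp: S_def)
    then have nz: "w + z \<noteq> 0" "w + z \<notin> \<real>\<^sub>\<le>\<^sub>0"
      by (metis zero_complex.sel(2), simp add: complex_nonpos_Reals_iff)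
    have w: "w \<noteq> 0" using assms by auto
    have di: "((\<lambda>z. inverse (w + z)) has_field_derivative - (1 / (w + z)\<^sup>2)) (at z within S)"
      using nz by (auto intro!: derivative_eq_intros simp: power2_eq_square divide_simps)
    have dl: "((\<lambda>z. Ln (w + z)) has_field_derivative 1 / (w + z)) (at z within S)"
      using nz by (auto intro!: derivative_eq_intros simp: inverse_eq_divide)
    have "(E has_field_derivative (1 / 2 * (1 / w + 1 / (w + z)) + z / 2 * (- 1 / (w + z)\<^sup>2) - 1 / (w + z))) (at z within S)"
      using DERIV_diff[OF DERIV_cmult[OF DERIV_mult[OF DERIV_ident DERIV_add[OF DERIV_const[of "1 / w"] di]], of "1/2"]
          DERIV_diff[OF dl DERIV_const[of "Ln w"]]]
      unfolding E_def by (rule DERIV_cong) (simp add: inverse_eq_divide algebra_simps)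
    also have "1 / 2 * (1 / w + 1 / (w + z)) + z / 2 * (- 1 / (w + z)\<^sup>2) - 1 / (w + z) = (z\<^sup>2 / 2) / (w * (w + z)\<^sup>2)"
    proof -
      define v where "v = w + z"
      have z: "z = v - w" by (simp add: v_def)
      have "v \<noteq> 0" using nz by (simp add: v_def)
      then show ?thesis unfolding v_def[symmetric] unfolding z using w
        by (simp add: divide_simps power2_eq_square) (simp add: algebra_simps)
    qed
    finally show ?thesis .
  qed
  have bE: "norm ((z\<^sup>2 / 2) / (w * (w + z)\<^sup>2)) \<le> 1 / (2 * norm w * m\<^sup>2)" if "z \<in> S" for z
  proof -
    from that obtain \<tau> where \<tau>: "0 \<le> \<tau>" "\<tau> \<le> 1" "z = of_real \<tau>" by (auto simp: S_def)
    have "norm w > 0" using assms by auto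
    have "norm ((z\<^sup>2 / 2) / (w * (w + z)\<^sup>2)) = \<tau>\<^sup>2 / (2 * norm w * (norm (w + z))\<^sup>2)"
      using \<tau> by (simp add: norm_divide norm_mult norm_power)
    also have "\<dots> \<le> 1 / (2 * norm w * m\<^sup>2)"
      using \<tau> assms \<open>norm w > 0\<close> by (intro frac_le mult_left_mono power_mono power_le_one mult_pos_pos) auto
    finally show ?thesis .
  qed
  have "norm (E 1 - E 0) \<le> 1 / (2 * norm w * m\<^sup>2) * norm (1 - 0 :: complex)"
    by (rule field_differentiable_bound[OF cS dE bE])
      (auto simp: S_def intro: image_eqI[of _ _ 0] image_eqI[of _ _ 1])
  then show ?thesis by (simp add: E_def distrib_left inverse_eq_divide)
qed

lemma Ln_of_nat_shift_tendsto:
  fixes w :: complex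
  shows "(\<lambda>n. Ln (w + of_nat n) - of_real (ln (real n))) \<longlonglongrightarrow> 0"
proof -
  have "(\<lambda>n. w / of_nat n) \<longlonglongrightarrow> 0"
    by (rule tendsto_divide_0[OF tendsto_const]) (rule tendsto_of_nat)
  then have "(\<lambda>n. 1 + w / of_nat n) \<longlonglongrightarrow> 1 + 0" by (intro tendsto_intros)
  then have "(\<lambda>n. Ln (1 + w / of_nat n)) \<longlonglongrightarrow> Ln (1 + 0)"
    by (intro tendsto_Ln) auto
  then have *: "(\<lambda>n. Ln (1 + w / of_nat n)) \<longlonglongrightarrow> 0" by simp
  show ?thesis
  proof (rule Lim_transform_eventually[OF *])
    have "\<forall>\<^sub>F n in sequentially. n > 0 \<and> real n > norm w"
      using eventually_gt_at_top[of 0] filterlim_real_sequentially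
      by (auto simp: filterlim_at_top_dense intro: eventually_conj)
    then show "\<forall>\<^sub>F n in sequentially. Ln (1 + w / of_nat n) = Ln (w + of_nat n) - of_real (ln (real n))"
    proof eventually_elim
      case (elim n)
      have "w + of_nat n \<noteq> 0"
      proof
        assume "w + of_nat n = 0"
        then have "norm w = norm (of_nat n :: complex)" by (metis add_eq_0_iff norm_minus_cancel)
        then show False using elim by simp
      qed
      then have nz: "1 + w / of_nat n \<noteq> 0" using elim by (simp add: field_simps)
      have "w + of_nat n = of_real (real n) * (1 + w / of_nat n)" using elim by (simp add: field_simps)
      then show ?case using Ln_times_of_real[of "real n" "1 + w / of_nat n"] nz elim by simp
    qed
  qed
qed

text \<open>
  By \<open>(v + n) (v + n + 1) \<le> 2 (v^2 + (n + 1/2)^2)\<close> the terms are bounded by a telescoping series.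
\<close>

lemma sum_inverse_squares_le:
  fixes v :: real
  assumes "v \<ge> 1/2"
  shows "(\<Sum>n<N. 1 / (v\<^sup>2 + (real n + 1/2)\<^sup>2)) \<le> 2 / v"
proof -
  have "(\<Sum>n<N. 1 / (v\<^sup>2 + (real n + 1/2)\<^sup>2)) \<le> (\<Sum>n<N. 2 / (v + real n) - 2 / (v + real (Suc n)))"
  proof (rule sum_mono)
    fix n
    have "(v - (real n + 1/2))\<^sup>2 \<ge> 0" by simp
    then have "(v + real n) * (v + real n + 1) \<le> 2 * (v\<^sup>2 + (real n + 1/2)\<^sup>2)"
      by (simp add: power2_eq_square algebra_simps)
    moreover have "v + real n > 0" using assms by linarith
    ultimately have "1 / (v\<^sup>2 + (real n + 1/2)\<^sup>2) \<le> 2 / ((v + real n) * (v + real n + 1))"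
      using assms by (simp add: divide_simps add_pos_nonneg)
    also have "\<dots> = 2 / (v + real n) - 2 / (v + real (Suc n))"
      using \<open>v + real n > 0\<close> by (simp add: field_simps)
    finally show "1 / (v\<^sup>2 + (real n + 1/2)\<^sup>2) \<le> 2 / (v + real n) - 2 / (v + real (Suc n))" .
  qed
  also have "\<dots> = 2 / v - 2 / (v + real N)"
    by (subst sum_lessThan_telescope') simp
  also have "\<dots> \<le> 2 / v" using assms by simp
  finally show ?thesis .
qed

text \<open>
  Let \<open>e\<close> be the function in question. Then \<open>e(w + 1) - e(w)\<close> is an error of the trapezoidal rule, and
  \<open>e(w + n)\<close> tends to \<open>0\<close>. So \<open>e(w)\<close> is a sum of trapezoidal errors, which are
  \<open>O(1 / (|Im w| (Im w)^2 + |Im w| n^2))\<close> at \<open>w + n\<close>.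
\<close>

lemma Digamma_asymptotic:
  fixes w :: complex
  assumes "\<bar>Re w\<bar> \<le> 1/2" "\<bar>Im w\<bar> \<ge> 1/2"
  shows "norm (Digamma w - Ln w + 1 / (2 * w)) \<le> 2 / (Im w)\<^sup>2"
proof -
  define v where "v = \<bar>Im w\<bar>"
  have v: "v \<ge> 1/2" using assms by (simp add: v_def)
  define e where "e z = Digamma z - Ln z + 1 / (2 * z)" for z :: complex
  define d where "d n = norm (e (w + of_nat (Suc n)) - e (w + of_nat n))" for n
  have nz: "w + of_nat n \<noteq> 0" for n using assms by (auto simp: complex_eq_iff)
  have d_eq: "d n = norm (1 / (2 * (w + of_nat n)) + 1 / (2 * (w + of_nat n + 1)) - (Ln (w + of_nat n + 1) - Ln (w + of_nat n)))" for n
  proof -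
    have "Digamma (w + of_nat (Suc n)) = Digamma (w + of_nat n) + 1 / (w + of_nat n)"
      using Digamma_plus1[OF nz[of n]] by (simp add: add_ac)
    moreover have "1 / x = 1 / (2 * x) + 1 / (2 * x)" for x :: complex
      by (cases "x = 0") (auto simp: field_simps)
    from this[of "w + of_nat n"] calculation have "e (w + of_nat (Suc n)) - e (w + of_nat n) = 1 / (2 * (w + of_nat n)) + 1 / (2 * (w + of_nat n + 1)) - (Ln (w + of_nat n + 1) - Ln (w + of_nat n))"
      by (simp add: e_def add_ac)
    then show ?thesis unfolding d_def by simp
  qed
  have d0: "d 0 \<le> 1 / (2 * v * v\<^sup>2)"
  proof -
    have "d 0 \<le> 1 / (2 * norm w * v\<^sup>2)"
    proof -
      have "v \<le> norm (w + of_real \<tau>)" for \<tau>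
        using abs_Im_le_cmod[of "w + of_real \<tau>"] by (simp add: v_def)
      then show ?thesis
        using log_trapezoid_error[of w v] v assms by (simp add: d_eq)
    qed
    also have "\<dots> \<le> 1 / (2 * v * v\<^sup>2)"
      using v abs_Im_le_cmod[of w] by (intro frac_le mult_right_mono mult_pos_pos) (auto simp: v_def)
    finally show ?thesis .
  qed
  have dn: "d (Suc n) \<le> 1 / (2 * v) * (1 / (v\<^sup>2 + (real n + 1/2)\<^sup>2))" for n
  proof -
    let ?w = "w + of_nat (Suc n)"
    define m where "m = sqrt (v\<^sup>2 + (real n + 1/2)\<^sup>2)"
    have m2: "m\<^sup>2 = v\<^sup>2 + (real n + 1/2)\<^sup>2" by (simp add: m_def)
    have m0: "m > 0" unfolding m_def using v by (intro real_sqrt_gt_zero add_pos_nonneg) auto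
    have "d (Suc n) \<le> 1 / (2 * norm ?w * m\<^sup>2)"
      unfolding d_eq
    proof (rule log_trapezoid_error)
      show "Im ?w \<noteq> 0" using assms by auto
      fix \<tau> :: real assume \<tau>: "0 \<le> \<tau>" "\<tau> \<le> 1"
      have "(real n + 1/2)\<^sup>2 \<le> (Re (?w + of_real \<tau>))\<^sup>2"
        using assms \<tau> by (intro power_mono) (auto simp: abs_le_iff)
      then show "m \<le> norm (?w + of_real \<tau>)"
        unfolding m_def cmod_def by (intro real_sqrt_le_mono) (simp add: v_def)
    qed (rule m0)
    also have "\<dots> \<le> 1 / (2 * v * m\<^sup>2)"
      using v m0 abs_Im_le_cmod[of ?w] by (intro frac_le mult_right_mono mult_pos_pos) (auto simp: v_def)
    finally show ?thesis by (simp add: m2)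
  qed
  have bound: "norm (e w) \<le> 2 / v\<^sup>2 + norm (e (w + of_nat (Suc N)))" for N
  proof -
    have eq: "e (w + of_nat (Suc N)) - e w = (\<Sum>n<Suc N. e (w + of_nat (Suc n)) - e (w + of_nat n))"
      using sum_lessThan_telescope[of "\<lambda>n. e (w + of_nat n)" "Suc N"] by (simp only: of_nat_0 add_0_right)
    have "norm (e (w + of_nat (Suc N)) - e w) \<le> (\<Sum>n<Suc N. d n)"
      unfolding eq d_def by (rule norm_sum)
    also have "\<dots> = d 0 + (\<Sum>n<N. d (Suc n))" by (rule sum.lessThan_Suc_shift)
    also have "\<dots> \<le> 1 / (2 * v * v\<^sup>2) + (\<Sum>n<N. 1 / (2 * v) * (1 / (v\<^sup>2 + (real n + 1/2)\<^sup>2)))"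
      by (intro add_mono d0 sum_mono dn)
    also have "\<dots> \<le> 1 / (2 * v * v\<^sup>2) + 1 / (2 * v) * (2 / v)"
      unfolding sum_distrib_left[symmetric] using v by (intro add_left_mono mult_left_mono sum_inverse_squares_le) auto
    also have "\<dots> \<le> 2 / v\<^sup>2"
    proof -
      have "1 / (2 * v * v\<^sup>2) \<le> 1 / v\<^sup>2" using v by (intro frac_le) (auto simp: field_simps)
      moreover have "1 / (2 * v) * (2 / v) = 1 / v\<^sup>2" by (simp add: power2_eq_square)
      ultimately show ?thesis by simp
    qed
    finally show ?thesis using norm_triangle_ineq3[of "e w" "e (w + of_nat (Suc N))"]
      by (simp add: norm_minus_commute abs_le_iff)
  qed
  have "(\<lambda>n. e (w + of_nat n)) \<longlonglongrightarrow> 0"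
  proof -
    have w0: "w \<noteq> 0" using nz[of 0] by simp
    have D: "Digamma (w + of_nat n) = Digamma w + (\<Sum>i<n. inverse (w + of_nat i))" for n
    proof (induction n)
      case (Suc n)
      then show ?case using Digamma_plus1[OF nz[of n]] by (simp add: add_ac inverse_eq_divide)
    qed simp
    have "(\<lambda>n. 1 / (w + of_nat n)) \<longlonglongrightarrow> 0"
      by (intro tendsto_divide_0[OF tendsto_const] tendsto_add_filterlim_at_infinity[OF tendsto_const] tendsto_of_nat)
    then have l1: "(\<lambda>n. (1/2) * (1 / (w + of_nat n))) \<longlonglongrightarrow> (1/2) * 0" by (intro tendsto_mult tendsto_const)
    have "(\<lambda>n. Digamma w - (of_real (ln (real n)) - (\<Sum>i<n. inverse (w + of_nat i))) - (Ln (w + of_nat n) - of_real (ln (real n))) + (1/2) * (1 / (w + of_nat n)))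
        \<longlonglongrightarrow> Digamma w - Digamma w - 0 + (1/2) * 0"
      by (intro tendsto_add tendsto_diff tendsto_const Digamma_LIMSEQ[OF w0] Ln_of_nat_shift_tendsto l1)
    then show ?thesis by (simp add: e_def D algebra_simps)
  qed
  then have "(\<lambda>n. 2 / v\<^sup>2 + norm (e (w + of_nat (Suc n)))) \<longlonglongrightarrow> 2 / v\<^sup>2 + 0"
    by (intro tendsto_add tendsto_const tendsto_norm_zero LIMSEQ_Suc)
  then have "norm (e w) \<le> 2 / v\<^sup>2 + 0"
    by (rule LIMSEQ_le_const) (use bound in auto)
  then show ?thesis by (simp add: e_def v_def)
qed

text \<open>
  By the reflection formula this is \<open>pi / (2 sin(pi s / 2) \<Gamma>(s))\<close>. Written with gamma functions only, its
  logarithmic derivative is a combination of digamma functions.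
\<close>

definition sine_gamma_factor :: "complex \<Rightarrow> complex" where
  "sine_gamma_factor s = - (Gamma (1 + s / 2) * Gamma (- (s / 2)) * rGamma s) / 2"

text \<open>
  The mean value inequality along the horizontal segment from \<open>i t\<close> to \<open>-\<delta> + i t\<close>.
\<close>

lemma Ln_left_of_imaginary_axis:
  fixes \<delta> t :: real
  assumes "0 \<le> \<delta>" "\<delta> \<le> 1" "t \<ge> 1"
  shows "norm (Ln (Complex (- \<delta>) t) - (of_real (ln t) + \<i> * pi / 2 + \<i> * (\<delta> / t))) \<le> \<delta> / t\<^sup>2"
proof -
  define S where "S = complex_of_real ` {0..\<delta>}"
  have cS: "convex S" unfolding S_def by (intro convex_linear_image) auto
  define f where "f u = Ln (\<i> * t - u) + u / (\<i> * t)" for u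
  have fd: "(f has_field_derivative (1 / (\<i> * t) - 1 / (\<i> * t - u))) (at u within S)" if "u \<in> S" for u
  proof -
    have "Im (\<i> * t - u) \<noteq> 0" using that assms by (auto simp: S_def)
    then have "\<i> * t - u \<notin> \<real>\<^sub>\<le>\<^sub>0" by (simp add: complex_nonpos_Reals_iff)
    then show ?thesis
      unfolding f_def using assms by (auto intro!: derivative_eq_intros simp: divide_simps)
  qed
  have fb: "norm (1 / (\<i> * t) - 1 / (\<i> * t - u)) \<le> 1 / t\<^sup>2" if "u \<in> S" for u
  proof -
    from that obtain x where x: "0 \<le> x" "x \<le> \<delta>" "u = of_real x" by (auto simp: S_def)
    have "Im (\<i> * t - u) = t" by (simp add: x)
    then have n: "norm (\<i> * t - u) \<ge> t" using abs_Im_le_cmod[of "\<i> * t - u"] assms by simp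
    then have "\<i> * t - u \<noteq> 0" using assms by force
    then have "1 / (\<i> * t) - 1 / (\<i> * t - u) = - u / ((\<i> * t) * (\<i> * t - u))"
      using assms by (simp add: divide_simps)
    also have "norm \<dots> = x / (t * norm (\<i> * t - u))" using x assms by (simp add: norm_divide norm_mult)
    also have "\<dots> \<le> 1 / (t * t)" using x assms n by (intro frac_le mult_left_mono) auto
    finally show ?thesis by (simp add: power2_eq_square)
  qed
  have "norm (f (of_real \<delta>) - f (of_real 0)) \<le> 1 / t\<^sup>2 * norm (of_real \<delta> - of_real 0 :: complex)"
    by (rule field_differentiable_bound[OF cS fd fb]) (use assms in \<open>auto simp: S_def\<close>)
  moreover have "Ln (\<i> * of_real t) = of_real (ln t) + \<i> * pi / 2"
    using Ln_times_of_real[of t \<i>] Ln_of_real[of t] assms by (simp add: mult.commute)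
  moreover have "\<i> * of_real t - of_real \<delta> = Complex (- \<delta>) t" by (simp add: complex_eq_iff)
  moreover have "of_real \<delta> / (\<i> * of_real t) = - (\<i> * (\<delta> / t))"
    by (simp add: divide_inverse inverse_mult_distrib mult_ac)
  ultimately show ?thesis using assms by (simp add: f_def algebra_simps)
qed

text \<open>
  In the digamma asymptotics at \<open>s/2\<close>, \<open>-s/2\<close> and \<open>s\<close> the logarithms combine to \<open>-ln t\<close> while the
  imaginary constants \<open>i pi / 2\<close> cancel. The terms of order \<open>1/t\<close> come from the reciprocals \<open>1/s\<close> and from
  the real part \<open>-\<delta>\<close> in \<open>Ln s\<close>.
\<close>

lemma sine_gamma_factor_log_derivative:
  fixes \<delta> t :: real
  assumes "0 < \<delta>" "\<delta> \<le> 1/2" "t \<ge> 1"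
  defines "s \<equiv> Complex (- \<delta>) t"
  shows "norm (Digamma (1 + s / 2) / 2 - Digamma (- (s / 2)) / 2 - Digamma s
           + of_real (ln t) + \<i> * ((1/2 + \<delta>) / t)) \<le> 12 / t\<^sup>2"
proof -
  define w where "w = s / 2"
  have Rew: "Re w = - \<delta> / 2" "Im w = t / 2" and Res: "Re s = - \<delta>" "Im s = t" by (simp_all add: w_def s_def)
  have nz: "s \<noteq> 0" "w \<noteq> 0" using assms Res by (auto simp: w_def complex_eq_iff)
  define e1 where "e1 = Digamma w - Ln w + 1 / (2 * w)"
  define e2 where "e2 = Digamma (- w) - Ln (- w) + 1 / (2 * (- w))"
  define e3 where "e3 = Digamma s - Ln s + 1 / (2 * s)"
  define e4 where "e4 = Ln s - (of_real (ln t) + \<i> * pi / 2 + \<i> * (\<delta> / t))"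
  define e5 where "e5 = (1 / s - 1 / (\<i> * t)) / 2"
  have n1: "norm e1 \<le> 8 / t\<^sup>2"
    using Digamma_asymptotic[of w] assms Rew by (simp add: e1_def power_divide)
  have n2: "norm e2 \<le> 8 / t\<^sup>2"
    using Digamma_asymptotic[of "- w"] assms Rew by (simp add: e2_def power_divide)
  have n3: "norm e3 \<le> 2 / t\<^sup>2"
    using Digamma_asymptotic[of s] assms Res by (simp add: e3_def)
  have n4: "norm e4 \<le> (1/2) / t\<^sup>2"
  proof -
    have "norm e4 \<le> \<delta> / t\<^sup>2" unfolding e4_def s_def using assms by (intro Ln_left_of_imaginary_axis) auto
    also have "\<dots> \<le> (1/2) / t\<^sup>2" using assms by (intro divide_right_mono) auto
    finally show ?thesis .
  qed
  have n5: "norm e5 \<le> (1/2) / t\<^sup>2"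
  proof -
    have "\<i> * of_real t - s = of_real \<delta>" by (simp add: s_def complex_eq_iff)
    then have "1 / s - 1 / (\<i> * t) = of_real \<delta> / (s * (\<i> * t))"
      using nz assms by (simp add: divide_simps)
    then have "norm e5 = \<delta> / (norm s * t) / 2" using assms by (simp add: e5_def norm_divide norm_mult)
    also have "\<dots> \<le> 1 / (t * t) / 2"
      using assms Res abs_Im_le_cmod[of s] by (intro divide_right_mono frac_le mult_right_mono) auto
    finally show ?thesis by (simp add: power2_eq_square)
  qed
  define q where "q = 1 / s"
  have "Digamma (1 + s / 2) = Digamma w + 1 / w"
    using Digamma_plus1[OF nz(2)] by (simp add: w_def add.commute)
  then have r1: "Digamma (1 + s / 2) = Digamma w + 2 * q" by (simp add: w_def q_def)
  have r2: "Digamma w = e1 + Ln w - q" by (simp add: e1_def w_def q_def)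
  have "Ln (- w) = Ln w - \<i> * pi"
    using Ln_minus[of w] nz Rew assms by simp
  then have r3: "Digamma (- (s / 2)) = e2 + Ln w - \<i> * pi + q" by (simp add: e2_def w_def q_def)
  have r4: "Digamma s = e3 + Ln s - q / 2" by (simp add: e3_def q_def)
  have r5: "Ln s = e4 + of_real (ln t) + \<i> * pi / 2 + \<i> * (\<delta> / t)" by (simp add: e4_def)
  have "1 / (\<i> * of_real t) = - (\<i> / t)" using assms by (simp add: field_simps)
  then have r6: "q = 2 * e5 - \<i> / t" by (simp add: e5_def q_def diff_divide_distrib add_divide_distrib)
  have r7: "\<i> * of_real ((1/2 + \<delta>) / t) = (\<i> / t) / 2 + \<i> * (\<delta> / t)"
    by (simp add: add_divide_distrib distrib_left)
  have "Digamma (1 + s / 2) / 2 - Digamma (- (s / 2)) / 2 - Digamma s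
           + of_real (ln t) + \<i> * of_real ((1/2 + \<delta>) / t) = e1 / 2 - e2 / 2 - e3 - e4 + e5"
    unfolding r1 r2 r3 r4 r5 r6 r7 by (simp add: algebra_simps add_divide_distrib diff_divide_distrib)
  also have "norm \<dots> \<le> norm e1 / 2 + norm e2 / 2 + norm e3 + norm e4 + norm e5"
    by (intro order_trans[OF norm_triangle_ineq] order_trans[OF norm_triangle_ineq4] add_mono order_refl) (simp_all add: norm_divide)
  also have "\<dots> \<le> (8 / t\<^sup>2) / 2 + (8 / t\<^sup>2) / 2 + 2 / t\<^sup>2 + (1/2) / t\<^sup>2 + (1/2) / t\<^sup>2"
    by (intro add_mono divide_right_mono n1 n2 n3 n4 n5) auto
  also have "\<dots> \<le> 12 / t\<^sup>2" by (simp add: divide_right_mono flip: add_divide_distrib)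
  finally show ?thesis .
qed

lemma sine_gamma_factor_deriv:
  assumes "Im s \<noteq> 0"
  shows "(sine_gamma_factor has_field_derivative
     sine_gamma_factor s * (Digamma (1 + s / 2) / 2 - Digamma (- (s / 2)) / 2 - Digamma s)) (at s within A)"
proof -
  have ni: "z \<notin> \<int>\<^sub>\<le>\<^sub>0" if "Im z \<noteq> 0" for z :: complex
    using that by (auto elim!: nonpos_Ints_cases)
  have "1 + s / 2 \<notin> \<int>\<^sub>\<le>\<^sub>0" "- (s / 2) \<notin> \<int>\<^sub>\<le>\<^sub>0" "s \<notin> \<int>\<^sub>\<le>\<^sub>0"
    using assms by (intro ni; simp)+
  then show ?thesis
    unfolding sine_gamma_factor_def
    by (auto intro!: derivative_eq_intros simp: field_simps)
qed

text \<open>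
  The function \<open>|b|^2 e^(2 C / t)\<close> is nonincreasing, because the logarithmic derivative of \<open>|b|^2\<close> is at most
  \<open>2 C / t^2\<close>.
\<close>

lemma norm_bounded_of_log_derivative_bounded:
  fixes b \<rho> :: "real \<Rightarrow> complex"
  assumes b: "\<And>t. t \<ge> 1 \<Longrightarrow> (b has_vector_derivative \<rho> t * b t) (at t)"
    and \<rho>: "\<And>t. t \<ge> 1 \<Longrightarrow> norm (\<rho> t) \<le> C / t\<^sup>2"
    and "t \<ge> 1"
  shows "norm (b t) \<le> norm (b 1) * exp C"
proof -
  define f where "f t = ((Re (b t))\<^sup>2 + (Im (b t))\<^sup>2) * exp (2 * C / t)" for t
  have C: "C \<ge> 0" using \<rho>[of 1] norm_ge_zero[of "\<rho> 1"] by (simp del: norm_ge_zero)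
  have "f t \<le> f 1"
  proof (rule DERIV_nonpos_imp_nonincreasing[OF \<open>t \<ge> 1\<close>])
    fix u :: real assume u: "1 \<le> u" "u \<le> t"
    have dR: "((\<lambda>t. Re (b t)) has_real_derivative Re (\<rho> u * b u)) (at u)"
      using bounded_linear.has_vector_derivative[OF bounded_linear_Re b[OF u(1)]]
      by (simp add: has_real_derivative_iff_has_vector_derivative)
    have dI: "((\<lambda>t. Im (b t)) has_real_derivative Im (\<rho> u * b u)) (at u)"
      using bounded_linear.has_vector_derivative[OF bounded_linear_Im b[OF u(1)]]
      by (simp add: has_real_derivative_iff_has_vector_derivative)
    define D where "D = (2 * (Re (\<rho> u) - C / u\<^sup>2)) * ((Re (b u))\<^sup>2 + (Im (b u))\<^sup>2) * exp (2 * C / u)"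
    have sq: "((\<lambda>t. (x t)\<^sup>2) has_real_derivative 2 * x u * x') (at u)"
      if "(x has_real_derivative x') (at u)" for x :: "real \<Rightarrow> real" and x'
      using DERIV_power[OF that, of 2] by (simp add: mult_ac)
    have de: "((\<lambda>t. exp (2 * C / t)) has_real_derivative exp (2 * C / u) * (- 2 * C / u\<^sup>2)) (at u)"
      using u by (auto intro!: derivative_eq_intros simp: power2_eq_square)
    have "(f has_real_derivative (2 * Re (b u) * Re (\<rho> u * b u) + 2 * Im (b u) * Im (\<rho> u * b u)) * exp (2 * C / u)
        + exp (2 * C / u) * (- 2 * C / u\<^sup>2) * ((Re (b u))\<^sup>2 + (Im (b u))\<^sup>2)) (at u)"
      unfolding f_def by (intro DERIV_mult DERIV_add sq dR dI de)
    also have "(2 * Re (b u) * Re (\<rho> u * b u) + 2 * Im (b u) * Im (\<rho> u * b u)) * exp (2 * C / u)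
        + exp (2 * C / u) * (- 2 * C / u\<^sup>2) * ((Re (b u))\<^sup>2 + (Im (b u))\<^sup>2) = D"
      by (simp add: D_def power2_eq_square algebra_simps add_divide_distrib)
    finally have "(f has_real_derivative D) (at u)" .
    moreover have "D \<le> 0"
    proof -
      have "Re (\<rho> u) \<le> C / u\<^sup>2" using \<rho>[OF u(1)] complex_Re_le_cmod[of "\<rho> u"] by linarith
      then show ?thesis unfolding D_def by (intro mult_nonpos_nonneg[OF mult_nonpos_nonneg]) auto
    qed
    ultimately show "\<exists>y. (f has_real_derivative y) (at u) \<and> y \<le> 0" by blast
  qed
  moreover have "(norm (b t))\<^sup>2 \<le> f t"
  proof -
    have "(norm (b t))\<^sup>2 * 1 \<le> (norm (b t))\<^sup>2 * exp (2 * C / t)"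
      using C \<open>t \<ge> 1\<close> by (intro mult_left_mono) auto
    then show ?thesis by (simp add: f_def cmod_power2)
  qed
  moreover have "f 1 = (norm (b 1) * exp C)\<^sup>2"
    by (simp add: f_def cmod_power2 power_mult_distrib exp_double)
  ultimately have "(norm (b t))\<^sup>2 \<le> (norm (b 1) * exp C)\<^sup>2" by linarith
  then show ?thesis by (rule power2_le_imp_le) auto
qed

text \<open>
  A form of Stirling's formula: the gamma factor is a power of \<open>t\<close> times an oscillation times an amplitude
  \<open>b\<close> that varies slowly. Integration by parts only uses that \<open>b\<close> is bounded and that \<open>b'/b\<close> is
  \<open>O(t^(-2))\<close>, and both follow from the logarithmic derivative of the gamma factor.
\<close>

lemma sine_gamma_factor_asymptotic:
  fixes \<delta> :: real
  assumes "0 < \<delta>" "\<delta> \<le> 1/2"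
  obtains b \<rho> :: "real \<Rightarrow> complex" and B :: real where
    "\<And>t. t \<ge> 1 \<Longrightarrow> sine_gamma_factor (Complex (- \<delta>) t) = b t * of_real (t powr (1/2 + \<delta>)) * cis (- (t * ln t - t))"
    "\<And>t. t \<ge> 1 \<Longrightarrow> (b has_vector_derivative \<rho> t * b t) (at t)"
    "\<And>t. t \<ge> 1 \<Longrightarrow> norm (\<rho> t) \<le> 12 / t\<^sup>2"
    "\<And>t. t \<ge> 1 \<Longrightarrow> norm (b t) \<le> B" "B > 0"
    "continuous_on {1..} \<rho>"
proof -
  define G where "G t = sine_gamma_factor (Complex (- \<delta>) t)" for t
  define L where "L s = Digamma (1 + s / 2) / 2 - Digamma (- (s / 2)) / 2 - Digamma s" for s :: complex
  \<comment> \<open>b is the gamma factor stripped of its expected size and phase.\<close>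
  define c where "c = - (1/2 + \<delta>)"
  define b where "b t = G t * (of_real (t powr c) * cis (t * ln t - t))" for t
  define \<rho> where "\<rho> t = \<i> * (L (Complex (- \<delta>) t) + of_real (ln t) - \<i> * of_real (c / t))" for t
  have dG: "(G has_vector_derivative \<i> * (G t * L (Complex (- \<delta>) t))) (at t)" if "t \<ge> 1" for t
  proof -
    have *: "Complex (- \<delta>) t = of_real (- \<delta>) + \<i> * of_real t" for t by (simp add: complex_eq_iff)
    have "((\<lambda>t. Complex (- \<delta>) t) has_vector_derivative \<i>) (at t)"
      unfolding * by (auto intro!: derivative_eq_intros)
    moreover have "(sine_gamma_factor has_field_derivative (G t * L (Complex (- \<delta>) t))) (at (Complex (- \<delta>) t))"
      unfolding G_def L_def using that by (intro sine_gamma_factor_deriv) auto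
    ultimately have "((sine_gamma_factor \<circ> (\<lambda>t. Complex (- \<delta>) t)) has_vector_derivative (\<i> * (G t * L (Complex (- \<delta>) t)))) (at t)"
      by (rule field_vector_diff_chain_at)
    then show ?thesis by (simp add: G_def[abs_def] o_def)
  qed
  have db: "(b has_vector_derivative \<rho> t * b t) (at t)" if t: "t \<ge> 1" for t
  proof -
    have d1: "((\<lambda>t. t powr c) has_field_derivative (c * t powr (c - 1))) (at t)"
      using t by (intro has_real_derivative_powr) auto
    have d2: "((\<lambda>t. t * ln t - t) has_field_derivative ln t) (at t)"
      using t by (auto intro!: derivative_eq_intros)
    have "(b has_vector_derivative G t * (of_real (t powr c) * (of_real (ln t) * (\<i> * cis (t * ln t - t)))
        + of_real (c * t powr (c - 1)) * cis (t * ln t - t))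
        + \<i> * (G t * L (Complex (- \<delta>) t)) * (of_real (t powr c) * cis (t * ln t - t))) (at t)"
      unfolding b_def[abs_def]
      by (intro has_vector_derivative_mult has_vector_derivative_of_real has_vector_derivative_cis dG[OF t] d1 d2)
    moreover have "t powr (c - 1) = t powr c / t"
      using t by (simp add: powr_diff)
    ultimately show ?thesis
      unfolding \<rho>_def b_def using t by (simp add: algebra_simps add_divide_distrib diff_divide_distrib)
  qed
  have nr: "norm (\<rho> t) \<le> 12 / t\<^sup>2" if "t \<ge> 1" for t
  proof -
    have "complex_of_real ((1/2 + \<delta>) / t) = - of_real (c / t)"
      by (simp only: c_def minus_divide_left[symmetric] of_real_minus minus_minus)
    then show ?thesis
      using sine_gamma_factor_log_derivative[OF assms that] by (simp add: \<rho>_def L_def norm_mult)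
  qed
  show ?thesis
  proof (rule that)
    show "sine_gamma_factor (Complex (- \<delta>) t) = b t * of_real (t powr (1/2 + \<delta>)) * cis (- (t * ln t - t))" if "t \<ge> 1" for t
    proof -
      have "b t * of_real (t powr (1/2 + \<delta>)) * cis (- (t * ln t - t))
        = G t * of_real (t powr (- (1/2 + \<delta>)) * t powr (1/2 + \<delta>)) * (cis (t * ln t - t) * cis (- (t * ln t - t)))"
        by (simp add: b_def c_def mult_ac)
      also have "t powr (- (1/2 + \<delta>)) * t powr (1/2 + \<delta>) = 1"
        using that by (simp flip: powr_add)
      also have "cis (t * ln t - t) * cis (- (t * ln t - t)) = 1" by (simp add: cis_mult)
      finally show ?thesis by (simp add: G_def)
    qed
    show "(b has_vector_derivative \<rho> t * b t) (at t)" if "t \<ge> 1" for t by (rule db[OF that])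
    show "norm (\<rho> t) \<le> 12 / t\<^sup>2" if "t \<ge> 1" for t by (rule nr[OF that])
    show "norm (b t) \<le> norm (b 1) * exp 12 + 1" if "t \<ge> 1" for t
      using norm_bounded_of_log_derivative_bounded[OF db nr that] by simp
    show "norm (b 1) * exp 12 + 1 > 0" by (intro add_nonneg_pos) auto
    have ni: "z \<notin> \<int>\<^sub>\<le>\<^sub>0" if "Im z \<noteq> 0" for z :: complex
      using that by (auto elim!: nonpos_Ints_cases)
    have continuous_on_Polygamma': "continuous_on {z. Im z \<noteq> 0} (Digamma :: complex \<Rightarrow> complex)"
      by (intro continuous_on_Polygamma) (auto dest: ni)
    show "continuous_on {1..} \<rho>"
      unfolding \<rho>_def[abs_def] L_def
      by (intro continuous_intros continuous_on_compose2[OF continuous_on_Polygamma'] ni) auto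
  qed
qed

section \<open>Mellin transforms\<close>

lemma absolutely_integrable_lborelI:
  fixes f :: "real \<Rightarrow> complex"
  assumes "set_integrable lborel S f"
  shows "f absolutely_integrable_on S"
  using assms unfolding set_integrable_def
  by (subst integrable_completion) (auto dest: borel_measurable_integrable)

text \<open>
  The substitution \<open>u = (y/a)^2\<close> in the beta integral with \<open>p = 1 + s/2\<close>.
\<close>

lemma mellin_rational:
  fixes s :: complex and a :: real
  assumes s: "-2 < Re s" "Re s < 0" and a: "a > 0"
  shows "((\<lambda>y. of_real (y\<^sup>2 / (a * (y\<^sup>2 + a\<^sup>2))) * of_real y powr (s - 1)) has_integral
     of_real a powr (s - 1) * (Gamma (1 + s / 2) * Gamma (- (s / 2)) / 2)) {0<..}"
proof -
  define p where "p = 1 + s / 2"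
  have p: "0 < Re p" "Re p < 1" using s by (auto simp: p_def)
  define f where "f u = exp ((p - 1) * of_real (ln u)) / of_real (1 + u)" for u :: real
  define g g' where "g y = (y / a)\<^sup>2" and "g' y = 2 * y / a\<^sup>2" for y
  have f: "f absolutely_integrable_on {0<..}"
    unfolding f_def using beta_integral_Gamma(1)[OF p] by (rule absolutely_integrable_lborelI)
  have fv: "integral {0<..} f = Gamma p * Gamma (1 - p)"
    unfolding f_def using beta_integral_Gamma(2)[OF p] set_borel_integral_eq_integral(2)[OF beta_integral_Gamma(1)[OF p]] by simp
  have cf: "continuous_on {0<..} f"
  proof -
    have "1 + complex_of_real x \<noteq> 0" if "x > 0" for x
      using that by (simp add: complex_eq_iff)
    then show ?thesis unfolding f_def by (auto intro!: continuous_intros)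
  qed
  have dg: "(g has_field_derivative g' y) (at y)" for y
    unfolding g_def g'_def using a by (auto intro!: derivative_eq_intros simp: power2_eq_square)
  have *: "((\<lambda>y. of_real (g' y) * f (g y)) has_integral Gamma p * Gamma (1 - p)) {0<..}"
  proof -
    have "(\<lambda>k. 1 / real (Suc k)) \<longlonglongrightarrow> 0" by (rule lim_1_over_n[THEN LIMSEQ_Suc])
    then have "(\<lambda>k. (1 / real (Suc k) / a)\<^sup>2) \<longlonglongrightarrow> (0 / a)\<^sup>2" using a by (intro tendsto_intros) auto
    then have lim0: "(\<lambda>k. g (1 / real (Suc k))) \<longlonglongrightarrow> 0" by (simp add: g_def)
    have "filterlim (\<lambda>k. real (Suc k)) at_top sequentially"
      by (rule filterlim_compose[OF filterlim_real_sequentially filterlim_Suc])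
    then have "filterlim (\<lambda>k. (1 / a) * real (Suc k)) at_top sequentially"
      using a by (intro filterlim_tendsto_pos_mult_at_top[OF tendsto_const]) auto
    then have "filterlim (\<lambda>k. ((1 / a) * real (Suc k)) ^ 2) at_top sequentially"
      by (intro filterlim_pow_at_top) auto
    then have lim1: "filterlim (\<lambda>k. g (real (Suc k))) at_top sequentially" by (simp add: g_def field_simps)
    have cg': "continuous_on {0<..} g'" unfolding g'_def using a by (intro continuous_intros) auto
    have pos: "g x > 0" "g' x \<ge> 0" if "x > 0" for x using that a by (auto simp: g_def g'_def)
    have mono: "g x \<le> g y" if "0 < x" "x \<le> y" for x y
      unfolding g_def using that a by (intro power_mono divide_right_mono) auto
    show ?thesis using has_integral_substitution_halfline[OF f cf dg cg' pos mono lim0 lim1] fv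
      by (auto simp: has_integral_iff absolutely_integrable_on_def)
  qed
  have **: "of_real (y\<^sup>2 / (a * (y\<^sup>2 + a\<^sup>2))) * of_real y powr (s - 1) = of_real a powr (s - 1) / 2 * (of_real (g' y) * f (g y))"
    if "y \<in> {0<..}" for y
  proof -
    have y: "y > 0" using that by simp
    have pos: "y\<^sup>2 + a\<^sup>2 > 0" using y by (intro add_pos_nonneg) auto
    have ya: "of_real y = exp (of_real (ln y) :: complex)" "of_real a = exp (of_real (ln a) :: complex)"
      using y a by (simp_all only: exp_of_real exp_ln)
    define r where "r = a\<^sup>2 / (y\<^sup>2 + a\<^sup>2)"
    have "f (g y) = exp ((s / 2) * of_real (2 * (ln y - ln a))) / of_real (1 + (y / a)\<^sup>2)"
      using y a by (simp add: f_def g_def p_def ln_realpow ln_div)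
    also have "(s / 2) * of_real (2 * (ln y - ln a)) = s * of_real (ln y) - s * of_real (ln a)"
      by (simp add: algebra_simps)
    also have "exp \<dots> = exp (s * of_real (ln y)) / exp (s * of_real (ln a))" by (rule exp_diff)
    finally have 1: "f (g y) = exp (s * of_real (ln y)) / exp (s * of_real (ln a)) * of_real r"
      using a pos by (simp add: r_def divide_simps power_divide add.commute)
    have 2: "of_real y powr (s - 1) = exp (s * of_real (ln y)) / of_real y" "of_real a powr (s - 1) = exp (s * of_real (ln a)) / of_real a"
      using y a by (simp_all add: powr_def Ln_of_real left_diff_distrib exp_diff ya[symmetric])
    have 3: "y\<^sup>2 / (a * (y\<^sup>2 + a\<^sup>2)) * (1 / y) = (1 / a) / 2 * (g' y * r)"
      using y a pos by (simp add: r_def g'_def power2_eq_square)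
    have "of_real (y\<^sup>2 / (a * (y\<^sup>2 + a\<^sup>2))) * of_real y powr (s - 1)
      = exp (s * of_real (ln y)) * of_real (y\<^sup>2 / (a * (y\<^sup>2 + a\<^sup>2)) * (1 / y))"
      unfolding 2 by simp
    also have "\<dots> = exp (s * of_real (ln y)) * of_real ((1 / a) / 2 * (g' y * r))"
      by (simp only: 3)
    also have "\<dots> = of_real a powr (s - 1) / 2 * (of_real (g' y) * f (g y))"
      unfolding 1 2 by simp
    finally show ?thesis .
  qed
  have "((\<lambda>y. of_real a powr (s - 1) / 2 * (of_real (g' y) * f (g y))) has_integral of_real a powr (s - 1) / 2 * (Gamma p * Gamma (1 - p))) {0<..}"
    by (rule has_integral_mult_right[OF *])
  then have "((\<lambda>y. of_real (y\<^sup>2 / (a * (y\<^sup>2 + a\<^sup>2))) * of_real y powr (s - 1)) has_integral of_real a powr (s - 1) / 2 * (Gamma p * Gamma (1 - p))) {0<..}"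
    by (rule has_integral_eq[rotated]) (rule **[symmetric])
  then show ?thesis by (simp add: p_def)
qed

text \<open>
  Integration by parts reduces the integral to \<open>\<Gamma>(s + 1) / s\<close>. The boundary terms vanish at \<open>0\<close> because
  \<open>e^(-y) - 1\<close> is of order \<open>y\<close>, and at infinity because \<open>Re s < 0\<close>. The same computation with the real
  exponent \<open>Re s\<close> bounds the integrals of the modulus.
\<close>

lemma Gamma_integral_below_zero:
  fixes s :: complex
  assumes s: "-1 < Re s" "Re s < 0"
  shows "(\<lambda>y. of_real (exp (- y) - 1) * of_real y powr (s - 1)) absolutely_integrable_on {0<..}"
    and "integral {0<..} (\<lambda>y. of_real (exp (- y) - 1) * of_real y powr (s - 1)) = Gamma s"
proof -
  define \<sigma> where "\<sigma> = Re s"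
  have \<sigma>: "-1 < \<sigma>" "\<sigma> < 0" and s0: "s \<noteq> 0" using s by (auto simp: \<sigma>_def)
  define u v where "u k = 1 / real (Suc k)" and "v k = real (Suc k)" for k
  have uv: "0 < u k" "u k \<le> 1" "1 \<le> v k" for k by (auto simp: u_def v_def)
  define f where "f y = of_real (exp (- y) - 1) * of_real y powr (s - 1)" for y :: real
  have cf: "continuous_on {0<..} f"
    unfolding f_def by (intro continuous_intros) auto
  have fi: "f integrable_on {u k..v k}" for k
    using uv(1)[of k] by (intro integrable_continuous_real continuous_on_subset[OF cf]) auto
  have nE: "norm (complex_of_real (exp (- y) - 1)) = 1 - exp (- y)" if "y > 0" for y
    using that by (simp only: norm_of_real) simp
  have nf: "norm (f y) = (1 - exp (- y)) * y powr (\<sigma> - 1)" if "y > 0" for y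
    using that nE[OF that] by (simp add: f_def \<sigma>_def norm_mult norm_powr_real_powr del: of_real_diff)
  define F where "F y = of_real (exp (- y) - 1) * of_real y powr s / s" for y :: real
  define e where "e y = of_real y powr s / of_real (exp y)" for y :: real
  have dF: "(F has_vector_derivative f y - e y / s) (at y within A)" if y: "y > 0" for y A
  proof -
    have 1: "((\<lambda>y. complex_of_real (exp (- y) - 1)) has_vector_derivative of_real (- exp (- y))) (at y within A)"
      by (intro has_vector_derivative_of_real) (auto intro!: derivative_eq_intros)
    have 2: "((\<lambda>y. complex_of_real y powr s) has_vector_derivative s * of_real y powr (s - 1)) (at y within A)"
      using y by (intro has_vector_derivative_real_field has_field_derivative_powr) auto
    have "(F has_vector_derivative (of_real (exp (- y) - 1) * (s * of_real y powr (s - 1)) + of_real (- exp (- y)) * of_real y powr s) / s) (at y within A)"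
      unfolding F_def by (intro has_vector_derivative_divide has_vector_derivative_mult 1 2)
    also have "(of_real (exp (- y) - 1) * (s * of_real y powr (s - 1)) + of_real (- exp (- y)) * of_real y powr s) / s = f y - e y / s"
      using s0 by (simp add: f_def e_def exp_minus field_simps)
    finally show ?thesis .
  qed
  have e_abs: "e absolutely_integrable_on {0<..}" and e_int: "integral {0<..} e = Gamma (s + 1)"
    using absolutely_integrable_Gamma_integral'[of "s + 1"] integral_unique[OF Gamma_integral_complex'[of "s + 1"]] s
    by (simp_all add: e_def[abs_def])
  have ce: "continuous_on {0<..} e" unfolding e_def by (intro continuous_intros) auto
  have ei: "e integrable_on {u k..v k}" for k
    using uv(1)[of k] by (intro integrable_continuous_real continuous_on_subset[OF ce]) auto
  have parts: "integral {u k..v k} f = F (v k) - F (u k) + integral {u k..v k} e / s" for k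
  proof -
    have "u k \<le> v k" using uv(2)[of k] uv(3)[of k] by linarith
    then have "((\<lambda>y. f y - e y / s) has_integral (F (v k) - F (u k))) {u k..v k}"
    proof (rule fundamental_theorem_of_calculus)
      fix y assume "y \<in> {u k..v k}"
      then have "y > 0" using less_le_trans[OF uv(1)[of k], of y] by simp
      then show "(F has_vector_derivative f y - e y / s) (at y within {u k..v k})" by (rule dF)
    qed
    moreover have "((\<lambda>y. e y / s) has_integral integral {u k..v k} e / s) {u k..v k}"
      by (rule has_integral_divide[OF integrable_integral[OF ei]])
    ultimately have "((\<lambda>y. (f y - e y / s) + e y / s) has_integral (F (v k) - F (u k)) + integral {u k..v k} e / s) {u k..v k}"
      by (rule has_integral_add)
    then show ?thesis by (simp add: integral_unique)
  qed
  have nh: "(\<lambda>y. norm (f y)) integrable_on {0<..}"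
  proof (rule improper_integrable_bounded)
    fix k
    show "(\<lambda>y. norm (f y)) integrable_on {1 / real (Suc k)..real (Suc k)}"
      using less_le_trans[OF uv(1)[of k]]
      by (intro integrable_continuous_real continuous_intros continuous_on_subset[OF cf]) (auto simp: u_def simp del: of_nat_Suc)
    define Fr where "Fr y = (exp (- y) - 1) * y powr \<sigma> / \<sigma>" for y :: real
    define er where "er y = y powr \<sigma> / exp y" for y :: real
    have "u k \<le> v k" using uv(2)[of k] uv(3)[of k] by linarith
    then have I: "((\<lambda>y. - norm (f y) - er y / \<sigma>) has_integral (Fr (v k) - Fr (u k))) {u k..v k}"
    proof (rule fundamental_theorem_of_calculus)
      fix y assume "y \<in> {u k..v k}"
      then have y: "y > 0" using less_le_trans[OF uv(1)[of k], of y] by simp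
      have p: "((\<lambda>y. y powr \<sigma>) has_real_derivative \<sigma> * y powr (\<sigma> - 1)) (at y within {u k..v k})"
        using y by (intro has_field_derivative_at_within[OF has_real_derivative_powr]) auto
      have q: "((\<lambda>y. exp (- y) - 1) has_real_derivative - exp (- y)) (at y within {u k..v k})"
        by (auto intro!: derivative_eq_intros)
      have "(Fr has_real_derivative ((- exp (- y)) * y powr \<sigma> + \<sigma> * y powr (\<sigma> - 1) * (exp (- y) - 1)) / \<sigma>) (at y within {u k..v k})"
        unfolding Fr_def by (intro DERIV_cdivide DERIV_mult p q)
      also have "((- exp (- y)) * y powr \<sigma> + \<sigma> * y powr (\<sigma> - 1) * (exp (- y) - 1)) / \<sigma> = - norm (f y) - er y / \<sigma>"
        using \<sigma> by (simp add: nf[OF y] er_def exp_minus field_simps)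
      finally show "(Fr has_vector_derivative - norm (f y) - er y / \<sigma>) (at y within {u k..v k})"
        by (simp add: has_real_derivative_iff_has_vector_derivative)
    qed
    have cer: "continuous_on {0<..} er" unfolding er_def by (intro continuous_intros) auto
    have eri: "er integrable_on {u k..v k}"
      using uv(1)[of k] by (intro integrable_continuous_real continuous_on_subset[OF cer]) auto
    have "integral {u k..v k} er \<le> integral {0..} er"
    proof (rule integral_subset_le)
      show "{u k..v k} \<subseteq> {0..}" using uv(1)[of k] by auto
      show "er integrable_on {0..}" using Gamma_integral_real[of "\<sigma> + 1"] \<sigma> by (auto simp: er_def[abs_def])
    qed (use eri in \<open>auto simp: er_def\<close>)
    also have "integral {0..} er = Gamma (\<sigma> + 1)"
      using integral_unique[OF Gamma_integral_real[of "\<sigma> + 1"]] \<sigma> by (simp add: er_def[abs_def])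
    finally have er_le: "integral {u k..v k} er \<le> Gamma (\<sigma> + 1)" .
    have "((\<lambda>y. - 1 * ((- norm (f y) - er y / \<sigma>) + er y / \<sigma>)) has_integral - 1 * ((Fr (v k) - Fr (u k)) + integral {u k..v k} er / \<sigma>)) {u k..v k}"
      by (intro has_integral_mult_right has_integral_add I has_integral_divide integrable_integral eri)
    then have "integral {u k..v k} (\<lambda>y. norm (f y)) = Fr (u k) - Fr (v k) - integral {u k..v k} er / \<sigma>"
      by (simp add: integral_unique)
    moreover have "Fr (u k) \<le> 1 / (- \<sigma>)"
    proof -
      have "(1 - exp (- u k)) * u k powr \<sigma> \<le> u k * u k powr \<sigma>"
        using exp_ge_add_one_self[of "- u k"] by (intro mult_right_mono) auto
      also have "\<dots> = u k powr (\<sigma> + 1)" using uv(1)[of k] by (simp add: powr_add)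
      also have "\<dots> \<le> 1" using uv[of k] \<sigma> by (intro powr_le1) auto
      finally have "(1 - exp (- u k)) * u k powr \<sigma> \<le> 1" .
      then have "(1 - exp (- u k)) * u k powr \<sigma> / (- \<sigma>) \<le> 1 / (- \<sigma>)" using \<sigma> by (intro divide_right_mono) auto
      moreover have "Fr (u k) = (1 - exp (- u k)) * u k powr \<sigma> / (- \<sigma>)"
        using \<sigma> by (simp add: Fr_def field_simps)
      ultimately show ?thesis by simp
    qed
    moreover have "Fr (v k) \<ge> 0" unfolding Fr_def using \<sigma> uv(3)[of k] by (intro divide_nonpos_neg mult_nonpos_nonneg) auto
    moreover have "- (integral {u k..v k} er / \<sigma>) \<le> Gamma (\<sigma> + 1) / (- \<sigma>)"
      using divide_right_mono[OF er_le, of "- \<sigma>"] \<sigma> by simp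
    ultimately have "integral {u k..v k} (\<lambda>y. norm (f y)) \<le> 1 / (- \<sigma>) + Gamma (\<sigma> + 1) / (- \<sigma>)"
      by linarith
    then show "integral {1 / real (Suc k)..real (Suc k)} (\<lambda>y. norm (f y)) \<le> 1 / (- \<sigma>) + Gamma (\<sigma> + 1) / (- \<sigma>)"
      by (simp add: u_def v_def)
  qed auto
  have u0: "u \<longlonglongrightarrow> 0" unfolding u_def by (rule lim_1_over_n[THEN LIMSEQ_Suc])
  have v1: "filterlim v at_top sequentially" unfolding v_def by (rule filterlim_compose[OF filterlim_real_sequentially filterlim_Suc])
  note D = improper_integral_dominated[OF nh order_refl fi uv(1) u0 v1]
  show "(\<lambda>y. of_real (exp (- y) - 1) * of_real y powr (s - 1)) absolutely_integrable_on {0<..}"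
    using D(1) nh unfolding f_def[abs_def] absolutely_integrable_on_def by simp
  have e_lim: "(\<lambda>k. integral {u k..v k} e) \<longlonglongrightarrow> Gamma (s + 1)"
    using improper_integral_dominated(2)[of "\<lambda>y. norm (e y)" e, OF _ order_refl ei uv(1) u0 v1] e_abs e_int
    by (simp add: absolutely_integrable_on_def)
  have Fv: "(\<lambda>k. F (v k)) \<longlonglongrightarrow> 0"
  proof (rule Lim_null_comparison)
    show "(\<lambda>k. v k powr \<sigma> / norm s) \<longlonglongrightarrow> 0"
      using tendsto_divide[OF tendsto_neg_powr[OF \<sigma>(2) v1] tendsto_const[of "norm s"]] s0 by simp
    show "\<forall>\<^sub>F k in sequentially. norm (F (v k)) \<le> v k powr \<sigma> / norm s"
    proof (intro always_eventually allI)
      fix k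
      have "norm (F (v k)) = (1 - exp (- v k)) * v k powr \<sigma> / norm s"
        using uv(3)[of k] nE[of "v k"] by (simp add: F_def \<sigma>_def norm_mult norm_divide norm_powr_real_powr del: of_real_diff)
      also have "\<dots> \<le> 1 * v k powr \<sigma> / norm s" by (intro divide_right_mono mult_right_mono) auto
      finally show "norm (F (v k)) \<le> v k powr \<sigma> / norm s" by simp
    qed
  qed
  have Fu: "(\<lambda>k. F (u k)) \<longlonglongrightarrow> 0"
  proof (rule Lim_null_comparison)
    have "(\<lambda>k. v k powr (- (\<sigma> + 1))) \<longlonglongrightarrow> 0" using \<sigma> by (intro tendsto_neg_powr v1) auto
    then show "(\<lambda>k. v k powr (- (\<sigma> + 1)) / norm s) \<longlonglongrightarrow> 0"
      using tendsto_divide[OF _ tendsto_const[of "norm s"]] s0 by fastforce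
    show "\<forall>\<^sub>F k in sequentially. norm (F (u k)) \<le> v k powr (- (\<sigma> + 1)) / norm s"
    proof (intro always_eventually allI)
      fix k
      have "norm (F (u k)) = (1 - exp (- u k)) * u k powr \<sigma> / norm s"
        using uv(1)[of k] nE[of "u k"] by (simp add: F_def \<sigma>_def norm_mult norm_divide norm_powr_real_powr del: of_real_diff)
      also have "\<dots> \<le> u k * u k powr \<sigma> / norm s"
        using exp_ge_add_one_self[of "- u k"] by (intro divide_right_mono mult_right_mono) auto
      also have "u k * u k powr \<sigma> = u k powr (\<sigma> + 1)" using uv(1)[of k] by (simp add: powr_add)
      also have "u k powr (\<sigma> + 1) = v k powr (- (\<sigma> + 1))"
      proof -
        have "u k = inverse (v k)" by (simp add: u_def v_def inverse_eq_divide)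
        then show ?thesis using uv(3)[of k] inverse_powr[of "v k" "\<sigma> + 1"] powr_minus[of "v k" "\<sigma> + 1"] by simp
      qed
      finally show "norm (F (u k)) \<le> v k powr (- (\<sigma> + 1)) / norm s" .
    qed
  qed
  have "(\<lambda>k. integral {u k..v k} f) \<longlonglongrightarrow> 0 - 0 + Gamma (s + 1) / s"
    unfolding parts using s0 by (intro tendsto_intros Fv Fu e_lim)
  then have "integral {0<..} f = Gamma (s + 1) / s" using D(2) LIMSEQ_unique by fastforce
  also have "s \<notin> \<int>\<^sub>\<le>\<^sub>0"
  proof
    assume "s \<in> \<int>\<^sub>\<le>\<^sub>0"
    then obtain n where "s = - of_nat n" by (auto elim: nonpos_Ints_cases')
    then show False using s by (cases n) auto
  qed
  then have "Gamma (s + 1) / s = Gamma s" using s0 by (simp add: Gamma_plus1)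
  finally show "integral {0<..} (\<lambda>y. of_real (exp (- y) - 1) * of_real y powr (s - 1)) = Gamma s"
    by (simp add: f_def[abs_def])
qed

section \<open>The functional equation of the sine series\<close>

lemma Gamma_integral_below_zero_scaled:
  fixes s :: complex and n :: nat
  assumes s: "-1 < Re s" "Re s < 0"
  shows "((\<lambda>y. of_real (exp (- real n * y) - 1) * of_real y powr (s - 1)) has_integral of_nat n powr (- s) * Gamma s) {0<..}"
proof (cases "n = 0")
  case False
  then have n: "real n > 0" by simp
  define f where "f y = of_real (exp (- y) - 1) * of_real y powr (s - 1)" for y :: real
  have f: "f absolutely_integrable_on {0<..}" "integral {0<..} f = Gamma s"
    using Gamma_integral_below_zero[OF s] by (simp_all add: f_def[abs_def])
  have cf: "continuous_on {0<..} f"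
    unfolding f_def by (intro continuous_intros) auto
  have dg: "((\<lambda>y. real n * y) has_field_derivative real n) (at y)" for y by (auto intro!: derivative_eq_intros)
  have lim: "(\<lambda>k. real n * (1 / real (Suc k))) \<longlonglongrightarrow> 0"
    using tendsto_mult[OF tendsto_const[of "real n"] lim_1_over_n[THEN LIMSEQ_Suc]] by simp
  have lim': "filterlim (\<lambda>k. real n * real (Suc k)) at_top sequentially"
    using n by (intro filterlim_tendsto_pos_mult_at_top[OF tendsto_const]
       filterlim_compose[OF filterlim_real_sequentially filterlim_Suc]) auto
  have mono: "real n * x \<le> real n * y" if "0 < x" "x \<le> y" for x y using that by (intro mult_left_mono) auto
  note S = has_integral_substitution_halfline[OF f(1) cf dg _ _ _ mono lim lim']
  have "((\<lambda>y. of_real (real n) * f (real n * y)) has_integral Gamma s) {0<..}"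
    using S n f(2) by (simp add: has_integral_iff absolutely_integrable_on_def)
  then have "((\<lambda>y. of_nat n powr (- s) * (of_real (real n) * f (real n * y))) has_integral of_nat n powr (- s) * Gamma s) {0<..}"
    by (rule has_integral_mult_right)
  then show ?thesis
  proof (rule has_integral_eq[rotated])
    fix y :: real assume "y \<in> {0<..}"
    then have "of_real (real n * y) powr (s - 1) = of_real (real n) powr (s - 1) * of_real y powr (s - 1)"
      unfolding of_real_mult by (intro powr_times_real) auto
    moreover have "of_nat n powr (- s) * (of_nat n * of_real (real n) powr (s - 1)) = (1 :: complex)"
    proof -
      have "of_nat n * of_real (real n) powr (s - 1) = of_nat n powr s"
        using n by (simp add: powr_diff)
      then show ?thesis using n by (simp add: powr_minus)
    qed
    ultimately show "of_nat n powr (- s) * (of_real (real n) * f (real n * y)) = of_real (exp (- real n * y) - 1) * of_real y powr (s - 1)"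
      by (simp add: f_def mult_ac)
  qed
qed simp

text \<open>
  The second difference in \<open>n\<close> of \<open>e^(-n y) - 1\<close> is \<open>e^(-n y) (1 - e^(-y))^2\<close>.
\<close>

lemma second_diff_integral:
  fixes s :: complex
  assumes s: "-1 < Re s" "Re s < 0"
  shows "((\<lambda>y. of_real (exp (- real n * y) * (1 - exp (- y))\<^sup>2) * of_real y powr (s - 1)) has_integral second_diff_powr n s * Gamma s) {0<..}"
proof -
  let ?A = "\<lambda>n y. of_real (exp (- real n * y) - 1) * of_real y powr (s - 1)"
  have "((\<lambda>y. ?A (n + 2) y - 2 * ?A (n + 1) y + ?A n y) has_integral
      (of_nat (n + 2) powr (- s) * Gamma s - 2 * (of_nat (n + 1) powr (- s) * Gamma s) + of_nat n powr (- s) * Gamma s)) {0<..}"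
    by (intro has_integral_add has_integral_diff has_integral_mult_right Gamma_integral_below_zero_scaled s)
  moreover have "?A (n + 2) y - 2 * ?A (n + 1) y + ?A n y = of_real (exp (- real n * y) * (1 - exp (- y))\<^sup>2) * of_real y powr (s - 1)" for y
  proof -
    have e: "exp (- real (n + 2) * y) = exp (- real n * y) * exp (- y) * exp (- y)" "exp (- real (n + 1) * y) = exp (- real n * y) * exp (- y)"
      by (simp_all add: algebra_simps flip: exp_add)
    define E X P where "E = exp (- y)" and "X = exp (- real n * y)" and "P = complex_of_real y powr (s - 1)"
    show ?thesis unfolding e E_def[symmetric] X_def[symmetric] P_def[symmetric]
      by (simp add: power2_eq_square algebra_simps)
  qed
  ultimately show ?thesis by (simp add: second_diff_powr_def algebra_simps)
qed

text \<open>
  The second difference integrals are summed against \<open>z^(n + 2)\<close> under the integral sign, and the integrand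
  becomes a geometric series. The constant \<open>z/(1 - z)\<close> is the value of the first summand at \<open>y = 0\<close>; subtracting it
  makes the integral converge at \<open>0\<close> for negative \<open>Re s\<close>.
\<close>

lemma polylog_cont_integral:
  fixes s z :: complex
  assumes s: "-1 < Re s" "Re s < 0" and z: "norm z = 1" "z \<noteq> 1"
  shows "((\<lambda>y. (z * exp (- of_real y) / (1 - z * exp (- of_real y)) - z / (1 - z)) * of_real y powr (s - 1))
     has_integral Gamma s * polylog_cont z s) {0<..}"
proof -
  define f where "f n y = z ^ (n + 2) * (of_real (exp (- real n * y) * (1 - exp (- y))\<^sup>2) * of_real y powr (s - 1))" for n and y :: real
  define S where "S = (\<Sum>n. z ^ (n + 2) * second_diff_powr n s)"
  \<comment> \<open>The integral of the modulus: the same integral with s replaced by Re s.\<close>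
  define J where "J n = Re (second_diff_powr n (of_real (Re s)) * Gamma (of_real (Re s)))" for n
  have fi: "(f n has_integral z ^ (n + 2) * (second_diff_powr n s * Gamma s)) {0<..}" for n
    unfolding f_def by (intro has_integral_mult_right second_diff_integral s)
  have nf: "norm (f n y) = exp (- real n * y) * (1 - exp (- y))\<^sup>2 * y powr (Re s - 1)" if "y > 0" for n y
    using that z by (simp add: f_def norm_mult norm_power norm_powr_real_powr del: of_real_mult of_real_power of_real_diff)
  have Re_powr: "Re (of_real x * of_real y powr (of_real (Re s) - 1)) = x * y powr (Re s - 1)" if "y > 0" for x y
  proof -
    have "complex_of_real y powr (of_real (Re s) - 1) = of_real (y powr (Re s - 1))"
      using that powr_of_real[of y "Re s - 1"] by simp
    then show ?thesis by simp
  qed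
  have fJ: "((\<lambda>y. norm (f n y)) has_integral J n) {0<..}" for n
  proof -
    have "((\<lambda>y. Re (of_real (exp (- real n * y) * (1 - exp (- y))\<^sup>2) * of_real y powr (of_real (Re s) - 1))) has_integral J n) {0<..}"
      unfolding J_def using s by (intro has_integral_Re second_diff_integral) auto
    then show ?thesis by (rule has_integral_eq[rotated]) (simp only: nf Re_powr greaterThan_iff)
  qed
  have sJ: "summable J"
  proof (rule summable_comparison_test)
    have "summable (\<lambda>n. norm (z ^ (n + 2) * second_diff_powr n (of_real (Re s))))"
      using s z by (intro summable_polylog_cont) auto
    then have "summable (\<lambda>n. norm (second_diff_powr n (of_real (Re s))))" using z by (simp add: norm_mult norm_power)
    then show "summable (\<lambda>n. norm (second_diff_powr n (of_real (Re s))) * norm (Gamma (complex_of_real (Re s))))"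
      by (rule summable_mult2)
    show "\<exists>N. \<forall>n\<ge>N. norm (J n) \<le> norm (second_diff_powr n (of_real (Re s))) * norm (Gamma (complex_of_real (Re s)))"
      unfolding J_def norm_mult[symmetric] real_norm_def by (intro exI allI impI abs_Re_le_cmod)
  qed
  have zE: "norm (z * exp (- of_real y)) < 1" if "y > 0" for y
    using that z by (simp add: norm_mult)
  have geo: "(\<lambda>n. (z * exp (- of_real y)) ^ n) sums (1 / (1 - z * exp (- of_real y)))" if "y > 0" for y
    using zE[OF that] by (rule geometric_sums)
  have fgeo: "f n y = (z * exp (- of_real y)) ^ n * (z\<^sup>2 * of_real ((1 - exp (- y))\<^sup>2) * of_real y powr (s - 1))" for n y
  proof -
    have "exp (- real n * y) = exp (- y) ^ n" by (simp flip: exp_of_nat_mult)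
    then show ?thesis by (simp add: f_def power_mult_distrib power_add power2_eq_square mult_ac exp_of_real flip: of_real_minus)
  qed
  have fs: "summable (\<lambda>n. norm (f n y))" if "y \<in> {0<..}" for y
  proof -
    have "summable (\<lambda>n. norm (z * exp (- of_real y)) ^ n * norm (z\<^sup>2 * of_real ((1 - exp (- y))\<^sup>2) * of_real y powr (s - 1)))"
      using zE[of y] that by (intro summable_mult2 summable_geometric) auto
    then show ?thesis unfolding fgeo norm_mult norm_power by (simp only: norm_mult norm_power)
  qed
  have sumf: "(\<Sum>n. f n y) = z\<^sup>2 * of_real ((1 - exp (- y))\<^sup>2) / (1 - z * exp (- of_real y)) * of_real y powr (s - 1)" if "y > 0" for y
    using sums_mult2[OF geo[OF that], of "z\<^sup>2 * of_real ((1 - exp (- y))\<^sup>2) * of_real y powr (s - 1)"]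
    unfolding fgeo by (simp add: sums_iff)
  have sI: "(\<Sum>n. z ^ (n + 2) * (second_diff_powr n s * Gamma s)) = S * Gamma s"
    unfolding S_def using suminf_mult2[OF summable_norm_cancel[OF summable_polylog_cont[OF z(1), of s]], of "Gamma s"] s by (simp add: mult.assoc)
  have "((\<lambda>y. \<Sum>n. f n y) has_integral S * Gamma s) {0<..}"
    using has_integral_suminf(1)[OF fi fJ sJ fs] by (simp only: sI)
  then have "((\<lambda>y. z\<^sup>2 * of_real ((1 - exp (- y))\<^sup>2) / (1 - z * exp (- of_real y)) * of_real y powr (s - 1)) has_integral S * Gamma s) {0<..}"
    by (rule has_integral_eq[rotated]) (simp only: sumf greaterThan_iff)
  moreover have "((\<lambda>y. z * (of_real (exp (- y) - 1) * of_real y powr (s - 1))) has_integral z * Gamma s) {0<..}"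
    using Gamma_integral_below_zero_scaled[OF s, of 1] by (intro has_integral_mult_right) simp
  ultimately have "((\<lambda>y. z\<^sup>2 * of_real ((1 - exp (- y))\<^sup>2) / (1 - z * exp (- of_real y)) * of_real y powr (s - 1) + z * (of_real (exp (- y) - 1) * of_real y powr (s - 1)))
       has_integral (S * Gamma s + z * Gamma s)) {0<..}"
    by (rule has_integral_add)
  then have "((\<lambda>y. (z\<^sup>2 * of_real ((1 - exp (- y))\<^sup>2) / (1 - z * exp (- of_real y)) * of_real y powr (s - 1) + z * (of_real (exp (- y) - 1) * of_real y powr (s - 1))) / (1 - z)\<^sup>2)
       has_integral (S * Gamma s + z * Gamma s) / (1 - z)\<^sup>2) {0<..}"
    by (rule has_integral_divide)
  also have "(S * Gamma s + z * Gamma s) / (1 - z)\<^sup>2 = Gamma s * polylog_cont z s"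
    by (simp add: polylog_cont_def S_def algebra_simps)
  finally have I: "((\<lambda>y. (z\<^sup>2 * of_real ((1 - exp (- y))\<^sup>2) / (1 - z * exp (- of_real y)) * of_real y powr (s - 1) + z * (of_real (exp (- y) - 1) * of_real y powr (s - 1))) / (1 - z)\<^sup>2)
       has_integral Gamma s * polylog_cont z s) {0<..}" .
  have eq: "(z\<^sup>2 * of_real ((1 - exp (- y))\<^sup>2) / (1 - z * exp (- of_real y)) * of_real y powr (s - 1) + z * (of_real (exp (- y) - 1) * of_real y powr (s - 1))) / (1 - z)\<^sup>2
      = (z * exp (- of_real y) / (1 - z * exp (- of_real y)) - z / (1 - z)) * of_real y powr (s - 1)" if "y \<in> {0<..}" for y :: real
  proof -
    define E where "E = complex_of_real (exp (- y))"
    define P where "P = complex_of_real y powr (s - 1)"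
    have E: "exp (- complex_of_real y) = E" by (simp add: E_def exp_of_real flip: of_real_minus)
    have nz: "1 - z * E \<noteq> 0" using zE[of y] that by (auto simp: E)
    have z1: "1 - z \<noteq> 0" using z by simp
    have 1: "(z\<^sup>2 * (1 - E)\<^sup>2 / (1 - z * E) + z * (E - 1)) / (1 - z)\<^sup>2 = z * E / (1 - z * E) - z / (1 - z)"
    proof -
      have "(z\<^sup>2 * (1 - E)\<^sup>2 / (1 - z * E) + z * (E - 1)) * ((1 - z * E) * (1 - z)) = (z * E / (1 - z * E) - z / (1 - z)) * (1 - z)\<^sup>2 * ((1 - z * E) * (1 - z))"
      proof -
        have "(z\<^sup>2 * (1 - E)\<^sup>2 / (1 - z * E) + z * (E - 1)) * ((1 - z * E) * (1 - z)) = (z\<^sup>2 * (1 - E)\<^sup>2 + z * (E - 1) * (1 - z * E)) * (1 - z)"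
          using nz by (simp add: field_simps)
        also have "\<dots> = (z * E * (1 - z) - z * (1 - z * E)) * (1 - z)\<^sup>2"
          by (simp add: power2_eq_square algebra_simps)
        also have "z * E * (1 - z) - z * (1 - z * E) = (z * E / (1 - z * E) - z / (1 - z)) * ((1 - z * E) * (1 - z))"
        proof -
          have "A * q - B * p = (A / p - B / q) * (p * q)" if "p \<noteq> 0" "q \<noteq> 0" for A B p q :: complex
            using that by (simp add: field_simps)
          from this[OF nz z1] show ?thesis .
        qed
        finally show ?thesis by (simp only: mult_ac)
      qed
      then have "z\<^sup>2 * (1 - E)\<^sup>2 / (1 - z * E) + z * (E - 1) = (z * E / (1 - z * E) - z / (1 - z)) * (1 - z)\<^sup>2"
        using nz z1 by (simp only: mult_cancel_right mult_eq_0_iff) auto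
      then show ?thesis using z1 by simp
    qed
    have "(z\<^sup>2 * of_real ((1 - exp (- y))\<^sup>2) / (1 - z * E) * P + z * (of_real (exp (- y) - 1) * P)) / (1 - z)\<^sup>2
       = (z\<^sup>2 * (1 - E)\<^sup>2 / (1 - z * E) + z * (E - 1)) / (1 - z)\<^sup>2 * P"
    proof -
      have "of_real ((1 - exp (- y))\<^sup>2) = (1 - E)\<^sup>2" "of_real (exp (- y) - 1) = E - 1" by (simp_all add: E_def)
      then show ?thesis by (simp only: distrib_right mult.assoc times_divide_eq_left)
    qed
    then show ?thesis unfolding E P_def[symmetric] 1 .
  qed
  show ?thesis by (rule has_integral_eq[OF eq I])
qed

text \<open>
  Logarithmic differentiation of the reflection formula gives \<open>\<psi>(1 - u) - \<psi>(u) = pi cot(pi u)\<close>; the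
  series of the digamma function do the rest.
\<close>

lemma cot_partial_fractions:
  fixes u :: complex
  assumes "u \<notin> \<int>"
  shows "(\<lambda>k. 1 / (u + of_nat k) - 1 / (1 - u + of_nat k)) sums (of_real pi * cos (of_real pi * u) / sin (of_real pi * u))"
proof -
  have u1: "1 - u \<notin> \<int>"
  proof
    assume "1 - u \<in> \<int>"
    then have "1 - (1 - u) \<in> \<int>" by (rule Ints_diff[OF Ints_1])
    with assms show False by simp
  qed
  have nn: "u \<notin> \<int>\<^sub>\<le>\<^sub>0" "1 - u \<notin> \<int>\<^sub>\<le>\<^sub>0" using assms u1 nonpos_Ints_Int by blast+
  have nz: "u \<noteq> 0" "1 - u \<noteq> 0" using assms u1 by auto
  have sin0: "sin (of_real pi * u) \<noteq> 0"
  proof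
    assume "sin (of_real pi * u) = 0"
    then obtain n :: int where "of_real pi * u = of_real (of_int n * pi)" unfolding sin_eq_0 by blast
    then have "u = of_int n" by simp
    then show False using assms by simp
  qed
  have "((\<lambda>z. Gamma z * Gamma (1 - z)) has_field_derivative Gamma u * Digamma u * Gamma (1 - u) - Gamma u * (Gamma (1 - u) * Digamma (1 - u))) (at u)"
    using nn by (auto intro!: derivative_eq_intros)
  moreover have "((\<lambda>z. Gamma z * Gamma (1 - z)) has_field_derivative - of_real pi * (of_real pi * cos (of_real pi * u)) / (sin (of_real pi * u))\<^sup>2) (at u)"
    unfolding Gamma_reflection_complex using sin0 by (auto intro!: derivative_eq_intros simp: power2_eq_square)
  ultimately have "Gamma u * Digamma u * Gamma (1 - u) - Gamma u * (Gamma (1 - u) * Digamma (1 - u)) = - of_real pi * (of_real pi * cos (of_real pi * u)) / (sin (of_real pi * u))\<^sup>2"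
    by (rule DERIV_unique)
  then have *: "(Gamma u * Gamma (1 - u)) * (Digamma (1 - u) - Digamma u) = of_real pi * (of_real pi * cos (of_real pi * u)) / (sin (of_real pi * u))\<^sup>2"
    by (simp add: algebra_simps)
  have D: "Digamma (1 - u) - Digamma u = of_real pi * cos (of_real pi * u) / sin (of_real pi * u)"
  proof -
    define S where "S = sin (of_real pi * u)"
    from * have "(of_real pi / S) * (Digamma (1 - u) - Digamma u) = (of_real pi / S) * (of_real pi * cos (of_real pi * u) / S)"
      unfolding Gamma_reflection_complex S_def[symmetric] by (simp add: power2_eq_square)
    moreover have "of_real pi / S \<noteq> 0" using sin0 by (simp add: S_def)
    ultimately show ?thesis unfolding S_def[symmetric] by (simp only: mult_cancel_left) auto
  qed
  have "(\<lambda>k. (inverse (of_nat (Suc k)) - inverse (1 - u + of_nat k)) - (inverse (of_nat (Suc k)) - inverse (u + of_nat k)))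
      sums ((Digamma (1 - u) + euler_mascheroni) - (Digamma u + euler_mascheroni))"
    unfolding Digamma_def using summable_sums[OF summable_Digamma[OF nz(1)]] summable_sums[OF summable_Digamma[OF nz(2)]]
    by (intro sums_diff) simp_all
  then show ?thesis using D by (simp add: inverse_eq_divide)
qed

lemma exp_quotient_eq_cot:
  fixes x :: complex
  assumes "exp (2 * \<i> * x) \<noteq> 1"
  shows "exp (2 * \<i> * x) / (1 - exp (2 * \<i> * x)) = - 1 / 2 + \<i> / 2 * (cos x / sin x)"
proof -
  define X where "X = exp (\<i> * x)"
  have X: "X \<noteq> 0" "exp (- (\<i> * x)) = 1 / X" by (simp_all add: X_def exp_minus inverse_eq_divide)
  have e: "exp (2 * \<i> * x) = X\<^sup>2" by (simp add: X_def power2_eq_square mult.assoc flip: exp_add)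
  have X1: "X\<^sup>2 \<noteq> 1" using assms e by simp
  have s: "sin x = (X\<^sup>2 - 1) / (2 * \<i> * X)"
    using X by (simp add: sin_exp_eq X_def[symmetric] field_simps power2_eq_square)
  have c: "cos x = (X\<^sup>2 + 1) / (2 * X)"
    using X by (simp add: cos_exp_eq X_def[symmetric] field_simps power2_eq_square)
  have "X\<^sup>2 - 1 \<noteq> 0" "1 - X\<^sup>2 \<noteq> 0" using X1 by auto
  have "cos x / sin x = \<i> * (X\<^sup>2 + 1) / (X\<^sup>2 - 1)"
  proof -
    have "(P / (2 * X)) / (Q / (2 * \<i> * X)) = \<i> * P / Q" if "Q \<noteq> 0" for P Q
      using that X by (simp add: divide_simps)
    from this[OF \<open>X\<^sup>2 - 1 \<noteq> 0\<close>] show ?thesis unfolding s c .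
  qed
  then have cs: "\<i> / 2 * (cos x / sin x) = - (X\<^sup>2 + 1) / (2 * (X\<^sup>2 - 1))" by simp
  show ?thesis unfolding e cs using \<open>X\<^sup>2 - 1 \<noteq> 0\<close> \<open>1 - X\<^sup>2 \<noteq> 0\<close>
    by (simp add: field_simps)
qed

text \<open>
  The two quotients are the same affine function of \<open>cot(pi u)\<close>, at \<open>u = \<alpha> + i y / (2 pi)\<close> and at
  \<open>u = \<alpha>\<close>. In the difference of the two partial fraction expansions each term is of order \<open>k^(-3)\<close>, so that the two progressions can be
  summed separately.
\<close>

lemma twisted_geometric_partial_fractions:
  fixes \<alpha> y :: real
  assumes \<alpha>: "0 < \<alpha>" "\<alpha> < 1" and y: "y > 0"
  defines "z \<equiv> cis (2 * pi * \<alpha>)"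
    and "a \<equiv> \<lambda>k. 2 * pi * (real k + \<alpha>)" and "b \<equiv> \<lambda>k. 2 * pi * (real k + 1 - \<alpha>)"
  shows "(\<lambda>k. y\<^sup>2 / (b k * (y\<^sup>2 + (b k)\<^sup>2)) - y\<^sup>2 / (a k * (y\<^sup>2 + (a k)\<^sup>2)))
     sums Im (z * exp (- of_real y) / (1 - z * exp (- of_real y)) - z / (1 - z))"
proof -
  define \<eta> where "\<eta> = y / (2 * pi)"
  have \<eta>: "\<eta> > 0" and y_eq: "y = 2 * pi * \<eta>" using y by (simp_all add: \<eta>_def)
  define c where "c t = of_real pi * cos (of_real pi * Complex \<alpha> t) / sin (of_real pi * Complex \<alpha> t)" for t
  have nI: "Complex \<alpha> t \<notin> \<int>" for t
  proof
    assume "Complex \<alpha> t \<in> \<int>"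
    then obtain n :: int where "Complex \<alpha> t = of_int n" by (elim Ints_cases)
    then have "\<alpha> = of_int n" by (simp add: complex_eq_iff)
    then show False using \<alpha> by auto
  qed
  have e_eq: "exp (2 * \<i> * (of_real pi * Complex \<alpha> t)) = z * exp (- of_real (2 * pi * t))" for t
  proof -
    have "2 * \<i> * (of_real pi * Complex \<alpha> t) = \<i> * of_real (2 * pi * \<alpha>) + (- of_real (2 * pi * t))"
      by (simp add: complex_eq_iff)
    then show ?thesis unfolding z_def cis_conv_exp by (simp only: exp_add)
  qed
  have e1: "exp (2 * \<i> * (of_real pi * Complex \<alpha> t)) \<noteq> 1" for t
  proof
    assume "exp (2 * \<i> * (of_real pi * Complex \<alpha> t)) = 1"
    then obtain n :: int where "Im (2 * \<i> * (of_real pi * Complex \<alpha> t)) = of_int (2 * n) * pi"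
      unfolding exp_eq_1 by blast
    then have "\<alpha> = of_int n" by simp
    then show False using \<alpha> by auto
  qed
  have Im_e: "Im (z * exp (- of_real (2 * pi * t)) / (1 - z * exp (- of_real (2 * pi * t)))) = Re (c t) / (2 * pi)" for t
  proof -
    have "Im (- 1 / 2 + \<i> / 2 * w) = Re w / 2" for w by simp
    then have "Im (z * exp (- of_real (2 * pi * t)) / (1 - z * exp (- of_real (2 * pi * t)))) = Re (cos (of_real pi * Complex \<alpha> t) / sin (of_real pi * Complex \<alpha> t)) / 2"
      using exp_quotient_eq_cot[OF e1[of t]] by (simp only: e_eq)
    moreover have "Re (c t) = pi * Re (cos (of_real pi * Complex \<alpha> t) / sin (of_real pi * Complex \<alpha> t))"
      unfolding c_def times_divide_eq_right[symmetric] by (simp only: Re_complex_of_real Im_complex_of_real times_complex.sel mult_zero_left diff_zero)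
    ultimately show ?thesis by simp
  qed
  define T where "T t k = (real k + \<alpha>) / ((real k + \<alpha>)\<^sup>2 + t\<^sup>2) - (real k + 1 - \<alpha>) / ((real k + 1 - \<alpha>)\<^sup>2 + t\<^sup>2)" for t k
  have S: "T t sums Re (c t)" for t
  proof -
    have "(\<lambda>k. Re (1 / (Complex \<alpha> t + of_nat k) - 1 / (1 - Complex \<alpha> t + of_nat k))) sums Re (c t)"
      unfolding c_def by (intro sums_Re cot_partial_fractions nI)
    moreover have "Re (1 / (Complex \<alpha> t + of_nat k) - 1 / (1 - Complex \<alpha> t + of_nat k)) = T t k" for k
      by (simp add: T_def Re_divide algebra_simps)
    ultimately show ?thesis by simp
  qed
  have "(\<lambda>k. (T \<eta> k - T 0 k) / (2 * pi)) sums ((Re (c \<eta>) - Re (c 0)) / (2 * pi))"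
    by (intro sums_divide sums_diff S)
  also have "(Re (c \<eta>) - Re (c 0)) / (2 * pi) = Im (z * exp (- of_real y) / (1 - z * exp (- of_real y)) - z / (1 - z))"
    using Im_e[of \<eta>] Im_e[of 0] by (simp add: y_eq diff_divide_distrib)
  also have "(\<lambda>k. (T \<eta> k - T 0 k) / (2 * pi)) = (\<lambda>k. y\<^sup>2 / (b k * (y\<^sup>2 + (b k)\<^sup>2)) - y\<^sup>2 / (a k * (y\<^sup>2 + (a k)\<^sup>2)))"
  proof
    fix k
    have *: "(A / (A\<^sup>2 + \<eta>\<^sup>2) - A / (A\<^sup>2 + 0\<^sup>2)) / (2 * pi) = - (y\<^sup>2 / ((2 * pi * A) * (y\<^sup>2 + (2 * pi * A)\<^sup>2)))" if "A > 0" for A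
    proof -
      have p: "A\<^sup>2 + \<eta>\<^sup>2 > 0" using that by (intro add_pos_nonneg) auto
      have "A / (A\<^sup>2 + \<eta>\<^sup>2) - A / (A\<^sup>2 + 0\<^sup>2) = - (\<eta>\<^sup>2 / (A * (A\<^sup>2 + \<eta>\<^sup>2)))"
        using that p by (simp add: divide_simps power2_eq_square)
      moreover have "y\<^sup>2 / ((2 * pi * A) * (y\<^sup>2 + (2 * pi * A)\<^sup>2)) = \<eta>\<^sup>2 / (A * (A\<^sup>2 + \<eta>\<^sup>2)) / (2 * pi)"
      proof -
        have "y\<^sup>2 + (2 * pi * A)\<^sup>2 = (2 * pi)\<^sup>2 * (A\<^sup>2 + \<eta>\<^sup>2)" "y\<^sup>2 = (2 * pi)\<^sup>2 * \<eta>\<^sup>2"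
          by (simp_all add: y_eq power_mult_distrib algebra_simps)
        then show ?thesis by simp
      qed
      ultimately show ?thesis by simp
    qed
    have "(T \<eta> k - T 0 k) / (2 * pi) = ((real k + \<alpha>) / ((real k + \<alpha>)\<^sup>2 + \<eta>\<^sup>2) - (real k + \<alpha>) / ((real k + \<alpha>)\<^sup>2 + 0\<^sup>2)) / (2 * pi)
       - ((real k + 1 - \<alpha>) / ((real k + 1 - \<alpha>)\<^sup>2 + \<eta>\<^sup>2) - (real k + 1 - \<alpha>) / ((real k + 1 - \<alpha>)\<^sup>2 + 0\<^sup>2)) / (2 * pi)"
      unfolding T_def by (simp add: diff_divide_distrib)
    also have "\<dots> = y\<^sup>2 / (b k * (y\<^sup>2 + (b k)\<^sup>2)) - y\<^sup>2 / (a k * (y\<^sup>2 + (a k)\<^sup>2))"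
      using *[of "real k + \<alpha>"] *[of "real k + 1 - \<alpha>"] \<alpha> by (simp add: a_def b_def)
    finally show "(T \<eta> k - T 0 k) / (2 * pi) = y\<^sup>2 / (b k * (y\<^sup>2 + (b k)\<^sup>2)) - y\<^sup>2 / (a k * (y\<^sup>2 + (a k)\<^sup>2))" .
  qed
  finally show ?thesis .
qed

text \<open>
  The polylogarithm has no continuation of the above form at \<open>z = 1\<close>, but for integral \<open>\<alpha>\<close> all sines vanish.
\<close>

definition sine_L :: "real \<Rightarrow> complex \<Rightarrow> complex" where
  "sine_L \<alpha> s = (if \<alpha> \<in> \<int> then 0
     else (polylog_cont (cis (2 * pi * \<alpha>)) s - polylog_cont (cis (- (2 * pi * \<alpha>))) s) / (2 * \<i>))"

lemma sine_L_nonint: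
  assumes "\<alpha> \<notin> \<int>"
  shows "sine_L \<alpha> = (\<lambda>s. (polylog_cont (cis (2 * pi * \<alpha>)) s - polylog_cont (cis (- (2 * pi * \<alpha>))) s) / (2 * \<i>))"
  using assms by (simp add: sine_L_def fun_eq_iff)

lemma summable_shifted_powr:
  fixes c \<alpha> \<sigma> :: real
  assumes "c > 0" "\<alpha> > 0" "\<sigma> < -1"
  shows "summable (\<lambda>k. (c * (real k + \<alpha>)) powr \<sigma>)"
proof (rule summable_comparison_test_ev)
  show "summable (\<lambda>k. c powr \<sigma> * real k powr \<sigma>)"
    using assms by (intro summable_mult) (simp add: summable_real_powr_iff)
  show "\<forall>\<^sub>F k in sequentially. norm ((c * (real k + \<alpha>)) powr \<sigma>) \<le> c powr \<sigma> * real k powr \<sigma>"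
    using eventually_gt_at_top[of 0]
  proof eventually_elim
    case (elim k)
    have "(real k + \<alpha>) powr \<sigma> \<le> real k powr \<sigma>" using elim assms by (intro powr_mono2') auto
    then show ?case using assms by (simp add: powr_mult mult_left_mono)
  qed
qed

text \<open>
  Termwise integration; the modulus of a term is the same integrand with \<open>s\<close> replaced by \<open>Re s\<close>.
\<close>

lemma mellin_rational_series:
  fixes s :: complex and \<alpha> :: real
  assumes s: "-2 < Re s" "Re s < 0" and \<alpha>: "\<alpha> > 0"
  defines "a \<equiv> \<lambda>k. 2 * pi * (real k + \<alpha>)"
  shows "((\<lambda>y. \<Sum>k. of_real (y\<^sup>2 / (a k * (y\<^sup>2 + (a k)\<^sup>2))) * of_real y powr (s - 1)) has_integral
     (\<Sum>k. of_real (a k) powr (s - 1)) * (Gamma (1 + s / 2) * Gamma (- (s / 2)) / 2)) {0<..}"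
    and "summable (\<lambda>k. norm (of_real (a k) powr (s - 1)))"
    and "\<And>y. y > 0 \<Longrightarrow> summable (\<lambda>k. y\<^sup>2 / (a k * (y\<^sup>2 + (a k)\<^sup>2)))"
proof -
  define c where "c s = Gamma (1 + s / 2) * Gamma (- (s / 2)) / 2" for s :: complex
  have a: "a k > 0" for k using \<alpha> by (simp add: a_def add_nonneg_pos)
  have na: "norm (complex_of_real (a k) powr w) = a k powr Re w" for k w
    using a[of k] by (simp add: norm_powr_real_powr)
  have suma: "summable (\<lambda>k. a k powr \<sigma>)" if "\<sigma> < -1" for \<sigma>
    unfolding a_def using that \<alpha> by (intro summable_shifted_powr) auto
  show sa: "summable (\<lambda>k. norm (of_real (a k) powr (s - 1)))"
    unfolding na using s by (intro suma) auto
  show sy: "summable (\<lambda>k. y\<^sup>2 / (a k * (y\<^sup>2 + (a k)\<^sup>2)))" if "y > 0" for y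
  proof (rule summable_comparison_test)
    show "summable (\<lambda>k. y\<^sup>2 * a k powr (-3))" by (intro summable_mult suma) auto
    have "y\<^sup>2 / (a k * (y\<^sup>2 + (a k)\<^sup>2)) \<le> y\<^sup>2 * a k powr (-3)" for k
    proof -
      have "y\<^sup>2 / (a k * (y\<^sup>2 + (a k)\<^sup>2)) \<le> y\<^sup>2 / (a k * (a k)\<^sup>2)"
        using a[of k] by (intro divide_left_mono mult_left_mono mult_pos_pos) (auto simp: add_nonneg_pos)
      also have "\<dots> = y\<^sup>2 * a k powr (-3)"
        using a[of k] by (simp add: powr_minus divide_inverse power2_eq_square power3_eq_cube powr_realpow[of "a k" 3, simplified])
      finally show ?thesis .
    qed
    moreover have "0 \<le> y\<^sup>2 / (a k * (y\<^sup>2 + (a k)\<^sup>2))" for k using a[of k] by auto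
    ultimately show "\<exists>N. \<forall>k\<ge>N. norm (y\<^sup>2 / (a k * (y\<^sup>2 + (a k)\<^sup>2))) \<le> y\<^sup>2 * a k powr (-3)"
      by (intro exI allI impI) (simp only: real_norm_def abs_of_nonneg)
  qed
  define f where "f k y = of_real (y\<^sup>2 / (a k * (y\<^sup>2 + (a k)\<^sup>2))) * of_real y powr (s - 1)" for k and y :: real
  define J where "J k = a k powr (Re s - 1) * Re (c (of_real (Re s)))" for k
  have fi: "(f k has_integral of_real (a k) powr (s - 1) * c s) {0<..}" for k
    unfolding f_def c_def by (rule mellin_rational[OF s a])
  have nf: "norm (f k y) = y\<^sup>2 / (a k * (y\<^sup>2 + (a k)\<^sup>2)) * y powr (Re s - 1)" if "y > 0" for k y
    using that a[of k] by (simp add: f_def norm_mult norm_powr_real_powr abs_mult del: of_real_divide of_real_mult of_real_power of_real_add)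
  have rp: "complex_of_real y powr (of_real (Re s) - 1) = of_real (y powr (Re s - 1))" if "y > 0" for y
    using that powr_of_real[of y "Re s - 1"] by simp
  have fJ: "((\<lambda>y. norm (f k y)) has_integral J k) {0<..}" for k
  proof -
    have "((\<lambda>y. of_real (y\<^sup>2 / (a k * (y\<^sup>2 + (a k)\<^sup>2))) * of_real y powr (of_real (Re s) - 1)) has_integral
        of_real (a k) powr (of_real (Re s) - 1) * c (of_real (Re s))) {0<..}"
      unfolding c_def using s by (intro mellin_rational a) auto
    then have "((\<lambda>y. Re (of_real (y\<^sup>2 / (a k * (y\<^sup>2 + (a k)\<^sup>2))) * of_real y powr (of_real (Re s) - 1))) has_integral
        Re (of_real (a k) powr (of_real (Re s) - 1) * c (of_real (Re s)))) {0<..}"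
      by (rule has_integral_Re)
    moreover have "Re (of_real (a k) powr (of_real (Re s) - 1) * c (of_real (Re s))) = J k"
      unfolding J_def rp[OF a] by simp
    ultimately have *: "((\<lambda>y. Re (of_real (y\<^sup>2 / (a k * (y\<^sup>2 + (a k)\<^sup>2))) * of_real y powr (of_real (Re s) - 1))) has_integral J k) {0<..}"
      by simp
    have "norm (f k y) = Re (of_real (y\<^sup>2 / (a k * (y\<^sup>2 + (a k)\<^sup>2))) * of_real y powr (of_real (Re s) - 1))" if "y > 0" for y
      unfolding nf[OF that] rp[OF that] of_real_mult[symmetric] by (rule Re_complex_of_real[symmetric])
    then show ?thesis by (intro has_integral_eq[OF _ *]) simp
  qed
  have sJ: "summable J" unfolding J_def using s by (intro summable_mult2 suma) auto
  have fs: "summable (\<lambda>k. norm (f k y))" if "y \<in> {0<..}" for y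
  proof -
    have "y > 0" using that by simp
    then show ?thesis unfolding nf[OF \<open>y > 0\<close>] by (intro summable_mult2 sy)
  qed
  have "((\<lambda>y. \<Sum>k. f k y) has_integral (\<Sum>k. of_real (a k) powr (s - 1) * c s)) {0<..}"
    by (rule has_integral_suminf(1)[OF fi fJ sJ fs])
  also have "(\<Sum>k. of_real (a k) powr (s - 1) * c s) = (\<Sum>k. of_real (a k) powr (s - 1)) * c s"
    using summable_norm_cancel[OF sa] by (rule suminf_mult2[symmetric])
  finally show "((\<lambda>y. \<Sum>k. of_real (y\<^sup>2 / (a k * (y\<^sup>2 + (a k)\<^sup>2))) * of_real y powr (s - 1)) has_integral
     (\<Sum>k. of_real (a k) powr (s - 1)) * (Gamma (1 + s / 2) * Gamma (- (s / 2)) / 2)) {0<..}"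
    by (simp add: f_def[abs_def] c_def)
qed

lemma cis_frac: "cis (2 * pi * frac \<alpha>) = cis (2 * pi * \<alpha>)"
proof -
  have "2 * pi * \<alpha> = 2 * pi * frac \<alpha> + 2 * pi * of_int \<lfloor>\<alpha>\<rfloor>" by (simp add: frac_def algebra_simps)
  then show ?thesis by (simp add: cis_mult[symmetric] cis_multiple_2pi)
qed

lemma cis_neq_1_of_nonint:
  assumes "\<alpha> \<notin> \<int>"
  shows "cis (2 * pi * \<alpha>) \<noteq> 1" "cis (- (2 * pi * \<alpha>)) \<noteq> 1"
proof -
  show 1: "cis (2 * pi * \<alpha>) \<noteq> 1"
  proof
    assume "cis (2 * pi * \<alpha>) = 1"
    then have "exp (\<i> * of_real (2 * pi * \<alpha>)) = 1" by (simp only: cis_conv_exp)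
    then obtain n :: int where "Im (\<i> * of_real (2 * pi * \<alpha>)) = of_int (2 * n) * pi" unfolding exp_eq_1 by blast
    then have "\<alpha> = of_int n" by simp
    then show False using assms by simp
  qed
  show "cis (- (2 * pi * \<alpha>)) \<noteq> 1"
  proof
    assume "cis (- (2 * pi * \<alpha>)) = 1"
    then have "cnj (cis (2 * pi * \<alpha>)) = 1" by (simp add: cis_cnj)
    then show False using 1 by (metis complex_cnj_cnj complex_cnj_one)
  qed
qed

text \<open>
  Let \<open>\<phi>(y)\<close> be the imaginary part of \<open>z e^(-y) / (1 - z e^(-y)) - z / (1 - z)\<close>, where
  \<open>z = e^(2 pi i \<alpha>)\<close>. Its Mellin transform is \<open>\<Gamma>(s) L(\<alpha>, s)\<close> by the integral for the polylogarithm. The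
  partial fractions of \<open>\<phi>\<close>, transformed term by term, give the dual series. Dividing by \<open>\<Gamma>(s)\<close> gives
  the gamma factor, in which \<open>\<alpha>\<close> does not occur.
\<close>

theorem sine_L_functional_equation:
  fixes s :: complex and \<alpha> :: real
  assumes s: "-1 < Re s" "Re s < 0" and "\<alpha> \<notin> \<int>"
  shows "sine_L \<alpha> s = sine_gamma_factor s *
    ((\<Sum>k. of_real (2 * pi * (real k + frac \<alpha>)) powr (s - 1)) - (\<Sum>k. of_real (2 * pi * (real k + (1 - frac \<alpha>))) powr (s - 1)))"
proof -
  define z where "z = cis (2 * pi * \<alpha>)"
  have zc: "cis (- (2 * pi * \<alpha>)) = cnj z" by (simp add: z_def cis_cnj)
  have zf: "z = cis (2 * pi * frac \<alpha>)" by (simp add: z_def cis_frac)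
  have \<alpha>: "0 < frac \<alpha>" "frac \<alpha> < 1" using \<open>\<alpha> \<notin> \<int>\<close> frac_lt_1[of \<alpha>] by (auto simp: frac_gt_0_iff)
  have z: "norm z = 1" "z \<noteq> 1" using cis_neq_1_of_nonint[OF \<open>\<alpha> \<notin> \<int>\<close>] by (auto simp: z_def)
  define \<phi> where "\<phi> z y = z * exp (- of_real y) / (1 - z * exp (- of_real y)) - z / (1 - z)" for z :: complex and y :: real
  have \<phi>c: "\<phi> (cnj z) y = cnj (\<phi> z y)" for y
  proof -
    have "cnj (exp (- complex_of_real y)) = exp (- complex_of_real y)"
      by (simp only: exp_of_real of_real_minus[symmetric] complex_cnj_complex_of_real)
    then show ?thesis by (simp add: \<phi>_def)
  qed
  define a b where "a k = 2 * pi * (real k + frac \<alpha>)" and "b k = 2 * pi * (real k + (1 - frac \<alpha>))" for k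
  define A B where "A y = (\<Sum>k. of_real (y\<^sup>2 / (a k * (y\<^sup>2 + (a k)\<^sup>2))) * of_real y powr (s - 1))"
    and "B y = (\<Sum>k. of_real (y\<^sup>2 / (b k * (y\<^sup>2 + (b k)\<^sup>2))) * of_real y powr (s - 1))" for y :: real
  define c where "c = Gamma (1 + s / 2) * Gamma (- (s / 2)) / 2"
  have s2: "-2 < Re s" using s by simp
  have \<alpha>': "1 - frac \<alpha> > 0" using \<alpha> by simp
  note MA = mellin_rational_series[OF s2 s(2) \<alpha>(1)] and MB = mellin_rational_series[OF s2 s(2) \<alpha>']
  have 1: "((\<lambda>y. (\<phi> z y * of_real y powr (s - 1) - \<phi> (cnj z) y * of_real y powr (s - 1)) / (2 * \<i>)) has_integral
      (Gamma s * polylog_cont z s - Gamma s * polylog_cont (cnj z) s) / (2 * \<i>)) {0<..}"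
    unfolding \<phi>_def using z by (intro has_integral_divide has_integral_diff polylog_cont_integral s) (auto simp: complex_eq_iff)
  have 2: "((\<lambda>y. B y - A y) has_integral (\<Sum>k. of_real (b k) powr (s - 1)) * c - (\<Sum>k. of_real (a k) powr (s - 1)) * c) {0<..}"
    unfolding A_def B_def a_def b_def c_def by (intro has_integral_diff MA(1) MB(1))
  have eq: "(\<phi> z y * of_real y powr (s - 1) - \<phi> (cnj z) y * of_real y powr (s - 1)) / (2 * \<i>) = B y - A y"
    if "y \<in> {0<..}" for y
  proof -
    have y: "y > 0" using that by simp
    define P where "P = complex_of_real y powr (s - 1)"
    define Ay By where "Ay k = y\<^sup>2 / (a k * (y\<^sup>2 + (a k)\<^sup>2))" and "By k = y\<^sup>2 / (b k * (y\<^sup>2 + (b k)\<^sup>2))" for k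
    have sA: "summable Ay" and sB: "summable By"
      using MA(3)[OF y] MB(3)[OF y] by (simp_all add: Ay_def[abs_def] By_def[abs_def] a_def b_def)
    have "(\<lambda>k. By k - Ay k) sums Im (\<phi> z y)"
      using twisted_geometric_partial_fractions[OF \<alpha> y] by (simp add: \<phi>_def zf By_def Ay_def a_def b_def add_diff_eq)
    then have Im: "Im (\<phi> z y) = suminf By - suminf Ay"
      using sums_unique2[OF _ sums_diff[OF summable_sums[OF sB] summable_sums[OF sA]]] by blast
    have "A y = of_real (suminf Ay) * P" "B y = of_real (suminf By) * P"
      unfolding A_def B_def P_def Ay_def[symmetric] By_def[symmetric]
      using suminf_mult2[OF summable_of_real[OF sA, where 'a = complex], of "of_real y powr (s - 1)"] suminf_of_real[OF sA, where 'a = complex]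
        suminf_mult2[OF summable_of_real[OF sB, where 'a = complex], of "of_real y powr (s - 1)"] suminf_of_real[OF sB, where 'a = complex]
      by simp_all
    then have "B y - A y = of_real (Im (\<phi> z y)) * P" by (simp add: Im left_diff_distrib)
    moreover have "\<phi> z y - \<phi> (cnj z) y = 2 * \<i> * of_real (Im (\<phi> z y))"
      unfolding \<phi>c by (simp add: complex_eq_iff)
    ultimately show ?thesis
      by (simp add: P_def[symmetric] left_diff_distrib[symmetric])
  qed
  have "((\<lambda>y. B y - A y) has_integral (Gamma s * polylog_cont z s - Gamma s * polylog_cont (cnj z) s) / (2 * \<i>)) {0<..}"
    by (rule has_integral_eq[OF eq 1])
  from has_integral_unique[OF this 2]
  have "Gamma s * sine_L \<alpha> s = (\<Sum>k. of_real (b k) powr (s - 1)) * c - (\<Sum>k. of_real (a k) powr (s - 1)) * c"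
    using \<open>\<alpha> \<notin> \<int>\<close> by (simp add: sine_L_def zc z_def[symmetric] right_diff_distrib mult.left_commute)
  moreover have "rGamma s * Gamma s = 1"
  proof -
    have "s \<notin> \<int>\<^sub>\<le>\<^sub>0"
    proof
      assume "s \<in> \<int>\<^sub>\<le>\<^sub>0"
      then obtain n where "s = - of_nat n" by (auto elim: nonpos_Ints_cases')
      then show False using s by (cases n) auto
    qed
    then have "Gamma s \<noteq> 0" by (simp add: Gamma_eq_zero_iff)
    then show ?thesis by (simp add: rGamma_inverse_Gamma)
  qed
  ultimately have "sine_L \<alpha> s = rGamma s * ((\<Sum>k. of_real (b k) powr (s - 1)) * c - (\<Sum>k. of_real (a k) powr (s - 1)) * c)"
    by (metis mult.assoc mult_1)
  then show ?thesis
    by (simp add: sine_gamma_factor_def c_def a_def b_def algebra_simps)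
qed

section \<open>Oscillation of the gamma factor\<close>

text \<open>
  The frequency \<open>\<beta>\<close> does not enter the second derivative of the phase, which is at most \<open>-k/t\<close> on \<open>[1, t]\<close>.
\<close>

lemma oscillating_integral_bound:
  fixes \<beta> :: real and k :: nat
  assumes "k \<ge> 1" "t \<ge> 1"
  shows "norm (integral {1..t} (\<lambda>u. cis (\<beta> * u - real k * (u * ln u - u)))) \<le> 8 * sqrt t"
proof -
  have "norm (integral {1..t} (\<lambda>u. cis (\<beta> * u - real k * (u * ln u - u)))) \<le> 8 / sqrt (real k / t)"
  proof (rule second_derivative_test)
    show "((\<lambda>u. \<beta> * u - real k * (u * ln u - u)) has_real_derivative (\<beta> - real k * ln u)) (at u)" if "u \<in> {1..t}" for u
      using that by (auto intro!: derivative_eq_intros)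
    show "((\<lambda>u. \<beta> - real k * ln u) has_real_derivative (- (real k / u))) (at u)" if "u \<in> {1..t}" for u
      using that by (auto intro!: derivative_eq_intros)
    show "- (real k / u) \<le> - (real k / t)" if "u \<in> {1..t}" for u
      using that by (simp add: frac_le)
    show "continuous_on {1..t} (\<lambda>u. - (real k / u))" by (intro continuous_intros) auto
  qed (use assms in auto)
  also have "8 / sqrt (real k / t) = 8 * sqrt t / sqrt (real k)" by (simp add: real_sqrt_divide)
  also have "\<dots> \<le> 8 * sqrt t / 1" using assms by (intro divide_left_mono) auto
  finally show ?thesis by simp
qed

text \<open>
  Integration by parts against the primitive \<open>E(t) = O(t^(1/2))\<close> of the oscillation. The decay of \<open>A'\<close> is such
  that \<open>A' E\<close> is \<open>O(t^(-1 - \<delta>))\<close> and just integrable.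
\<close>

lemma oscillating_integral_amplitude_bound:
  fixes A A' :: "real \<Rightarrow> complex" and k :: nat
  assumes k: "k \<ge> 1" and R: "R \<ge> 1" and \<delta>: "\<delta> > 0"
    and A: "\<And>t. t \<in> {1..R} \<Longrightarrow> (A has_vector_derivative A' t) (at t)" and cA': "continuous_on {1..R} A'"
    and bA: "\<And>t. t \<in> {1..R} \<Longrightarrow> norm (A t) \<le> M * t powr (- 1/2 - \<delta>)"
    and bA': "\<And>t. t \<in> {1..R} \<Longrightarrow> norm (A' t) \<le> M * t powr (- 3/2 - \<delta>)"
  shows "norm (integral {1..R} (\<lambda>t. A t * cis (\<beta> * t - real k * (t * ln t - t)))) \<le> 8 * M * (1 + 1 / \<delta>)"
proof -
  have M: "M \<ge> 0" using bA[of 1] R norm_ge_zero[of "A 1"] by (simp del: norm_ge_zero)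
  define e where "e t = cis (\<beta> * t - real k * (t * ln t - t))" for t
  define E where "E t = integral {1..t} e" for t
  have ce: "continuous_on {1..R} e" unfolding e_def by (intro continuous_intros) auto
  have dE: "(E has_vector_derivative e t) (at t within {1..R})" if "t \<in> {1..R}" for t
    unfolding E_def by (rule integral_has_vector_derivative[OF ce that])
  have bE: "norm (E t) \<le> 8 * sqrt t" if "t \<in> {1..R}" for t
    using oscillating_integral_bound[OF k, of t \<beta>] that by (simp add: E_def e_def[abs_def])
  have cE: "continuous_on {1..R} E" by (rule continuous_on_vector_derivative[OF dE])
  have cA: "continuous_on {1..R} A"
    by (rule continuous_on_vector_derivative[OF has_vector_derivative_at_within[OF A]])
  have E1: "E 1 = 0" by (simp add: E_def)
  have "((\<lambda>t. A t * e t + A' t * E t) has_integral (A R * E R - A 1 * E 1)) {1..R}"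
    by (rule fundamental_theorem_of_calculus[OF R])
      (intro has_vector_derivative_mult has_vector_derivative_at_within[OF A] dE; assumption)
  moreover have iA'E: "(\<lambda>t. A' t * E t) integrable_on {1..R}"
    by (intro integrable_continuous_real continuous_intros cA' cE)
  ultimately have "((\<lambda>t. (A t * e t + A' t * E t) - A' t * E t) has_integral (A R * E R - A 1 * E 1) - integral {1..R} (\<lambda>t. A' t * E t)) {1..R}"
    by (intro has_integral_diff integrable_integral)
  then have eq: "integral {1..R} (\<lambda>t. A t * e t) = A R * E R - integral {1..R} (\<lambda>t. A' t * E t)"
    by (simp add: integral_unique E1)
  have hs: "t powr (1/2) = sqrt t" if "t \<ge> 1" for t using that by (simp add: powr_half_sqrt)
  have 1: "norm (A R * E R) \<le> 8 * M"
  proof -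
    have "norm (A R * E R) \<le> (M * R powr (- 1/2 - \<delta>)) * (8 * sqrt R)"
      unfolding norm_mult using R by (intro mult_mono bA bE mult_nonneg_nonneg M) auto
    also have "\<dots> = 8 * M * (R powr (- 1/2 - \<delta>) * R powr (1/2))" using hs[OF R] by simp
    also have "R powr (- 1/2 - \<delta>) * R powr (1/2) = R powr (- \<delta>)" by (simp flip: powr_add)
    also have "\<dots> \<le> 1" using R \<delta> powr_mono[of "- \<delta>" 0 R] by simp
    finally show ?thesis using M by (simp add: mult_left_mono)
  qed
  have 2: "norm (integral {1..R} (\<lambda>t. A' t * E t)) \<le> 8 * M * (1 / \<delta>)"
  proof -
    have I: "((\<lambda>t. 8 * M * t powr (- 1 - \<delta>)) has_integral 8 * M * ((- 1 / \<delta>) * R powr (- \<delta>) - (- 1 / \<delta>) * 1 powr (- \<delta>))) {1..R}"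
    proof (intro has_integral_mult_right fundamental_theorem_of_calculus[OF R])
      fix t assume t: "t \<in> {1..R}"
      have "((\<lambda>t. (- 1 / \<delta>) * t powr (- \<delta>)) has_real_derivative (- 1 / \<delta>) * (- \<delta> * t powr (- \<delta> - 1))) (at t within {1..R})"
        using t by (intro DERIV_cmult has_field_derivative_at_within[OF has_real_derivative_powr]) auto
      also have "(- 1 / \<delta>) * (- \<delta> * t powr (- \<delta> - 1)) = t powr (- 1 - \<delta>)"
      proof -
        have e: "- \<delta> - 1 = - 1 - \<delta>" by simp
        show ?thesis unfolding e using \<delta> by simp
      qed
      finally show "((\<lambda>t. (- 1 / \<delta>) * t powr (- \<delta>)) has_vector_derivative t powr (- 1 - \<delta>)) (at t within {1..R})"
        by (simp add: has_real_derivative_iff_has_vector_derivative)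
    qed
    have "norm (integral {1..R} (\<lambda>t. A' t * E t)) \<le> integral {1..R} (\<lambda>t. 8 * M * t powr (- 1 - \<delta>))"
    proof (rule integral_norm_bound_integral[OF iA'E has_integral_integrable[OF I]])
      fix t assume t: "t \<in> {1..R}"
      have "norm (A' t * E t) \<le> (M * t powr (- 3/2 - \<delta>)) * (8 * sqrt t)"
        unfolding norm_mult using t by (intro mult_mono bA' bE mult_nonneg_nonneg M) auto
      also have "\<dots> = 8 * M * (t powr (- 3/2 - \<delta>) * t powr (1/2))" using hs[of t] t by simp
      also have "t powr (- 3/2 - \<delta>) * t powr (1/2) = t powr (- 1 - \<delta>)" by (simp flip: powr_add)
      finally show "norm (A' t * E t) \<le> 8 * M * t powr (- 1 - \<delta>)" .
    qed
    also have "\<dots> = 8 * M * (1 / \<delta> - R powr (- \<delta>) / \<delta>)" by (subst integral_unique[OF I]) (simp add: algebra_simps)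
    also have "\<dots> \<le> 8 * M * (1 / \<delta>)" using M \<delta> by (intro mult_left_mono) auto
    finally show ?thesis .
  qed
  have "norm (integral {1..R} (\<lambda>t. A t * e t)) \<le> 8 * M + 8 * M * (1 / \<delta>)"
    unfolding eq by (rule order_trans[OF norm_triangle_ineq4 add_mono[OF 1 2]])
  then show ?thesis by (simp add: e_def distrib_left)
qed

lemma riesz_kernel_vector_derivative:
  assumes "h > 0" "c > 0"
  shows "((\<lambda>t. riesz_kernel h r (Complex c t)) has_vector_derivative
      riesz_kernel h r (Complex c t) * (- \<i> * (1 / Complex c t + of_nat r * of_real h / (1 + of_real h * Complex c t)))) (at t)"
proof -
  let ?s = "Complex c t"
  have nz: "?s \<noteq> 0" "1 + of_real h * ?s \<noteq> 0"
    using riesz_kernel_denominator(3,4)[OF assms(1), of ?s] assms by auto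
  have *: "Complex c t = of_real c + \<i> * of_real t" for t by (simp add: complex_eq_iff)
  have s: "((\<lambda>t. Complex c t) has_vector_derivative \<i>) (at t)"
    unfolding * by (auto intro!: derivative_eq_intros)
  have p: "((\<lambda>s. (1 + of_real h * s) ^ r) has_field_derivative of_nat r * of_real h / (1 + of_real h * ?s) * (1 + of_real h * ?s) ^ r) (at ?s)"
  proof (cases r)
    case (Suc r')
    have "((\<lambda>s. 1 + of_real h * s) has_field_derivative of_real h) (at ?s)" by (auto intro!: derivative_eq_intros)
    from DERIV_power[OF this, of r] show ?thesis using nz by (simp add: Suc mult_ac)
  qed simp
  have "(riesz_kernel h r has_field_derivative
     - (1 * (1 + of_real h * ?s) ^ r + of_nat r * of_real h / (1 + of_real h * ?s) * (1 + of_real h * ?s) ^ r * ?s) / (?s * (1 + of_real h * ?s) ^ r * (?s * (1 + of_real h * ?s) ^ r))) (at ?s)"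
    unfolding riesz_kernel_def using DERIV_divide[OF DERIV_const[of 1] DERIV_mult[OF DERIV_ident p]] nz by simp
  also have "- (1 * (1 + of_real h * ?s) ^ r + of_nat r * of_real h / (1 + of_real h * ?s) * (1 + of_real h * ?s) ^ r * ?s) / (?s * (1 + of_real h * ?s) ^ r * (?s * (1 + of_real h * ?s) ^ r))
     = - riesz_kernel h r ?s * (1 / ?s + of_nat r * of_real h / (1 + of_real h * ?s))"
  proof -
    have "- (1 * P + W * P * S) / (S * P * (S * P)) = - (1 / (S * P)) * (1 / S + W)" if "S \<noteq> 0" "P \<noteq> 0" for S P W :: complex
      using that by (simp add: field_simps)
    then show ?thesis unfolding riesz_kernel_def using nz by (metis power_not_zero)
  qed
  finally have "((riesz_kernel h r \<circ> (\<lambda>t. Complex c t)) has_vector_derivative \<i> * (- riesz_kernel h r ?s * (1 / ?s + of_nat r * of_real h / (1 + of_real h * ?s)))) (at t)"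
    by (rule field_vector_diff_chain_at[OF s])
  then show ?thesis by (simp add: o_def mult_ac)
qed

text \<open>
  Interpolation between the lower bounds \<open>1\<close> and \<open>(h t)^r\<close> for \<open>|1 + h s|^r\<close>. Only as much decay is used as
  is needed, since every power of \<open>t\<close> is paid for by a power of \<open>1/h\<close>.
\<close>

lemma norm_riesz_kernel_powr_le:
  assumes "h > 0" "c > 0" "t > 0" "0 \<le> \<theta>" "\<theta> \<le> real r"
  shows "norm (riesz_kernel h r (Complex c t)) \<le> h powr (- \<theta>) * t powr (- 1 - \<theta>)"
proof -
  let ?n = "norm (1 + of_real h * Complex c t)"
  have t: "t \<le> norm (Complex c t)" using abs_Im_le_cmod[of "Complex c t"] assms by simp
  have n1: "1 \<le> ?n" and n2: "h * t \<le> ?n"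
    using riesz_kernel_denominator(1,2)[of h "Complex c t"] assms by auto
  have "(h * t) powr \<theta> \<le> ?n powr \<theta>" using n2 assms by (intro powr_mono2) auto
  also have "\<dots> \<le> ?n powr real r" using n1 assms by (intro powr_mono) auto
  also have "\<dots> = ?n ^ r" using n1 by (intro powr_realpow) linarith
  finally have n: "(h * t) powr \<theta> \<le> ?n ^ r" .
  have "norm (riesz_kernel h r (Complex c t)) = 1 / (norm (Complex c t) * ?n ^ r)"
    by (simp add: riesz_kernel_def norm_divide norm_mult norm_power)
  also have "\<dots> \<le> 1 / (t * (h * t) powr \<theta>)"
    using assms t n by (intro frac_le mult_mono mult_pos_pos) auto
  also have "\<dots> = h powr (- \<theta>) * t powr (- 1 - \<theta>)"
    using assms by (simp add: powr_mult powr_diff powr_minus divide_simps)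
  finally show ?thesis .
qed

text \<open>
  The \<open>k\<close>-th power of the gamma factor has size \<open>t^(k (1/2 + \<delta>))\<close>, and the kernel has size
  \<open>h^(-\<theta>) t^(-1 - \<theta>)\<close>. The exponent \<open>\<theta>\<close> is chosen such that the product is \<open>t^(-1/2 - \<delta>)\<close>, the size
  for which the oscillation makes the integral converge.
\<close>

lemma gamma_factor_fourier_bound:
  fixes \<delta> :: real and k r :: nat
  assumes "k \<ge> 1" and \<delta>: "0 < \<delta>" "\<delta> \<le> 1/2"
  defines "\<theta> \<equiv> (real k - 1) / 2 + (real k + 1) * \<delta>"
  assumes r: "\<theta> \<le> real r"
  obtains C where "C > 0" "\<And>h R \<beta>. h > 0 \<Longrightarrow> R \<ge> 1 \<Longrightarrow>
    norm (integral {1..R} (\<lambda>t. riesz_kernel h r (Complex (1 - \<delta>) t) * sine_gamma_factor (Complex (- \<delta>) t) ^ k * cis (\<beta> * t))) \<le> C * h powr (- \<theta>)"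
proof -
  obtain b \<rho> B where G: "\<And>t. t \<ge> 1 \<Longrightarrow> sine_gamma_factor (Complex (- \<delta>) t) = b t * of_real (t powr (1/2 + \<delta>)) * cis (- (t * ln t - t))"
    and db: "\<And>t. t \<ge> 1 \<Longrightarrow> (b has_vector_derivative \<rho> t * b t) (at t)"
    and \<rho>: "\<And>t. t \<ge> 1 \<Longrightarrow> norm (\<rho> t) \<le> 12 / t\<^sup>2"
    and bB: "\<And>t. t \<ge> 1 \<Longrightarrow> norm (b t) \<le> B" and B: "B > 0" and c\<rho>: "continuous_on {1..} \<rho>"
    using sine_gamma_factor_asymptotic[OF \<delta>] by metis
  define c where "c = real k * (1/2 + \<delta>)"
  have c: "0 \<le> c" "c \<le> real k" using \<delta> mult_left_mono[of "1/2 + \<delta>" 1 "real k"] by (auto simp: c_def)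
  have \<theta>0: "\<theta> \<ge> 0" using assms by (simp add: \<theta>_def)
  \<comment> \<open>N / t bounds the logarithmic derivative of the amplitude: 1 + r from the kernel, k from t powr c, 12 k from b.\<close>
  define N where "N = 1 + real r + 13 * real k"
  have N: "N \<ge> 1" by (simp add: N_def)
  have "norm (integral {1..R} (\<lambda>t. riesz_kernel h r (Complex (1 - \<delta>) t) * sine_gamma_factor (Complex (- \<delta>) t) ^ k * cis (\<beta> * t)))
     \<le> 8 * (B ^ k * N * (1 + 1 / \<delta>)) * h powr (- \<theta>)" if h: "h > 0" and R: "R \<ge> 1" for h R \<beta>
  proof -
    define \<kappa> where "\<kappa> t = riesz_kernel h r (Complex (1 - \<delta>) t)" for t
    define \<kappa>' where "\<kappa>' t = - \<i> * (1 / Complex (1 - \<delta>) t + of_nat r * of_real h / (1 + of_real h * Complex (1 - \<delta>) t))" for t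
    have d\<kappa>: "(\<kappa> has_vector_derivative \<kappa> t * \<kappa>' t) (at t)" for t
      unfolding \<kappa>_def \<kappa>'_def using h \<delta> by (intro riesz_kernel_vector_derivative) auto
    define A where "A t = \<kappa> t * (of_real (t powr c) * b t ^ k)" for t
    define l where "l t = \<kappa>' t + of_real (c / t) + of_nat k * \<rho> t" for t
    have dA: "(A has_vector_derivative A t * l t) (at t)" if t: "t \<in> {1..R}" for t
    proof -
      have t1: "t \<ge> 1" using that by simp
      have p: "((\<lambda>t. t powr c) has_field_derivative c * t powr (c - 1)) (at t)"
        using t1 by (intro has_real_derivative_powr) auto
      have bk: "((\<lambda>t. b t ^ k) has_vector_derivative of_nat k * \<rho> t * b t ^ k) (at t)"
      proof -
        have "((\<lambda>w. w ^ k) has_field_derivative of_nat k * b t ^ (k - 1)) (at (b t))"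
          by (auto intro!: derivative_eq_intros)
        from field_vector_diff_chain_at[OF db[OF t1] this]
        have "((\<lambda>t. b t ^ k) has_vector_derivative \<rho> t * b t * (of_nat k * b t ^ (k - 1))) (at t)" by (simp add: o_def)
        also have "\<rho> t * b t * (of_nat k * b t ^ (k - 1)) = of_nat k * \<rho> t * b t ^ k"
          using \<open>k \<ge> 1\<close> by (cases k) auto
        finally show ?thesis .
      qed
      have "(A has_vector_derivative \<kappa> t * (of_real (t powr c) * (of_nat k * \<rho> t * b t ^ k) + of_real (c * t powr (c - 1)) * b t ^ k)
          + \<kappa> t * \<kappa>' t * (of_real (t powr c) * b t ^ k)) (at t)"
        unfolding A_def by (intro has_vector_derivative_mult has_vector_derivative_of_real p bk d\<kappa>)
      moreover have "t powr (c - 1) = t powr c / t" using t1 by (simp add: powr_diff)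
      ultimately show ?thesis unfolding A_def l_def using t1 by (simp add: algebra_simps)
    qed
    have nl: "norm (l t) \<le> N / t" if t: "t \<ge> 1" for t
    proof -
      have "norm (1 / Complex (1 - \<delta>) t) \<le> 1 / t"
        using abs_Im_le_cmod[of "Complex (1 - \<delta>) t"] t by (simp add: norm_divide frac_le)
      moreover have "norm (of_nat r * of_real h / (1 + of_real h * Complex (1 - \<delta>) t)) \<le> real r / t"
      proof -
        have "h * t \<le> norm (1 + of_real h * Complex (1 - \<delta>) t)"
          using riesz_kernel_denominator(1)[OF h, of "Complex (1 - \<delta>) t"] t by simp
        moreover have "0 < h * t" using h t by simp
        ultimately have "real r * h / norm (1 + of_real h * Complex (1 - \<delta>) t) \<le> real r * h / (h * t)"
          using h by (intro frac_le) simp_all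
        then show ?thesis using h by (simp add: norm_divide norm_mult)
      qed
      ultimately have "norm (\<kappa>' t) \<le> 1 / t + real r / t"
        unfolding \<kappa>'_def norm_mult norm_minus_cancel norm_ii mult_1 by (rule order_trans[OF norm_triangle_ineq add_mono])
      moreover have "norm (of_real (c / t) :: complex) \<le> real k / t"
        using c t by (simp add: norm_divide divide_right_mono)
      moreover have "norm (of_nat k * \<rho> t) \<le> 12 * real k / t"
      proof -
        have "norm (\<rho> t) \<le> 12 / t\<^sup>2" by (rule \<rho>[OF t])
        also have "\<dots> \<le> 12 / t" using t by (intro divide_left_mono) (auto simp: power2_eq_square)
        finally have "real k * norm (\<rho> t) \<le> real k * (12 / t)" by (intro mult_left_mono) auto
        then show ?thesis by (simp add: norm_mult mult_ac)
      qed
      ultimately have "norm (l t) \<le> (1 / t + real r / t) + real k / t + 12 * real k / t"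
        unfolding l_def by (intro order_trans[OF norm_triangle_ineq] add_mono)
      also have "\<dots> = N / t" by (simp add: N_def add_divide_distrib[symmetric])
      finally show ?thesis .
    qed
    have nA: "norm (A t) \<le> B ^ k * h powr (- \<theta>) * t powr (- 1/2 - \<delta>)" if t: "t \<ge> 1" for t
    proof -
      have "norm (A t) = norm (\<kappa> t) * (t powr c * norm (b t) ^ k)" by (simp add: A_def norm_mult norm_power)
      also have "\<dots> \<le> (h powr (- \<theta>) * t powr (- 1 - \<theta>)) * (t powr c * B ^ k)"
        unfolding \<kappa>_def using t h \<delta> \<theta>0 r bB[OF t] by (intro mult_mono norm_riesz_kernel_powr_le power_mono) auto
      also have "\<dots> = B ^ k * h powr (- \<theta>) * (t powr (- 1 - \<theta>) * t powr c)" by simp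
      also have "t powr (- 1 - \<theta>) * t powr c = t powr (- 1/2 - \<delta>)"
      proof -
        have "(- 1 - \<theta>) + c = - 1/2 - \<delta>" by (simp add: \<theta>_def c_def field_simps)
        then show ?thesis by (simp flip: powr_add)
      qed
      finally show ?thesis .
    qed
    define M where "M = B ^ k * h powr (- \<theta>) * N"
    have M': "B ^ k * h powr (- \<theta>) \<le> M"
      unfolding M_def using N B by (intro order_trans[OF _ mult_left_mono[OF N]]) auto
    have "norm (integral {1..R} (\<lambda>t. A t * cis (\<beta> * t - real k * (t * ln t - t)))) \<le> 8 * M * (1 + 1 / \<delta>)"
    proof (rule oscillating_integral_amplitude_bound[OF \<open>k \<ge> 1\<close> R \<delta>(1) dA])
      have cA: "continuous_on {1..R} A"
        by (rule continuous_on_vector_derivative[OF has_vector_derivative_at_within[OF dA]])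
      have nz: "Complex (1 - \<delta>) t \<noteq> 0" "1 + of_real h * Complex (1 - \<delta>) t \<noteq> 0" for t
        using riesz_kernel_denominator(3,4)[OF h, of "Complex (1 - \<delta>) t"] \<delta> by auto
      have cC: "continuous_on {1..R} (\<lambda>t. Complex (1 - \<delta>) t)"
        by (intro continuous_intros)
      show "continuous_on {1..R} (\<lambda>t. A t * l t)"
        unfolding l_def \<kappa>'_def using nz
        by (intro continuous_intros cA cC continuous_on_subset[OF c\<rho>]) auto
      show "norm (A t) \<le> M * t powr (- 1/2 - \<delta>)" if "t \<in> {1..R}" for t
        by (rule order_trans[OF nA mult_right_mono[OF M']]) (use that in auto)
      show "norm (A t * l t) \<le> M * t powr (- 3/2 - \<delta>)" if "t \<in> {1..R}" for t
      proof -
        have t: "t \<ge> 1" using that by simp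
        have "norm (A t * l t) \<le> (B ^ k * h powr (- \<theta>) * t powr (- 1/2 - \<delta>)) * (N / t)"
          unfolding norm_mult using B N t by (intro mult_mono nA nl) auto
        also have "\<dots> = M * (t powr (- 1/2 - \<delta>) / t)" by (simp add: M_def)
        also have "t powr (- 1/2 - \<delta>) / t = t powr (- 3/2 - \<delta>)"
        proof -
          have "t powr ((- 1/2 - \<delta>) - 1) = t powr (- 1/2 - \<delta>) / t powr 1" by (rule powr_diff)
          then show ?thesis using t by simp
        qed
        finally show ?thesis .
      qed
    qed
    also have "integral {1..R} (\<lambda>t. A t * cis (\<beta> * t - real k * (t * ln t - t))) = integral {1..R} (\<lambda>t. \<kappa> t * sine_gamma_factor (Complex (- \<delta>) t) ^ k * cis (\<beta> * t))"
    proof (rule integral_cong)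
      fix t assume "t \<in> {1..R}"
      then have t: "t \<ge> 1" by simp
      have "sine_gamma_factor (Complex (- \<delta>) t) ^ k = b t ^ k * of_real (t powr c) * cis (- real k * (t * ln t - t))"
      proof -
        have "(t powr (1/2 + \<delta>)) ^ k = t powr c" using t by (simp add: c_def powr_powr mult.commute flip: powr_realpow)
        then have "complex_of_real (t powr (1/2 + \<delta>)) ^ k = of_real (t powr c)" by (metis of_real_power)
        moreover have "cis (- (t * ln t - t)) ^ k = cis (- real k * (t * ln t - t))"
          using Complex.DeMoivre[of "- (t * ln t - t)" k] by (simp only: mult_minus_left mult_minus_right)
        ultimately show ?thesis unfolding G[OF t] power_mult_distrib by (simp only:)
      qed
      moreover have "cis (\<beta> * t - real k * (t * ln t - t)) = cis (\<beta> * t) * cis (- real k * (t * ln t - t))"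
        by (simp add: cis_mult)
      ultimately show "A t * cis (\<beta> * t - real k * (t * ln t - t)) = \<kappa> t * sine_gamma_factor (Complex (- \<delta>) t) ^ k * cis (\<beta> * t)"
        by (simp add: A_def mult_ac)
    qed
    finally show ?thesis by (simp add: \<kappa>_def M_def mult_ac)
  qed
  moreover have "8 * (B ^ k * N * (1 + 1 / \<delta>)) > 0" using B N \<delta> by (intro mult_pos_pos) (auto intro: add_pos_pos)
  ultimately show ?thesis using that by blast
qed

text \<open>
  Multiplication by \<open>D\<close> enlarges the sup norm of a Fourier transform over any compact interval at most by the
  factor \<open>M\<close>. This property is preserved under products, whereas a product of several series of exponentials
  would have to be rewritten as a multiple series.
\<close>

definition fourier_multiplier :: "real \<Rightarrow> (real \<Rightarrow> complex) \<Rightarrow> bool" where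
  "fourier_multiplier M D \<longleftrightarrow> M \<ge> 0 \<and> continuous_on UNIV D \<and>
     (\<forall>p q g B. continuous_on {p..q} g \<longrightarrow> (\<forall>\<beta>. norm (integral {p..q} (\<lambda>t. g t * cis (\<beta> * t))) \<le> B) \<longrightarrow>
        (\<forall>\<beta>. norm (integral {p..q} (\<lambda>t. g t * D t * cis (\<beta> * t))) \<le> M * B))"

lemma fourier_multiplierD:
  assumes "fourier_multiplier M D" "continuous_on {p..q} g"
    and "\<And>\<beta>. norm (integral {p..q} (\<lambda>t. g t * cis (\<beta> * t))) \<le> B"
  shows "norm (integral {p..q} (\<lambda>t. g t * D t * cis (\<beta> * t))) \<le> M * B"
  using assms unfolding fourier_multiplier_def by blast

lemma fourier_multiplier_exp_series:
  fixes c :: "nat \<Rightarrow> complex" and \<beta> :: "nat \<Rightarrow> real"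
  assumes "summable (\<lambda>n. norm (c n))"
  shows "fourier_multiplier (\<Sum>n. norm (c n)) (\<lambda>t. \<Sum>n. c n * cis (\<beta> n * t))"
proof -
  have "continuous_on {- real n..real n} (\<lambda>t. \<Sum>n. c n * cis (\<beta> n * t))" for n
    by (rule fourier_bound_mult_exp_series(2)[where g = "\<lambda>_. 0" and B = 0, OF _ _ assms]) auto
  then have "continuous_on UNIV (\<lambda>t. \<Sum>n. c n * cis (\<beta> n * t))"
  proof -
    assume *: "\<And>n. continuous_on {- real n..real n} (\<lambda>t. \<Sum>n. c n * cis (\<beta> n * t))"
    show ?thesis
    proof (rule continuous_at_imp_continuous_on, rule ballI)
      fix x :: real
      obtain n where "real n > \<bar>x\<bar>" using reals_Archimedean2 by blast
      then have "x \<in> interior {- real n..real n}" by (simp add: interior_atLeastAtMost_real abs_less_iff)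
      then show "isCont (\<lambda>t. \<Sum>n. c n * cis (\<beta> n * t)) x" using *[of n] continuous_on_interior by blast
    qed
  qed
  moreover have "0 \<le> (\<Sum>n. norm (c n))" by (intro suminf_nonneg assms) auto
  ultimately show ?thesis
    unfolding fourier_multiplier_def using fourier_bound_mult_exp_series(1)[OF _ _ assms] by blast
qed

lemma fourier_multiplier_diff:
  assumes "fourier_multiplier M D" "fourier_multiplier N E"
  shows "fourier_multiplier (M + N) (\<lambda>t. D t - E t)"
  unfolding fourier_multiplier_def
proof (intro conjI allI impI)
  have c: "continuous_on UNIV D" "continuous_on UNIV E" and nn: "M \<ge> 0" "N \<ge> 0"
    using assms by (auto simp: fourier_multiplier_def)
  show "0 \<le> M + N" using nn by simp
  show "continuous_on UNIV (\<lambda>t. D t - E t)" by (intro continuous_intros c)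
  fix p q g B \<beta>
  assume g: "continuous_on {p..q} g" and B: "\<forall>\<beta>. norm (integral {p..q} (\<lambda>t. g t * cis (\<beta> * t))) \<le> B"
  have i: "(\<lambda>t. g t * D t * cis (\<beta> * t)) integrable_on {p..q}" "(\<lambda>t. g t * E t * cis (\<beta> * t)) integrable_on {p..q}"
    by (intro integrable_continuous_real continuous_intros g continuous_on_subset[OF c(1)] continuous_on_subset[OF c(2)]; simp)+
  have "integral {p..q} (\<lambda>t. g t * (D t - E t) * cis (\<beta> * t)) = integral {p..q} (\<lambda>t. g t * D t * cis (\<beta> * t)) - integral {p..q} (\<lambda>t. g t * E t * cis (\<beta> * t))"
    using Henstock_Kurzweil_Integration.integral_diff[OF i] by (simp add: algebra_simps)
  also have "norm \<dots> \<le> M * B + N * B"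
    using assms B g by (intro order_trans[OF norm_triangle_ineq4] add_mono fourier_multiplierD) auto
  finally show "norm (integral {p..q} (\<lambda>t. g t * (D t - E t) * cis (\<beta> * t))) \<le> (M + N) * B"
    by (simp add: distrib_right)
qed

lemma fourier_multiplier_zero: "fourier_multiplier 0 (\<lambda>_. 0)"
  by (simp add: fourier_multiplier_def)

lemma fourier_multiplier_prod:
  assumes "finite J" "\<And>j. j \<in> J \<Longrightarrow> fourier_multiplier (M j) (D j)"
  shows "fourier_multiplier (\<Prod>j\<in>J. M j) (\<lambda>t. \<Prod>j\<in>J. D j t)"
  using assms
proof (induction J rule: finite_induct)
  case empty
  then show ?case by (simp add: fourier_multiplier_def)
next
  case (insert j J)
  have j: "fourier_multiplier (M j) (D j)" and J: "fourier_multiplier (\<Prod>j\<in>J. M j) (\<lambda>t. \<Prod>j\<in>J. D j t)"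
    using insert by auto
  have c: "continuous_on UNIV (D j)" "continuous_on UNIV (\<lambda>t. \<Prod>j\<in>J. D j t)" and nn: "M j \<ge> 0" "(\<Prod>j\<in>J. M j) \<ge> 0"
    using j J by (auto simp: fourier_multiplier_def)
  show ?case
    unfolding fourier_multiplier_def prod.insert[OF insert(1,2)]
  proof (intro conjI allI impI)
    show "0 \<le> M j * (\<Prod>j\<in>J. M j)" using nn by simp
    show "continuous_on UNIV (\<lambda>t. D j t * (\<Prod>j\<in>J. D j t))" by (intro continuous_on_mult c)
    fix p q g B \<beta>
    assume g: "continuous_on {p..q} g" and B: "\<forall>\<beta>. norm (integral {p..q} (\<lambda>t. g t * cis (\<beta> * t))) \<le> B"
    have "norm (integral {p..q} (\<lambda>t. (g t * (\<Prod>j\<in>J. D j t)) * D j t * cis (\<beta> * t))) \<le> M j * ((\<Prod>j\<in>J. M j) * B)"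
      by (intro fourier_multiplierD[OF j] fourier_multiplierD[OF J] g continuous_on_mult continuous_on_subset[OF c(2)])
        (use B in auto)
    then show "norm (integral {p..q} (\<lambda>t. g t * (D j t * (\<Prod>j\<in>J. D j t)) * cis (\<beta> * t))) \<le> M j * (\<Prod>j\<in>J. M j) * B"
      by (simp add: mult_ac)
  qed
qed

lemma of_real_powr_Complex:
  assumes "x > 0"
  shows "of_real x powr Complex c t = of_real (x powr c) * cis (ln x * t)"
proof -
  have w: "Complex c t = of_real c + \<i> * of_real t" by (simp add: complex_eq_iff)
  have "complex_of_real x powr Complex c t = exp (of_real (c * ln x) + \<i> * of_real (ln x * t))"
    unfolding w using assms by (simp add: powr_def Ln_of_real algebra_simps)
  also have "\<dots> = of_real (exp (c * ln x)) * cis (ln x * t)"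
    by (simp only: exp_add exp_of_real cis_conv_exp)
  also have "exp (c * ln x) = x powr c" using assms by (simp add: powr_def)
  finally show ?thesis .
qed

text \<open>
  On a vertical line \<open>a^(s - 1)\<close> is an exponential in \<open>t\<close> with frequency \<open>ln a\<close>, and on the abscissa
  \<open>-\<delta>\<close> its coefficient \<open>a^(-1 - \<delta>)\<close> is summable over the progression.
\<close>

lemma shifted_powr_series_multiplier:
  assumes "\<alpha> > 0" "\<delta> > 0"
  shows "fourier_multiplier (\<Sum>k. (2 * pi * (real k + \<alpha>)) powr (- 1 - \<delta>))
     (\<lambda>t. \<Sum>k. of_real (2 * pi * (real k + \<alpha>)) powr (Complex (- \<delta>) t - 1))"
proof -
  define a where "a k = 2 * pi * (real k + \<alpha>)" for k
  have a: "a k > 0" for k using assms by (simp add: a_def add_nonneg_pos)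
  have eq: "complex_of_real (a k) powr (Complex (- \<delta>) t - 1) = of_real (a k powr (- 1 - \<delta>)) * cis (ln (a k) * t)" for k t
  proof -
    have "Complex (- \<delta>) t - 1 = Complex (- 1 - \<delta>) t" by (simp add: complex_eq_iff)
    then show ?thesis by (simp only: of_real_powr_Complex[OF a])
  qed
  have n: "norm (complex_of_real (a k powr (- 1 - \<delta>))) = a k powr (- 1 - \<delta>)" for k by simp
  have "summable (\<lambda>k. norm (complex_of_real (a k powr (- 1 - \<delta>))))"
    unfolding n unfolding a_def using assms by (intro summable_shifted_powr) auto
  from fourier_multiplier_exp_series[OF this, of "\<lambda>k. ln (a k)"]
  show ?thesis unfolding a_def[symmetric] eq n .
qed

section \<open>The integral to the left of the critical strip\<close>

lemma holomorphic_sine_L: "sine_L \<alpha> holomorphic_on {s. Re s > -1}"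
proof (cases "\<alpha> \<in> \<int>")
  case True
  then show ?thesis by (simp add: sine_L_def[abs_def])
next
  case False
  then show ?thesis
    unfolding sine_L_nonint[OF False] using cis_neq_1_of_nonint[OF False]
    by (intro holomorphic_intros holomorphic_polylog_cont) auto
qed

lemma sine_L_polynomial_growth:
  obtains C where "C > 0" "\<And>s. Re s \<ge> -1/2 \<Longrightarrow> norm (sine_L \<alpha> s) \<le> C * (1 + norm s) ^ 2"
proof (cases "\<alpha> \<in> \<int>")
  case True
  then show ?thesis using that[of 1] by (simp add: sine_L_def)
next
  case False
  obtain C1 where C1: "C1 > 0" "\<And>s. Re s \<ge> -1/2 \<Longrightarrow> norm (polylog_cont (cis (2 * pi * \<alpha>)) s) \<le> C1 * (1 + norm s) ^ 2"
    using polylog_cont_polynomial_growth[of "cis (2 * pi * \<alpha>)"] cis_neq_1_of_nonint[OF False] by auto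
  obtain C2 where C2: "C2 > 0" "\<And>s. Re s \<ge> -1/2 \<Longrightarrow> norm (polylog_cont (cis (- (2 * pi * \<alpha>))) s) \<le> C2 * (1 + norm s) ^ 2"
    using polylog_cont_polynomial_growth[of "cis (- (2 * pi * \<alpha>))"] cis_neq_1_of_nonint[OF False] by auto
  show ?thesis
  proof (rule that)
    show "C1 + C2 > 0" using C1 C2 by simp
    fix s :: complex assume s: "Re s \<ge> -1/2"
    have "norm (sine_L \<alpha> s) \<le> (norm (polylog_cont (cis (2 * pi * \<alpha>)) s) + norm (polylog_cont (cis (- (2 * pi * \<alpha>))) s)) / 2"
      unfolding sine_L_nonint[OF False] norm_divide by (simp add: norm_mult divide_right_mono norm_triangle_ineq4)
    also have "\<dots> \<le> (C1 * (1 + norm s) ^ 2 + C2 * (1 + norm s) ^ 2) / 2"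
      by (intro divide_right_mono add_mono C1 C2 s) simp
    also have "\<dots> = (C1 + C2) * (1 + norm s) ^ 2 / 2" by (simp add: algebra_simps)
    also have "\<dots> \<le> (C1 + C2) * (1 + norm s) ^ 2" using C1 C2 by (simp add: field_simps)
    finally show "norm (sine_L \<alpha> s) \<le> (C1 + C2) * (1 + norm s) ^ 2" .
  qed
qed

lemma sine_L_cnj:
  assumes "Re s > -1"
  shows "sine_L \<alpha> (cnj s) = cnj (sine_L \<alpha> s)"
proof (cases "\<alpha> \<in> \<int>")
  case False
  show ?thesis
    unfolding sine_L_nonint[OF False] using assms
    by (simp add: polylog_cont_cnj cis_cnj minus_divide_left[symmetric] minus_divide_right[symmetric] diff_divide_distrib right_diff_distrib)
qed (simp add: sine_L_def)

lemma sine_L_Dirichlet_series: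
  assumes "Re s > 1"
  shows "(\<lambda>n. of_real (sin (2 * pi * real n * \<alpha>)) * of_nat n powr (- s)) sums sine_L \<alpha> s"
proof (cases "\<alpha> \<in> \<int>")
  case True
  then obtain m :: int where m: "\<alpha> = of_int m" by (elim Ints_cases)
  have "sin (2 * pi * real n * \<alpha>) = 0" for n
  proof -
    have "2 * pi * real n * \<alpha> = of_int (2 * int n * m) * pi" by (simp add: m)
    then show ?thesis unfolding sin_zero_iff_int2 by blast
  qed
  then show ?thesis using True by (simp add: sine_L_def)
next
  case False
  have s: "(\<lambda>n. (cis (2 * pi * \<alpha>) ^ n * of_nat n powr (- s) - cis (- (2 * pi * \<alpha>)) ^ n * of_nat n powr (- s)) / (2 * \<i>)) sums sine_L \<alpha> s"
    unfolding sine_L_nonint[OF False] using cis_neq_1_of_nonint[OF False] assms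
    by (intro sums_divide sums_diff polylog_cont_eq_Dirichlet_series) auto
  moreover have "(cis (2 * pi * \<alpha>) ^ n * w - cis (- (2 * pi * \<alpha>)) ^ n * w) / (2 * \<i>) = of_real (sin (2 * pi * real n * \<alpha>)) * w" for n w
  proof -
    have "cis (2 * pi * \<alpha>) ^ n - cis (- (2 * pi * \<alpha>)) ^ n = 2 * \<i> * of_real (sin (2 * pi * real n * \<alpha>))"
      unfolding Complex.DeMoivre by (simp add: complex_eq_iff mult_ac)
    then have "(cis (2 * pi * \<alpha>) ^ n - cis (- (2 * pi * \<alpha>)) ^ n) * w / (2 * \<i>) = of_real (sin (2 * pi * real n * \<alpha>)) * w"
      by simp
    then show ?thesis by (simp only: left_diff_distrib)
  qed
  ultimately show ?thesis by simp
qed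

lemma sine_L_on_left_line:
  assumes "0 < \<delta>" "\<delta> \<le> 1/2"
  obtains M D where "fourier_multiplier M D"
    "\<And>t. sine_L \<alpha> (Complex (- \<delta>) t) = sine_gamma_factor (Complex (- \<delta>) t) * D t"
proof (cases "\<alpha> \<in> \<int>")
  case True
  then show ?thesis using that[OF fourier_multiplier_zero] by (simp add: sine_L_def)
next
  case False
  have f: "0 < frac \<alpha>" "frac \<alpha> < 1" "0 < 1 - frac \<alpha>" using False frac_lt_1[of \<alpha>] by (auto simp: frac_gt_0_iff)
  show ?thesis
  proof (rule that[OF fourier_multiplier_diff[OF shifted_powr_series_multiplier[OF f(1) assms(1)] shifted_powr_series_multiplier[OF f(3) assms(1)]]])
    fix t
    show "sine_L \<alpha> (Complex (- \<delta>) t) = sine_gamma_factor (Complex (- \<delta>) t) *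
      ((\<Sum>k. of_real (2 * pi * (real k + frac \<alpha>)) powr (Complex (- \<delta>) t - 1)) - (\<Sum>k. of_real (2 * pi * (real k + (1 - frac \<alpha>))) powr (Complex (- \<delta>) t - 1)))"
      using False assms by (intro sine_L_functional_equation) auto
  qed
qed

text \<open>
  The integrand takes conjugate values at \<open>t\<close> and \<open>-t\<close>, so \<open>t \<ge> 0\<close> is enough. The part up to \<open>t = 1\<close> is
  bounded trivially. In the rest, \<open>x^(i t)\<close> is a frequency, the gamma factors supply the oscillation and the
  dual series act as multipliers.
\<close>

lemma left_line_integral_bound:
  fixes \<alpha> :: "nat \<Rightarrow> real" and k r :: nat and \<delta> :: real
  assumes k: "k \<ge> 1" and \<delta>: "0 < \<delta>" "\<delta> \<le> 1/2"
  defines "\<theta> \<equiv> (real k - 1) / 2 + (real k + 1) * \<delta>"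
  assumes r: "\<theta> \<le> real r"
  obtains C where "C > 0" "\<And>h R x. h > 0 \<Longrightarrow> R \<ge> 1 \<Longrightarrow> x > 0 \<Longrightarrow>
    norm (integral {-R..R} (\<lambda>t. of_real x powr Complex (1 - \<delta>) t * riesz_kernel h r (Complex (1 - \<delta>) t) * (\<Prod>j=1..k. sine_L (\<alpha> j) (Complex (1 - \<delta>) t - 1))))
      \<le> C * x powr (1 - \<delta>) * (1 + h powr (- \<theta>))"
proof -
  obtain C1 where C1: "C1 > 0" "\<And>h R \<beta>. h > 0 \<Longrightarrow> R \<ge> 1 \<Longrightarrow>
    norm (integral {1..R} (\<lambda>t. riesz_kernel h r (Complex (1 - \<delta>) t) * sine_gamma_factor (Complex (- \<delta>) t) ^ k * cis (\<beta> * t))) \<le> C1 * h powr (- \<theta>)"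
    using gamma_factor_fourier_bound[OF k \<delta>, of r] r unfolding \<theta>_def by blast
  have "\<forall>j. \<exists>M D. fourier_multiplier M D \<and> (\<forall>t. sine_L (\<alpha> j) (Complex (- \<delta>) t) = sine_gamma_factor (Complex (- \<delta>) t) * D t)"
    using sine_L_on_left_line[OF \<delta>] by metis
  then obtain M D where MD: "\<And>j. fourier_multiplier (M j) (D j)" "\<And>j t. sine_L (\<alpha> j) (Complex (- \<delta>) t) = sine_gamma_factor (Complex (- \<delta>) t) * D j t"
    by metis
  define P where "P t = (\<Prod>j=1..k. D j t)" for t
  define MP where "MP = (\<Prod>j=1..k. M j)"
  have mP: "fourier_multiplier MP P" unfolding MP_def P_def by (intro fourier_multiplier_prod MD) auto
  have MP0: "MP \<ge> 0" using mP by (simp add: fourier_multiplier_def)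
  define Lp where "Lp t = (\<Prod>j=1..k. sine_L (\<alpha> j) (Complex (- \<delta>) t))" for t
  have Lp: "Lp t = sine_gamma_factor (Complex (- \<delta>) t) ^ k * P t" for t
    by (simp add: Lp_def MD(2) P_def prod.distrib)
  have cC: "continuous_on S (\<lambda>t. Complex c t)" for c S by (intro continuous_intros)
  have cLp: "continuous_on S Lp" for S
    unfolding Lp_def using \<delta>
    by (intro continuous_on_prod continuous_on_compose2[OF holomorphic_on_imp_continuous_on[OF holomorphic_sine_L] cC]) auto
  obtain C2 where C2: "\<And>t. t \<in> {0..1} \<Longrightarrow> norm (Lp t) \<le> C2" "C2 > 0"
  proof -
    have "bounded (Lp ` {0..1})" by (intro compact_imp_bounded compact_continuous_image cLp) auto
    then obtain c where "c > 0" "\<forall>y\<in>Lp ` {0..1}. norm y \<le> c" unfolding bounded_pos by blast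
    then show ?thesis using that[of c] by blast
  qed
  show ?thesis
  proof (rule that)
    show "2 * (2 * C2 + MP * C1) > 0" using C2 C1 MP0 by (auto intro!: add_pos_nonneg mult_pos_pos)
    fix h R x :: real assume h: "h > 0" and R: "R \<ge> 1" and x: "x > 0"
    define K where "K t = riesz_kernel h r (Complex (1 - \<delta>) t)" for t
    define f where "f t = of_real x powr Complex (1 - \<delta>) t * K t * Lp t" for t
    have cK: "continuous_on S K" for S
      unfolding K_def using \<delta> h by (intro continuous_on_riesz_kernel_line) auto
    note xp = of_real_powr_Complex[OF x, of "1 - \<delta>"]
    have cf: "continuous_on S f" for S
      unfolding f_def xp by (intro continuous_intros cK cLp)
    have fi: "f integrable_on {p..q}" for p q by (rule integrable_continuous_real[OF cf])
    \<comment> \<open>The sines are real, so all factors take conjugate values at conjugate points.\<close>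
    have fcnj: "f (- t) = cnj (f t)" for t
    proof -
      have 1: "Complex c (- t) = cnj (Complex c t)" for c by (simp add: complex_eq_iff)
      have "K (- t) = cnj (K t)" by (simp add: K_def 1 riesz_kernel_def)
      moreover have "Lp (- t) = cnj (Lp t)" using \<delta> by (simp add: Lp_def 1 sine_L_cnj cnj_prod)
      moreover have "of_real x powr Complex (1 - \<delta>) (- t) = cnj (of_real x powr Complex (1 - \<delta>) t)"
        unfolding xp by (simp add: cis_cnj)
      ultimately show ?thesis by (simp add: f_def)
    qed
    have neg: "integral {-R..0} f = cnj (integral {0..R} f)"
    proof -
      have "integral {-R..0} f = integral {0..R} (\<lambda>t. f (- t))"
        using Henstock_Kurzweil_Integration.integral_reflect_real[of R 0 "\<lambda>t. f (- t)"] by simp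
      also have "\<dots> = integral {0..R} (\<lambda>t. cnj (f t))" by (simp only: fcnj)
      also have "\<dots> = cnj (integral {0..R} f)"
        using integral_unique[OF has_integral_cnj[THEN iffD2, OF integrable_integral[OF fi]]] by (simp add: o_def)
      finally show ?thesis .
    qed
    have "integral {-R..R} f = integral {-R..0} f + integral {0..R} f"
      using R by (intro Henstock_Kurzweil_Integration.integral_combine[symmetric] fi) auto
    then have "norm (integral {-R..R} f) \<le> 2 * norm (integral {0..R} f)"
      unfolding neg using norm_triangle_ineq[of "cnj (integral {0..R} f)" "integral {0..R} f"] by simp
    also have "integral {0..R} f = integral {0..1} f + integral {1..R} f"
      using R by (intro Henstock_Kurzweil_Integration.integral_combine[symmetric] fi) auto
    also have "norm (integral {0..1} f + integral {1..R} f) \<le> x powr (1 - \<delta>) * (2 * C2) + x powr (1 - \<delta>) * (MP * (C1 * h powr (- \<theta>)))"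
    proof (rule order_trans[OF norm_triangle_ineq add_mono])
      have "norm (integral {0..1} f) \<le> (x powr (1 - \<delta>) * (2 * C2)) * (1 - 0)"
      proof (rule integral_bound)
        fix t :: real assume t: "t \<in> {0..1}"
        have "1 \<le> norm (1 + of_real h * Complex (1 - \<delta>) t) ^ r"
          using riesz_kernel_denominator(2)[OF h, of "Complex (1 - \<delta>) t"] \<delta> by (intro one_le_power) auto
        moreover have "1/2 \<le> norm (Complex (1 - \<delta>) t)"
          using complex_Re_le_cmod[of "Complex (1 - \<delta>) t"] \<delta> by simp
        ultimately have "1/2 * 1 \<le> norm (Complex (1 - \<delta>) t) * norm (1 + of_real h * Complex (1 - \<delta>) t) ^ r"
          by (intro mult_mono) auto
        then have "norm (K t) \<le> 1 / (1/2)"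
          unfolding K_def riesz_kernel_def norm_divide norm_mult norm_power norm_one by (intro frac_le) auto
        then have "norm (K t) \<le> 2" by simp
        then have "norm (f t) \<le> x powr (1 - \<delta>) * (2 * C2)"
          unfolding f_def xp norm_mult using C2(1)[OF t] by (simp add: mult.assoc) (intro mult_left_mono mult_mono, auto)
        then show "norm (f t) \<le> x powr (1 - \<delta>) * (2 * C2)" .
      qed (use cf in auto)
      then show "norm (integral {0..1} f) \<le> x powr (1 - \<delta>) * (2 * C2)" by simp
    next
      define g where "g t = K t * sine_gamma_factor (Complex (- \<delta>) t) ^ k" for t
      have "continuous_on {1..R} (\<lambda>t. sine_gamma_factor (Complex (- \<delta>) t))"
      proof (rule continuous_on_compose2[OF _ cC])
        show "continuous_on {s. Im s \<noteq> 0} sine_gamma_factor"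
          by (rule DERIV_continuous_on[OF sine_gamma_factor_deriv]) simp
      qed auto
      then have cg: "continuous_on {1..R} g" unfolding g_def by (intro continuous_intros cK)
      have "norm (integral {1..R} (\<lambda>t. g t * P t * cis (ln x * t))) \<le> MP * (C1 * h powr (- \<theta>))"
        by (rule fourier_multiplierD[OF mP cg]) (unfold g_def K_def, rule C1(2)[OF h R])
      moreover have "integral {1..R} f = of_real (x powr (1 - \<delta>)) * integral {1..R} (\<lambda>t. g t * P t * cis (ln x * t))"
      proof -
        have "f = (\<lambda>t. of_real (x powr (1 - \<delta>)) * (g t * P t * cis (ln x * t)))"
          by (simp add: fun_eq_iff f_def xp g_def Lp mult_ac)
        then show ?thesis by simp
      qed
      ultimately show "norm (integral {1..R} f) \<le> x powr (1 - \<delta>) * (MP * (C1 * h powr (- \<theta>)))"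
        by (simp add: norm_mult mult_left_mono)
    qed
    also have "x powr (1 - \<delta>) * (2 * C2) + x powr (1 - \<delta>) * (MP * (C1 * h powr (- \<theta>))) \<le> x powr (1 - \<delta>) * ((2 * C2 + MP * C1) * (1 + h powr (- \<theta>)))"
      unfolding distrib_left[symmetric] using C2 C1 MP0 by (intro mult_left_mono) (auto simp: algebra_simps)
    finally have "norm (integral {-R..R} f) \<le> 2 * (x powr (1 - \<delta>) * ((2 * C2 + MP * C1) * (1 + h powr (- \<theta>))))" by simp
    moreover have "Complex (1 - \<delta>) t - 1 = Complex (- \<delta>) t" for t by (simp add: complex_eq_iff)
    moreover have "2 * (x powr (1 - \<delta>) * ((2 * C2 + MP * C1) * (1 + h powr (- \<theta>)))) = 2 * (2 * C2 + MP * C1) * x powr (1 - \<delta>) * (1 + h powr (- \<theta>))"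
      by (simp only: mult_ac)
    ultimately show "norm (integral {-R..R} (\<lambda>t. of_real x powr Complex (1 - \<delta>) t * riesz_kernel h r (Complex (1 - \<delta>) t) * (\<Prod>j=1..k. sine_L (\<alpha> j) (Complex (1 - \<delta>) t - 1))))
      \<le> 2 * (2 * C2 + MP * C1) * x powr (1 - \<delta>) * (1 + h powr (- \<theta>))"
      by (simp only: f_def[abs_def] K_def Lp_def)
  qed
qed

section \<open>Smoothing the sum\<close>

lemma of_nat_prod_powr:
  fixes n :: "'a \<Rightarrow> nat" and w :: complex
  shows "(\<Prod>j\<in>J. of_nat (n j) powr w) = of_nat (\<Prod>j\<in>J. n j) powr w"
proof (induction J rule: infinite_finite_induct)
  case (insert j J)
  have "of_nat (n j * (\<Prod>j\<in>J. n j)) powr w = of_nat (n j) powr w * of_nat (\<Prod>j\<in>J. n j) powr w"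
    unfolding of_nat_mult by (rule powr_times_real) (auto simp del: of_nat_prod)
  then show ?case using insert by simp
qed simp_all

text \<open>
  The absolutely convergent \<open>k\<close>-fold product of \<open>\<Sum> m^(-2)\<close>; this majorant controls all sums over tuples.
\<close>

lemma summable_on_tuples:
  fixes k :: nat
  shows "(\<lambda>n. \<Prod>j=1..k. real (n j) powr (-2)) summable_on ({1..k} \<rightarrow>\<^sub>E {1..})"
proof -
  have "Infinite_Sum.abs_summable_on (\<lambda>m::nat. real m powr (-2)) {1..}"
  proof -
    have "summable (\<lambda>m. norm (real m powr (-2)))" by (simp add: summable_real_powr_iff)
    then have "Infinite_Sum.abs_summable_on (\<lambda>m::nat. real m powr (-2)) UNIV"
      by (simp add: norm_summable_imp_summable_on)
    then show ?thesis by (rule summable_on_subset_banach) simp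
  qed
  then have "Infinite_Set_Sum.abs_summable_on (\<lambda>m::nat. real m powr (-2)) {1..}" by (simp only: abs_summable_equivalent)
  then have "Infinite_Set_Sum.abs_summable_on (\<lambda>n. \<Prod>j\<in>{1..k}. real (n j) powr (-2)) ({1..k} \<rightarrow>\<^sub>E {1..})"
    by (intro abs_summable_on_prod_PiE) auto
  then have "Infinite_Sum.abs_summable_on (\<lambda>n. \<Prod>j\<in>{1..k}. real (n j) powr (-2)) ({1..k} \<rightarrow>\<^sub>E {1..})"
    by (simp only: abs_summable_equivalent)
  then show ?thesis by (rule abs_summable_summable)
qed

text \<open>
  The product of the \<open>k\<close> Dirichlet series is expanded into a series over tuples, which converges uniformly on the
  segment of integration and is integrated term by term.
\<close>

lemma smoothed_sum_eq_line_integral: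
  fixes \<alpha> :: "nat \<Rightarrow> real"
  assumes h: "h > 0" and x: "x > 0"
  shows "((\<lambda>n. of_real (\<Prod>j=1..k. real (n j) * sin (2 * pi * real (n j) * \<alpha> j)) * smooth_step h r R (x / real (\<Prod>j=1..k. n j)))
    has_sum (integral {-R..R} (\<lambda>t. of_real x powr Complex 3 t * riesz_kernel h r (Complex 3 t) * (\<Prod>j=1..k. sine_L (\<alpha> j) (Complex 3 t - 1))) / (2 * pi)))
    ({1..k} \<rightarrow>\<^sub>E {1..})"
proof -
  define T where "T = ({1..k} \<rightarrow>\<^sub>E {1..} :: (nat \<Rightarrow> nat) set)"
  define c where "c n = (\<Prod>j=1..k. real (n j) * sin (2 * pi * real (n j) * \<alpha> j))" for n :: "nat \<Rightarrow> nat"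
  define g where "g n = (\<Prod>j=1..k. n j)" for n :: "nat \<Rightarrow> nat"
  define K where "K t = of_real x powr Complex 3 t * riesz_kernel h r (Complex 3 t)" for t
  define q where "q j m t = of_real (sin (2 * pi * real m * \<alpha> j)) * of_nat m powr (- (Complex 3 t - 1))" for j m and t :: real
  define f where "f n t = K t * (\<Prod>j=1..k. q j (n j) t)" for n and t :: real
  have cC: "continuous_on S (\<lambda>t. Complex c t)" for c S by (intro continuous_intros)
  have cK: "continuous_on S K" for S
    unfolding K_def using h x by (intro continuous_intros continuous_on_riesz_kernel_line cC) auto
  have nq: "norm (q j m t) \<le> real m powr (-2)" for j m t
  proof -
    have "norm (q j m t) = \<bar>sin (2 * pi * real m * \<alpha> j)\<bar> * real m powr (-2)"
      by (simp add: q_def norm_mult norm_powr_real_powr)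
    also have "\<dots> \<le> 1 * real m powr (-2)" by (intro mult_right_mono) auto
    finally show ?thesis by simp
  qed
  have cq: "continuous_on S (q j m)" if "m \<ge> 1" for S j m
    unfolding q_def[abs_def] using that by (intro continuous_intros cC) auto
  have cf: "continuous_on S (f n)" if "n \<in> T" for S n
    unfolding f_def[abs_def] using that by (intro continuous_intros cK cq) (auto simp: T_def PiE_iff)
  obtain B where B: "\<And>t. t \<in> {-R..R} \<Longrightarrow> norm (K t) \<le> B" "B > 0"
  proof -
    have "bounded (K ` {-R..R})" by (intro compact_imp_bounded compact_continuous_image cK) auto
    then obtain c where "c > 0" "\<forall>y\<in>K ` {-R..R}. norm y \<le> c" unfolding bounded_pos by blast
    then show ?thesis using that[of c] by blast
  qed
  define M where "M n = B * (\<Prod>j=1..k. real (n j) powr (-2))" for n :: "nat \<Rightarrow> nat"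
  have M: "M summable_on T" unfolding M_def T_def by (intro summable_on_cmult_right summable_on_tuples)
  have fM: "norm (f n t) \<le> M n" if "n \<in> T" "t \<in> {-R..R}" for n t
    unfolding f_def M_def norm_mult prod_norm[symmetric] using B(1)[OF that(2)] B(2) nq
    by (intro mult_mono prod_mono) (auto intro!: prod_nonneg)
  define S where "S t = (\<Prod>j=1..k. sine_L (\<alpha> j) (Complex 3 t - 1))" for t
  have fS: "((\<lambda>n. f n t) has_sum (K t * S t)) T" if "t \<in> {-R..R}" for t
  proof -
    have q1: "((\<lambda>m. q j m t) has_sum sine_L (\<alpha> j) (Complex 3 t - 1)) {1..}" and q2: "Infinite_Sum.abs_summable_on (\<lambda>m. q j m t) {1..}" for j
    proof -
      have "summable (\<lambda>m. real m powr (-2))" by (simp add: summable_real_powr_iff)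
      then have sm: "summable (\<lambda>m. norm (q j m t))"
        by (rule summable_comparison_test[rotated]) (use nq in auto)
      have "(\<lambda>m. q j m t) sums sine_L (\<alpha> j) (Complex 3 t - 1)"
        unfolding q_def by (intro sine_L_Dirichlet_series) simp
      then have "((\<lambda>m. q j m t) has_sum sine_L (\<alpha> j) (Complex 3 t - 1)) UNIV" by (rule norm_summable_imp_has_sum[OF sm])
      moreover have "q j 0 t = 0" by (simp add: q_def)
      ultimately show "((\<lambda>m. q j m t) has_sum sine_L (\<alpha> j) (Complex 3 t - 1)) {1..}"
        by (subst has_sum_cong_neutral[where T = UNIV and g = "\<lambda>m. q j m t"]) (auto simp: not_le)
      have "Infinite_Sum.abs_summable_on (\<lambda>m. q j m t) UNIV"
        using sm by (simp add: norm_summable_imp_summable_on)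
      then show "Infinite_Sum.abs_summable_on (\<lambda>m. q j m t) {1..}" by (rule summable_on_subset_banach) simp
    qed
    have "infsum (\<lambda>n. \<Prod>j=1..k. q j (n j) t) T = (\<Prod>j=1..k. infsum (\<lambda>m. q j m t) {1..})"
      unfolding T_def by (rule infsum_prod_PiE_abs) (use q2 in auto)
    also have "\<dots> = S t" unfolding S_def using infsumI[OF q1] by simp
    finally have 1: "infsum (\<lambda>n. \<Prod>j=1..k. q j (n j) t) T = S t" .
    have "(\<lambda>n. \<Prod>j=1..k. q j (n j) t) summable_on T"
    proof (rule abs_summable_summable, rule summable_on_comparison_test[OF summable_on_tuples[of k, folded T_def]])
      fix n show "norm (\<Prod>j=1..k. q j (n j) t) \<le> (\<Prod>j=1..k. real (n j) powr (-2))"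
        unfolding prod_norm[symmetric] using nq by (intro prod_mono) auto
    qed auto
    then have "((\<lambda>n. \<Prod>j=1..k. q j (n j) t) has_sum S t) T" using 1 has_sum_infsum by metis
    then show ?thesis unfolding f_def by (rule has_sum_cmult_right)
  qed
  \<comment> \<open>Set to 0 off T, as the uniform limit theorem asks for continuous partial sums over arbitrary sets.\<close>
  define f' where "f' n t = (if n \<in> T then f n t else 0)" for n t
  have "uniform_limit {-R..R} (\<lambda>X t. \<Sum>n\<in>X. f' n t) (\<lambda>t. K t * S t) (finite_subsets_at_top T)"
  proof (rule Weierstrass_m_test_general'[OF _ _ M])
    show "norm (f' n t) \<le> M n" if "n \<in> T" "t \<in> {-R..R}" for n t using fM that by (simp add: f'_def)
    show "((\<lambda>n. f' n t) has_sum (K t * S t)) T" if "t \<in> {-R..R}" for t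
      using fS[OF that] by (subst has_sum_cong[where g = "\<lambda>n. f n t"]) (auto simp: f'_def)
  qed
  moreover have cf': "continuous_on {-R..R} (f' n)" for n
    using cf[of n] by (cases "n \<in> T") (simp_all add: f'_def[abs_def])
  have "continuous_on {-R..R} (\<lambda>t. \<Sum>n\<in>X. f' n t)" for X by (intro continuous_intros cf')
  ultimately obtain I J where IJ: "\<And>X. ((\<lambda>t. \<Sum>n\<in>X. f' n t) has_integral I X) {-R..R}" "((\<lambda>t. K t * S t) has_integral J) {-R..R}" "(I \<longlongrightarrow> J) (finite_subsets_at_top T)"
    by (rule uniform_limit_integral) auto
  have fn: "integral {-R..R} (f' n) = (2 * pi) * (of_real (c n) * smooth_step h r R (x / real (g n)))"
    if n: "n \<in> T" for n
  proof -
    have nj: "n j \<ge> 1" if "j \<in> {1..k}" for j using n that by (auto simp: T_def PiE_iff)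
    have P: "g n \<ge> 1" unfolding g_def using nj prod_ge_1[of "{1..k}" n] by auto
    have fe: "f' n t = of_real (c n) * (of_real (x / real (g n)) powr Complex 3 t * riesz_kernel h r (Complex 3 t))" for t
    proof -
      have q: "q j (n j) t = of_real (real (n j) * sin (2 * pi * real (n j) * \<alpha> j)) * of_nat (n j) powr (- Complex 3 t)" if "j \<in> {1..k}" for j
      proof -
        have "of_nat (n j) powr (- (Complex 3 t - 1)) = of_nat (n j) * of_nat (n j) powr (- Complex 3 t)"
          using nj[OF that] powr_add[of "of_nat (n j)" 1 "- Complex 3 t"] by simp
        then show ?thesis by (simp add: q_def)
      qed
      have "(\<Prod>j=1..k. q j (n j) t) = (\<Prod>j=1..k. of_real (real (n j) * sin (2 * pi * real (n j) * \<alpha> j)) * of_nat (n j) powr (- Complex 3 t))"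
        by (rule prod.cong[OF refl q])
      also have "\<dots> = (\<Prod>j=1..k. of_real (real (n j) * sin (2 * pi * real (n j) * \<alpha> j))) * (\<Prod>j=1..k. of_nat (n j) powr (- Complex 3 t))"
        by (rule prod.distrib)
      also have "\<dots> = of_real (c n) * of_nat (g n) powr (- Complex 3 t)"
        by (simp only: of_nat_prod_powr g_def c_def of_real_prod)
      finally have "(\<Prod>j=1..k. q j (n j) t) = of_real (c n) * of_nat (g n) powr (- Complex 3 t)" .
      moreover have "of_real x powr Complex 3 t * of_nat (g n) powr (- Complex 3 t) = of_real (x / real (g n)) powr Complex 3 t"
      proof -
        have "of_real (x / real (g n)) powr Complex 3 t = of_real x powr Complex 3 t * of_real (1 / real (g n)) powr Complex 3 t"
          using powr_times_real[of "of_real x" "of_real (1 / real (g n))" "Complex 3 t"] x by simp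
        also have "of_real (1 / real (g n)) powr Complex 3 t = of_nat (g n) powr (- Complex 3 t)"
        proof -
          have "of_real (real (g n)) powr Complex 3 t * of_real (1 / real (g n)) powr Complex 3 t = (1 :: complex)"
            using powr_times_real[of "of_real (real (g n))" "of_real (1 / real (g n))" "Complex 3 t"] P by simp
          from inverse_unique[OF this] show ?thesis by (simp add: powr_minus)
        qed
        finally show ?thesis by simp
      qed
      ultimately show ?thesis using n by (simp add: f'_def f_def K_def mult_ac)
    qed
    have "integral {-R..R} (f' n) = integral {-R..R} (\<lambda>t. of_real (c n) * (of_real (x / real (g n)) powr Complex 3 t * riesz_kernel h r (Complex 3 t)))"
      by (rule integral_cong) (rule fe)
    also have "\<dots> = of_real (c n) * integral {-R..R} (\<lambda>t. of_real (x / real (g n)) powr Complex 3 t * riesz_kernel h r (Complex 3 t))"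
      by (rule integral_mult_right)
    finally show ?thesis unfolding smooth_step_def by simp
  qed
  have "(sum (\<lambda>n. of_real (c n) * smooth_step h r R (x / real (g n))) \<longlongrightarrow> J / (2 * pi)) (finite_subsets_at_top T)"
  proof (rule Lim_transform_eventually)
    show "((\<lambda>X. I X / (2 * pi)) \<longlongrightarrow> J / (2 * pi)) (finite_subsets_at_top T)" by (intro tendsto_intros IJ(3)) auto
    show "\<forall>\<^sub>F X in finite_subsets_at_top T. I X / (2 * pi) = sum (\<lambda>n. of_real (c n) * smooth_step h r R (x / real (g n))) X"
    proof (rule eventually_finite_subsets_at_top_weakI)
      fix X assume X: "finite X" "X \<subseteq> T"
      have "I X = integral {-R..R} (\<lambda>t. \<Sum>n\<in>X. f' n t)" using IJ(1)[of X] by (simp add: integral_unique)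
      also have "\<dots> = (\<Sum>n\<in>X. integral {-R..R} (f' n))"
        using X by (intro Henstock_Kurzweil_Integration.integral_sum integrable_continuous_real cf') auto
      also have "\<dots> = (\<Sum>n\<in>X. (2 * pi) * (of_real (c n) * smooth_step h r R (x / real (g n))))"
        using X by (intro sum.cong refl fn) auto
      finally show "I X / (2 * pi) = sum (\<lambda>n. of_real (c n) * smooth_step h r R (x / real (g n))) X"
        by (simp add: sum_distrib_left[symmetric])
    qed
  qed
  then show ?thesis
    using integral_unique[OF IJ(2)] by (simp add: has_sum_def T_def K_def S_def c_def g_def)
qed

text \<open>
  By \<open>m/x \<le> e^(m/x - 1)\<close> the terms decay geometrically away from \<open>m = x\<close>, with ratio \<open>e^(-1/(2 h x))\<close>.
  So about \<open>h x\<close> of them count.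
\<close>

lemma sum_powr_ratio_le:
  assumes "h > 0" "x > 0"
  shows "(\<Sum>m = 1..nat \<lfloor>x\<rfloor>. (real m / x) powr (1 / (2 * h))) \<le> 1 + 2 * h * x"
proof -
  define u where "u = 1 / (2 * h * x)"
  define N where "N = nat \<lfloor>x\<rfloor>"
  have u: "u > 0" using assms by (simp add: u_def)
  have Nx: "real N \<le> x" using assms by (simp add: N_def)
  have "(\<Sum>m = 1..N. (real m / x) powr (1 / (2 * h))) \<le> (\<Sum>m = 1..N. exp (- u) ^ (N - m))"
  proof (rule sum_mono)
    fix m assume m: "m \<in> {1..N}"
    have "(real m / x) powr (1 / (2 * h)) \<le> exp (real m / x - 1) powr (1 / (2 * h))"
      using exp_ge_add_one_self[of "real m / x - 1"] assms by (intro powr_mono2) auto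
    also have "\<dots> = exp (- (u * (x - real m)))"
      using assms by (simp add: exp_powr_real u_def field_simps)
    also have "\<dots> \<le> exp (- (u * (real N - real m)))" using u Nx by simp
    also have "\<dots> = exp (- u) ^ (N - m)"
      using m by (simp add: exp_of_nat_mult[symmetric] of_nat_diff mult.commute)
    finally show "(real m / x) powr (1 / (2 * h)) \<le> exp (- u) ^ (N - m)" .
  qed
  also have "\<dots> = (\<Sum>i<N. exp (- u) ^ i)"
    by (rule sum.reindex_bij_witness[of _ "\<lambda>i. N - i" "\<lambda>m. N - m"]) auto
  also have "\<dots> \<le> (\<Sum>i. exp (- u) ^ i)"
    using u by (intro sum_le_suminf summable_geometric) auto
  also have "\<dots> = 1 / (1 - exp (- u))" using u by (intro suminf_geometric) auto
  also have "\<dots> = 1 + 1 / (exp u - 1)"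
    using u by (simp add: exp_minus field_simps)
  also have "\<dots> \<le> 1 + 1 / u"
    using u exp_ge_add_one_self[of u] by (intro add_left_mono frac_le) linarith+
  also have "1 / u = 2 * h * x" by (simp add: u_def)
  finally show ?thesis by (simp add: N_def)
qed

text \<open>
  The tuples are grouped by their product, and the divisor bound controls the size of each group.
\<close>

lemma tuples_weighted_sum_bound:
  fixes \<epsilon> :: real and k :: nat
  assumes "\<epsilon> > 0"
  obtains C where "C > 0" "\<And>h x. h > 0 \<Longrightarrow> x \<ge> 1 \<Longrightarrow>
    (\<Sum>n\<in>tuples_upto k x. real (\<Prod>j=1..k. n j) * (x / real (\<Prod>j=1..k. n j)) powr (- 1 / (2 * h))) \<le> C * x powr (1 + \<epsilon>) * (1 + 2 * h * x)"
proof -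
  obtain C where C: "C \<ge> 1" "\<And>m::nat. m > 0 \<Longrightarrow>
    real (card {n \<in> {1..k} \<rightarrow>\<^sub>E {1..}. (\<Prod>j=1..k. n j) = m}) \<le> C * real m powr \<epsilon>"
    by (rule card_factorizations_bound[OF assms, of k]) (rule that)
  show ?thesis
  proof (rule that)
    show "C > 0" using C by simp
    fix h x :: real assume h: "h > 0" and x: "x \<ge> 1"
    define g where "g n = (\<Prod>j=1..k. n j)" for n :: "nat \<Rightarrow> nat"
    define w where "w m = real m * (x / real m) powr (- 1 / (2 * h))" for m
    define N where "N = nat \<lfloor>x\<rfloor>"
    have gT: "g ` tuples_upto k x \<subseteq> {1..N}"
      using x by (auto simp: tuples_upto_def g_def N_def le_nat_iff le_floor_iff simp del: of_nat_prod)
    have "(\<Sum>n\<in>tuples_upto k x. w (g n)) = (\<Sum>m = 1..N. \<Sum>n\<in>{n \<in> tuples_upto k x. g n = m}. w (g n))"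
      by (rule sum.group[OF finite_tuples_upto _ gT, symmetric]) simp
    also have "\<dots> \<le> (\<Sum>m = 1..N. C * x powr (1 + \<epsilon>) * (real m / x) powr (1 / (2 * h)))"
    proof (rule sum_mono)
      fix m assume m: "m \<in> {1..N}"
      have mx: "real m \<le> x" using m x unfolding N_def by (simp add: le_nat_iff le_floor_iff)
      have w: "w m = real m * (real m / x) powr (1 / (2 * h))"
      proof -
        have "(x / real m) powr (- 1 / (2 * h)) = (real m / x) powr (1 / (2 * h))"
          using m x by (simp add: powr_minus powr_divide divide_simps)
        then show ?thesis by (simp add: w_def)
      qed
      have "(\<Sum>n\<in>{n \<in> tuples_upto k x. g n = m}. w (g n)) = real (card {n \<in> tuples_upto k x. g n = m}) * w m"
        by simp
      also have "\<dots> \<le> (C * real m powr \<epsilon>) * w m"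
      proof (rule mult_right_mono)
        have fin: "finite {n \<in> {1..k} \<rightarrow>\<^sub>E {1..}. (\<Prod>j=1..k. n j) = m}"
          by (rule finite_subset[OF _ finite_tuples_upto[of k "real m"]]) (use m in \<open>auto simp: tuples_upto_def\<close>)
        have "card {n \<in> tuples_upto k x. g n = m} \<le> card {n \<in> {1..k} \<rightarrow>\<^sub>E {1..}. (\<Prod>j=1..k. n j) = m}"
          by (rule card_mono[OF fin]) (auto simp: tuples_upto_def g_def)
        then have "real (card {n \<in> tuples_upto k x. g n = m}) \<le> real (card {n \<in> {1..k} \<rightarrow>\<^sub>E {1..}. (\<Prod>j=1..k. n j) = m})"
          by (rule of_nat_mono)
        also have "\<dots> \<le> C * real m powr \<epsilon>" using m by (intro C(2)) auto
        finally show "real (card {n \<in> tuples_upto k x. g n = m}) \<le> C * real m powr \<epsilon>" .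
      qed (simp add: w_def)
      also have "\<dots> = C * (real m powr \<epsilon> * real m) * (real m / x) powr (1 / (2 * h))" by (simp add: w)
      also have "\<dots> \<le> C * (x powr \<epsilon> * x) * (real m / x) powr (1 / (2 * h))"
        using C(1) mx m assms by (intro mult_right_mono mult_left_mono mult_mono powr_mono2) auto
      also have "x powr \<epsilon> * x = x powr (1 + \<epsilon>)" using x by (simp add: powr_add)
      finally show "(\<Sum>n\<in>{n \<in> tuples_upto k x. g n = m}. w (g n)) \<le> C * x powr (1 + \<epsilon>) * (real m / x) powr (1 / (2 * h))" .
    qed
    also have "\<dots> = C * x powr (1 + \<epsilon>) * (\<Sum>m = 1..N. (real m / x) powr (1 / (2 * h)))"
      by (simp add: sum_distrib_left)
    also have "\<dots> \<le> C * x powr (1 + \<epsilon>) * (1 + 2 * h * x)"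
      using C x h sum_powr_ratio_le[of h x] by (intro mult_left_mono) (auto simp: N_def)
    finally show "(\<Sum>n\<in>tuples_upto k x. real (\<Prod>j=1..k. n j) * (x / real (\<Prod>j=1..k. n j)) powr (- 1 / (2 * h))) \<le> C * x powr (1 + \<epsilon>) * (1 + 2 * h * x)"
      by (simp add: w_def g_def)
  qed
qed

text \<open>
  Off the jump this collects the two previous bounds. At the jump \<open>y = 1\<close> the value \<open>1/2\<close> of the sharp
  cut-off costs an additional error \<open>1/2\<close>, which is absorbed by doubling the constant \<open>2^r\<close>.
\<close>

lemma smooth_step_approx:
  assumes "h > 0" "r \<ge> 1" "R \<ge> 4" "h * R \<ge> 1" "y > 0"
  shows "norm (smooth_step h r R y - of_real (if y < 1 then 0 else if y = 1 then 1/2 else 1))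
    \<le> (if y < 1 then 0 else 2 ^ (r + 1) * y powr (- 1 / (2 * h))) + y ^ 3 / (h * R)"
proof (cases "y < 1")
  case True
  then show ?thesis using smooth_step_small[OF assms(1-3), of y] assms by simp
next
  case False
  then have y: "y \<ge> 1" by simp
  note L = smooth_step_large[OF assms(1-4) y]
  show ?thesis
  proof (cases "y = 1")
    case True
    have "norm (smooth_step h r R y - 1/2) \<le> norm (smooth_step h r R y - 1) + norm (1/2 :: complex)"
      using norm_triangle_ineq[of "smooth_step h r R y - 1" "1/2"] by simp
    also have "\<dots> \<le> (2 ^ r * y powr (- 1 / (2 * h)) + y ^ 3 / (h * R)) + 2 ^ r"
    proof (rule add_mono[OF L])
      have "(1::real) \<le> 2 ^ r" by (rule one_le_power) simp
      moreover have "norm (1/2 :: complex) = 1/2" by simp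
      ultimately show "norm (1/2 :: complex) \<le> 2 ^ r" by linarith
    qed
    finally show ?thesis using True by simp
  next
    case neq: False
    have "(2::real) ^ r * y powr (- 1 / (2 * h)) \<le> 2 ^ (r + 1) * y powr (- 1 / (2 * h))"
      by (intro mult_right_mono) auto
    with L have "norm (smooth_step h r R y - 1) \<le> 2 ^ (r + 1) * y powr (- 1 / (2 * h)) + y ^ 3 / (h * R)"
      by linarith
    then show ?thesis using False neq by simp
  qed
qed

text \<open>
  The sharp and the smooth sum are compared term by term over finite sets of tuples. The second error term, which
  comes from the truncation at height \<open>R\<close>, is summable over all tuples because \<open>n (x/n)^3 = x^3 n^(-2)\<close> for
  a product \<open>n\<close>.
\<close>

lemma sine_sum_approx:
  fixes k :: nat and a p :: "nat \<Rightarrow> nat"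
  assumes h: "h > 0" and r: "r \<ge> 1" and R: "R \<ge> 4" "h * R \<ge> 1" and x: "x > 0"
  shows "norm (integral {-R..R} (\<lambda>t. of_real x powr Complex 3 t * riesz_kernel h r (Complex 3 t) * (\<Prod>j=1..k. sine_L (real (a j) / real (p j)) (Complex 3 t - 1))) / (2 * pi)
      - of_real (sine_sum k a p x))
    \<le> 2 ^ (r + 1) * (\<Sum>n\<in>tuples_upto k x. real (\<Prod>j=1..k. n j) * (x / real (\<Prod>j=1..k. n j)) powr (- 1 / (2 * h)))
      + x ^ 3 * infsum (\<lambda>n. \<Prod>j=1..k. real (n j) powr (-2)) ({1..k} \<rightarrow>\<^sub>E {1..}) / (h * R)"
    (is "norm (?I - _) \<le> ?S1 + ?S2")
proof -
  define T where "T = ({1..k} \<rightarrow>\<^sub>E {1..} :: (nat \<Rightarrow> nat) set)"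
  define g where "g n = (\<Prod>j=1..k. n j)" for n :: "nat \<Rightarrow> nat"
  define c where "c n = (\<Prod>j=1..k. real (n j) * sin (2 * pi * real (n j) * (real (a j) / real (p j))))" for n :: "nat \<Rightarrow> nat"
  define W where "W n = smooth_step h r R (x / real (g n))" for n
  \<comment> \<open>The sharp cut-off, with the value 1/2 at the jump.\<close>
  define w where "w y = (if y < 1 then 0 else if y = 1 then 1/2 else 1 :: real)" for y :: real
  define e1 where "e1 n = real (g n) * (2 ^ (r + 1) * (x / real (g n)) powr (- 1 / (2 * h)))" for n
  define Z where "Z n = (\<Prod>j=1..k. real (n j) powr (-2))" for n :: "nat \<Rightarrow> nat"
  have U: "tuples_upto k x \<subseteq> T" by (auto simp: tuples_upto_def T_def)
  have g1: "g n \<ge> 1" if "n \<in> T" for n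
    unfolding g_def using that prod_ge_1[of "{1..k}" n] by (auto simp: T_def PiE_iff)
  have mem: "n \<in> tuples_upto k x \<longleftrightarrow> \<not> x / real (g n) < 1" if "n \<in> T" for n
    using that g1[OF that] by (simp add: tuples_upto_def T_def g_def[symmetric] not_less divide_simps del: of_nat_prod One_nat_def)
  have cg: "\<bar>c n\<bar> \<le> real (g n)" for n
  proof -
    have "\<bar>c n\<bar> = (\<Prod>j=1..k. \<bar>real (n j) * sin (2 * pi * real (n j) * (real (a j) / real (p j)))\<bar>)"
      unfolding c_def by (rule abs_prod)
    also have "\<dots> \<le> (\<Prod>j=1..k. real (n j))"
    proof (rule prod_mono)
      fix j show "0 \<le> \<bar>real (n j) * sin (2 * pi * real (n j) * (real (a j) / real (p j)))\<bar> \<and> \<bar>real (n j) * sin (2 * pi * real (n j) * (real (a j) / real (p j)))\<bar> \<le> real (n j)"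
        using mult_left_mono[OF abs_sin_le_one, of "real (n j)"] by (simp add: abs_mult)
    qed
    finally show ?thesis by (simp add: g_def)
  qed
  have ss: "sine_sum k a p x = (\<Sum>n\<in>tuples_upto k x. w (x / real (g n)) * c n)"
    unfolding sine_sum_def
  proof (rule sum.cong)
    fix n assume n: "n \<in> tuples_upto k x"
    then have nT: "n \<in> T" using U by blast
    have "x / real (g n) = 1 \<longleftrightarrow> real (g n) = x" using g1[OF nT] by (auto simp: field_simps)
    then have "w (x / real (g n)) = (if real (g n) = x then 1 / 2 else 1)" using mem[OF nT] n by (auto simp: w_def)
    moreover have "c n = real (g n) * (\<Prod>j=1..k. sin (2 * pi * real (n j) * real (a j) / real (p j)))"
      by (simp add: c_def g_def prod.distrib)
    ultimately show "(if real (\<Prod>j=1..k. n j) = x then 1 / 2 else 1) * (real (\<Prod>j=1..k. n j) * (\<Prod>j=1..k. sin (2 * pi * real (n j) * real (a j) / real (p j)))) = w (x / real (g n)) * c n"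
      by (simp add: g_def)
  qed simp
  have hs: "((\<lambda>n. of_real (c n) * W n) has_sum ?I) T"
    unfolding c_def W_def g_def T_def by (rule smoothed_sum_eq_line_integral[OF h x])
  have bound: "norm ((\<Sum>n\<in>F. of_real (c n) * W n) - of_real (sine_sum k a p x)) \<le> ?S1 + ?S2"
    if F: "finite F" "tuples_upto k x \<subseteq> F" "F \<subseteq> T" for F
  proof -
    have "sine_sum k a p x = (\<Sum>n\<in>F. w (x / real (g n)) * c n)"
      unfolding ss
    proof (rule sum.mono_neutral_left[OF F(1,2)])
      show "\<forall>i\<in>F - tuples_upto k x. w (x / real (g i)) * c i = 0"
        using mem F(3) by (auto simp: w_def)
    qed
    then have "(\<Sum>n\<in>F. of_real (c n) * W n) - of_real (sine_sum k a p x) = (\<Sum>n\<in>F. of_real (c n) * (W n - of_real (w (x / real (g n)))))"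
      by (simp add: sum_subtractf algebra_simps)
    also have "norm \<dots> \<le> (\<Sum>n\<in>F. (if n \<in> tuples_upto k x then e1 n else 0) + x ^ 3 / (h * R) * Z n)"
    proof (rule sum_norm_le)
      fix n assume "n \<in> F"
      then have nT: "n \<in> T" using F by blast
      have gp: "real (g n) > 0" using g1[OF nT] by simp
      have "norm (of_real (c n) * (W n - of_real (w (x / real (g n))))) = \<bar>c n\<bar> * norm (W n - of_real (w (x / real (g n))))"
        by (simp add: norm_mult)
      also have "\<dots> \<le> real (g n) * ((if x / real (g n) < 1 then 0 else 2 ^ (r + 1) * (x / real (g n)) powr (- 1 / (2 * h))) + (x / real (g n)) ^ 3 / (h * R))"
        unfolding W_def w_def using gp x by (intro mult_mono cg smooth_step_approx h r R) auto
      also have "\<dots> = (if n \<in> tuples_upto k x then e1 n else 0) + x ^ 3 / (h * R) * (real (g n) / real (g n) ^ 3)"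
        by (simp add: mem[OF nT] e1_def distrib_left power_divide mult_ac)
      also have "real (g n) / real (g n) ^ 3 = Z n"
      proof -
        have "Z n = (\<Prod>j=1..k. 1 / real (n j) ^ 2)"
        proof (unfold Z_def, rule prod.cong)
          fix j assume "j \<in> {1..k}"
          then have "n j \<ge> 1" using nT by (auto simp: T_def PiE_iff)
          then have "real (n j) > 0" by simp
          then show "real (n j) powr (-2) = 1 / real (n j) ^ 2" by (simp add: powr_minus divide_inverse powr_realpow[of _ 2, simplified])
        qed simp
        also have "\<dots> = 1 / real (g n) ^ 2" by (simp add: g_def prod_dividef prod_power_distrib)
        finally show ?thesis using gp by (simp add: power2_eq_square power3_eq_cube)
      qed
      finally show "norm (of_real (c n) * (W n - of_real (w (x / real (g n))))) \<le> (if n \<in> tuples_upto k x then e1 n else 0) + x ^ 3 / (h * R) * Z n" .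
    qed
    also have "\<dots> = (\<Sum>n\<in>F. if n \<in> tuples_upto k x then e1 n else 0) + x ^ 3 / (h * R) * (\<Sum>n\<in>F. Z n)"
      by (simp add: sum.distrib sum_distrib_left)
    also have "(\<Sum>n\<in>F. if n \<in> tuples_upto k x then e1 n else 0) = (\<Sum>n\<in>tuples_upto k x. e1 n)"
      using sum.inter_restrict[OF F(1), of e1 "tuples_upto k x"] F(2) by (simp add: Int_absorb1)
    also have "\<dots> = ?S1" by (simp add: e1_def g_def sum_distrib_left mult_ac)
    also have "(\<Sum>n\<in>F. Z n) \<le> infsum Z T"
      using F summable_on_tuples[of k] unfolding Z_def T_def by (intro finite_sum_le_infsum) (auto intro: prod_nonneg)
    finally show ?thesis using x h R by (simp add: Z_def[abs_def] T_def mult_left_mono divide_right_mono)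
  qed
  have "((\<lambda>F. norm ((\<Sum>n\<in>F. of_real (c n) * W n) - of_real (sine_sum k a p x))) \<longlongrightarrow> norm (?I - of_real (sine_sum k a p x))) (finite_subsets_at_top T)"
    using hs unfolding has_sum_def by (intro tendsto_intros)
  moreover have "\<forall>\<^sub>F F in finite_subsets_at_top T. norm ((\<Sum>n\<in>F. of_real (c n) * W n) - of_real (sine_sum k a p x)) \<le> ?S1 + ?S2"
    unfolding eventually_finite_subsets_at_top
    by (rule exI[of _ "tuples_upto k x"]) (use U finite_tuples_upto bound in auto)
  ultimately show ?thesis
    by (rule tendsto_upperbound) simp
qed

section \<open>The estimate\<close>

text \<open>
  Each of the \<open>k\<close> factors of the product grows at most like \<open>R^2\<close> at height \<open>R\<close>. With \<open>r = 2 k\<close>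
  the kernel decays like \<open>R^(-2 k - 1)\<close>, so the horizontal sides contribute \<open>O(1/R)\<close>.
\<close>

lemma line_shift_error:
  fixes \<alpha> :: "nat \<Rightarrow> real" and k :: nat
  assumes h: "h > 0" and x: "x \<ge> 1" and \<delta>: "0 < \<delta>" "\<delta> \<le> 1/2"
  defines "F \<equiv> \<lambda>s. of_real x powr s * riesz_kernel h (2 * k) s * (\<Prod>j=1..k. sine_L (\<alpha> j) (s - 1))"
  obtains C where "\<And>R. R \<ge> 1 \<Longrightarrow> norm (integral {-R..R} (\<lambda>t. F (Complex 3 t)) - integral {-R..R} (\<lambda>t. F (Complex (1 - \<delta>) t))) \<le> C / R"
proof -
  have "\<forall>j. \<exists>C. C > 0 \<and> (\<forall>s. Re s \<ge> -1/2 \<longrightarrow> norm (sine_L (\<alpha> j) s) \<le> C * (1 + norm s) ^ 2)"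
    using sine_L_polynomial_growth by metis
  then obtain c where c: "\<And>j. c j > 0" "\<And>j s. Re s \<ge> -1/2 \<Longrightarrow> norm (sine_L (\<alpha> j) s) \<le> c j * (1 + norm s) ^ 2"
    by metis
  have hol: "F holomorphic_on {s. Re s > 0}"
  proof -
    have L: "(\<lambda>s. sine_L (\<alpha> j) (s - 1)) holomorphic_on {s. Re s > 0}" for j
    proof -
      have "(sine_L (\<alpha> j) \<circ> (\<lambda>s. s - 1)) holomorphic_on {s. Re s > 0}"
        by (rule holomorphic_on_compose_gen[OF _ holomorphic_sine_L]) (auto intro!: holomorphic_intros)
      then show ?thesis by (simp add: o_def)
    qed
    show ?thesis unfolding F_def using x h
      by (intro holomorphic_intros holomorphic_on_prod holomorphic_riesz_kernel L) auto
  qed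
  define C where "C = x ^ 3 * (1 / h ^ (2 * k)) * (\<Prod>j=1..k. c j * 16)"
  have C0: "C \<ge> 0" unfolding C_def using x h c(1) by (intro mult_nonneg_nonneg prod_nonneg) (auto intro: less_imp_le)
  have bound: "norm (F s) \<le> C / R" if s: "1 - \<delta> \<le> Re s" "Re s \<le> 3" "\<bar>Im s\<bar> = R" and R: "R \<ge> 1" for s R
  proof -
    have nR: "R \<le> norm s" using abs_Im_le_cmod[of s] s by simp
    have nh: "h * R \<le> norm (1 + of_real h * s)" using riesz_kernel_denominator(1)[OF h, of s] s by simp
    have K: "norm (riesz_kernel h (2 * k) s) \<le> 1 / (R * (h * R) ^ (2 * k))"
      unfolding riesz_kernel_def norm_divide norm_mult norm_power norm_one
      using nR nh h R by (intro frac_le mult_mono power_mono mult_pos_pos zero_less_power) auto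
    have X: "norm (of_real x powr s) \<le> x ^ 3"
    proof -
      have "norm (of_real x powr s) = x powr Re s" using x by (simp add: norm_powr_real_powr)
      also have "\<dots> \<le> x powr 3" using x s by (intro powr_mono) auto
      also have "\<dots> = x ^ 3" using x by (simp add: powr_realpow[of x 3, simplified])
      finally show ?thesis .
    qed
    have L: "norm (\<Prod>j=1..k. sine_L (\<alpha> j) (s - 1)) \<le> (\<Prod>j=1..k. c j * 16) * R ^ (2 * k)"
    proof -
      have "norm (s - 1) \<le> \<bar>Re (s - 1)\<bar> + \<bar>Im (s - 1)\<bar>" by (rule cmod_le)
      also have "\<dots> \<le> 2 + R" using s \<delta> by auto
      finally have n: "1 + norm (s - 1) \<le> 4 * R" using R by simp
      have "norm (\<Prod>j=1..k. sine_L (\<alpha> j) (s - 1)) = (\<Prod>j=1..k. norm (sine_L (\<alpha> j) (s - 1)))"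
        by (rule prod_norm[symmetric])
      also have "\<dots> \<le> (\<Prod>j=1..k. c j * 16 * R ^ 2)"
      proof (rule prod_mono)
        fix j
        have "norm (sine_L (\<alpha> j) (s - 1)) \<le> c j * (1 + norm (s - 1)) ^ 2" using s \<delta> by (intro c(2)) auto
        also have "\<dots> \<le> c j * (4 * R) ^ 2" using n c(1)[of j] by (intro mult_left_mono power_mono) auto
        finally show "0 \<le> norm (sine_L (\<alpha> j) (s - 1)) \<and> norm (sine_L (\<alpha> j) (s - 1)) \<le> c j * 16 * R ^ 2"
          by (simp add: power_mult_distrib)
      qed
      also have "\<dots> = (\<Prod>j=1..k. c j * 16) * R ^ (2 * k)" by (simp add: prod.distrib power_mult)
      finally show ?thesis .
    qed
    have "norm (F s) \<le> x ^ 3 * (1 / (R * (h * R) ^ (2 * k))) * ((\<Prod>j=1..k. c j * 16) * R ^ (2 * k))"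
      unfolding F_def norm_mult using x h R by (intro mult_mono X K L mult_nonneg_nonneg) auto
    also have "\<dots> = C / R" using h R by (simp add: C_def power_mult_distrib)
    finally show ?thesis .
  qed
  have "norm (integral {-R..R} (\<lambda>t. F (Complex 3 t)) - integral {-R..R} (\<lambda>t. F (Complex (1 - \<delta>) t))) \<le> (2 * C * (2 + \<delta>)) / R" if R: "R \<ge> 1" for R
  proof -
    have "norm (integral {-R..R} (\<lambda>t. F (Complex 3 t)) - integral {-R..R} (\<lambda>t. F (Complex (1 - \<delta>) t))) \<le> 2 * (C / R) * (3 - (1 - \<delta>))"
      using R \<delta> C0 by (intro vertical_line_shift[where e = 0, OF _ _ _ _ hol] bound) auto
    then show ?thesis by simp
  qed
  then show ?thesis by (rule that)
qed

lemma le_of_le_plus_decaying: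
  fixes A B c R0 :: real
  assumes "\<And>R. R \<ge> R0 \<Longrightarrow> A \<le> B + c / R"
  shows "A \<le> B"
proof (rule tendsto_le[OF trivial_limit_at_top_linorder])
  show "((\<lambda>R. B + c / R) \<longlongrightarrow> B) at_top"
    using tendsto_add[OF tendsto_const[of B] tendsto_divide_0[OF tendsto_const[of c] filterlim_at_top_imp_at_infinity[OF filterlim_ident]]] by simp
  show "((\<lambda>R. A) \<longlongrightarrow> A) at_top" by simp
  show "\<forall>\<^sub>F R in at_top. A \<le> B + c / R"
    using eventually_ge_at_top[of R0] by eventually_elim (rule assms)
qed

text \<open>
  The sum differs from the integral on \<open>Re s = 3\<close> by the smoothing error, and from the integral on \<open>Re s = 1 - \<delta>\<close> by
  a further \<open>O(1/R)\<close>. The other bounds do not depend on \<open>R\<close>, so \<open>R\<close> may tend to infinity with \<open>x\<close> and \<open>h\<close> fixed.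
\<close>

lemma sine_sum_bound:
  fixes k :: nat and a p :: "nat \<Rightarrow> nat" and \<epsilon> \<delta> :: real
  assumes k: "k \<ge> 1" and \<delta>: "0 < \<delta>" "\<delta> \<le> 1/2" and \<epsilon>: "\<epsilon> > 0"
  defines "\<theta> \<equiv> (real k - 1) / 2 + (real k + 1) * \<delta>"
  obtains C where "C > 0" "\<And>h x. h > 0 \<Longrightarrow> x \<ge> 1 \<Longrightarrow>
    \<bar>sine_sum k a p x\<bar> \<le> C * (x powr (1 + \<epsilon>) * (1 + 2 * h * x) + x powr (1 - \<delta>) * (1 + h powr (- \<theta>)))"
proof -
  define r where "r = 2 * k"
  have r: "r \<ge> 1" using k by (simp add: r_def)
  have "(real k + 1) * \<delta> \<le> (real k + 1) * (1/2)" using \<delta> by (intro mult_left_mono) auto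
  then have \<theta>r: "(real k - 1) / 2 + (real k + 1) * \<delta> \<le> real r" using k by (simp add: r_def field_simps)
  obtain C1 where C1: "C1 > 0" "\<And>h x. h > 0 \<Longrightarrow> x \<ge> 1 \<Longrightarrow>
    (\<Sum>n\<in>tuples_upto k x. real (\<Prod>j=1..k. n j) * (x / real (\<Prod>j=1..k. n j)) powr (- 1 / (2 * h))) \<le> C1 * x powr (1 + \<epsilon>) * (1 + 2 * h * x)"
    by (rule tuples_weighted_sum_bound[OF \<epsilon>, of k]) (rule that)
  obtain C2 where C2: "C2 > 0" "\<And>h R x. h > 0 \<Longrightarrow> R \<ge> 1 \<Longrightarrow> x > 0 \<Longrightarrow>
    norm (integral {-R..R} (\<lambda>t. of_real x powr Complex (1 - \<delta>) t * riesz_kernel h r (Complex (1 - \<delta>) t) * (\<Prod>j=1..k. sine_L (real (a j) / real (p j)) (Complex (1 - \<delta>) t - 1))))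
      \<le> C2 * x powr (1 - \<delta>) * (1 + h powr (- \<theta>))"
    by (rule left_line_integral_bound[OF k \<delta> \<theta>r, where \<alpha> = "\<lambda>j. real (a j) / real (p j)", folded \<theta>_def]) (rule that)
  define Z where "Z = infsum (\<lambda>n. \<Prod>j=1..k. real (n j) powr (-2)) ({1..k} \<rightarrow>\<^sub>E {1..})"
  have main: "\<bar>sine_sum k a p x\<bar> \<le> 2 ^ (r + 1) * (C1 * x powr (1 + \<epsilon>) * (1 + 2 * h * x)) + C2 * x powr (1 - \<delta>) * (1 + h powr (- \<theta>))"
    if h: "h > 0" and x: "x \<ge> 1" for h x
  proof -
    define F where "F s = of_real x powr s * riesz_kernel h r s * (\<Prod>j=1..k. sine_L (real (a j) / real (p j)) (s - 1))" for s
    obtain C3 where C3: "\<And>R. R \<ge> 1 \<Longrightarrow> norm (integral {-R..R} (\<lambda>t. F (Complex 3 t)) - integral {-R..R} (\<lambda>t. F (Complex (1 - \<delta>) t))) \<le> C3 / R"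
      unfolding F_def r_def by (rule line_shift_error[OF h x \<delta>, where \<alpha> = "\<lambda>j. real (a j) / real (p j)" and k = k]) (rule that[unfolded F_def r_def])
    have ineq: "\<bar>sine_sum k a p x\<bar> \<le> (2 ^ (r + 1) * (C1 * x powr (1 + \<epsilon>) * (1 + 2 * h * x)) + C2 * x powr (1 - \<delta>) * (1 + h powr (- \<theta>)))
        + (x ^ 3 * Z / h + C3) / R" if R: "R \<ge> max 4 (1 / h)" for R
    proof -
      have R': "R \<ge> 4" "R \<ge> 1" "h * R \<ge> 1" using R h by (auto simp: field_simps)
      define I3 I1 where "I3 = integral {-R..R} (\<lambda>t. F (Complex 3 t))" and "I1 = integral {-R..R} (\<lambda>t. F (Complex (1 - \<delta>) t))"
      have n3: "norm (I3 / (2 * pi) - of_real (sine_sum k a p x)) \<le> 2 ^ (r + 1) * (C1 * x powr (1 + \<epsilon>) * (1 + 2 * h * x)) + x ^ 3 * Z / (h * R)"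
      proof -
        have "norm (I3 / (2 * pi) - of_real (sine_sum k a p x)) \<le> 2 ^ (r + 1) * (\<Sum>n\<in>tuples_upto k x. real (\<Prod>j=1..k. n j) * (x / real (\<Prod>j=1..k. n j)) powr (- 1 / (2 * h)))
          + x ^ 3 * Z / (h * R)"
          unfolding I3_def F_def Z_def using x by (intro sine_sum_approx h r R') auto
        also have "\<dots> \<le> 2 ^ (r + 1) * (C1 * x powr (1 + \<epsilon>) * (1 + 2 * h * x)) + x ^ 3 * Z / (h * R)"
          by (intro add_right_mono mult_left_mono C1(2) h x) simp
        finally show ?thesis .
      qed
      have half: "norm (w / (2 * pi)) \<le> norm w" for w :: complex
      proof -
        have "norm (w / (2 * pi)) = norm w / (2 * pi)" by (simp add: norm_divide norm_mult)
        also have "\<dots> \<le> norm w / 1" using pi_gt3 by (intro divide_left_mono) auto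
        finally show ?thesis by simp
      qed
      have n31: "norm ((I3 - I1) / (2 * pi)) \<le> C3 / R"
        using half[of "I3 - I1"] C3[OF R'(2)] unfolding I3_def I1_def by linarith
      have n1: "norm (I1 / (2 * pi)) \<le> C2 * x powr (1 - \<delta>) * (1 + h powr (- \<theta>))"
      proof -
        have "norm I1 \<le> C2 * x powr (1 - \<delta>) * (1 + h powr (- \<theta>))"
          unfolding I1_def F_def using x by (intro C2(2) h R') auto
        then show ?thesis using half[of I1] by linarith
      qed
      have "complex_of_real (sine_sum k a p x) = (I3 - I1) / (2 * pi) + I1 / (2 * pi) - (I3 / (2 * pi) - of_real (sine_sum k a p x))"
        by (simp add: diff_divide_distrib)
      then have "norm (complex_of_real (sine_sum k a p x)) \<le> norm ((I3 - I1) / (2 * pi)) + norm (I1 / (2 * pi)) + norm (I3 / (2 * pi) - of_real (sine_sum k a p x))"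
        by (metis (no_types, lifting) norm_triangle_ineq norm_triangle_ineq4 add_right_mono order_trans)
      also have "\<dots> \<le> C3 / R + C2 * x powr (1 - \<delta>) * (1 + h powr (- \<theta>)) + (2 ^ (r + 1) * (C1 * x powr (1 + \<epsilon>) * (1 + 2 * h * x)) + x ^ 3 * Z / (h * R))"
        by (intro add_mono n31 n1 n3)
      finally show ?thesis by (simp add: add_divide_distrib algebra_simps)
    qed
    show ?thesis by (rule le_of_le_plus_decaying[OF ineq])
  qed
  show ?thesis
  proof (rule that)
    show "2 ^ (r + 1) * C1 + C2 > 0" using C1 C2 by (intro add_pos_pos mult_pos_pos) auto
    fix h x :: real assume h: "h > 0" and x: "x \<ge> 1"
    define u v where "u = x powr (1 + \<epsilon>) * (1 + 2 * h * x)" and "v = x powr (1 - \<delta>) * (1 + h powr (- \<theta>))"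
    have uv: "u \<ge> 0" "v \<ge> 0" unfolding u_def v_def using h x by (auto intro!: mult_nonneg_nonneg add_nonneg_nonneg)
    have "\<bar>sine_sum k a p x\<bar> \<le> (2 ^ (r + 1) * C1) * u + C2 * v"
      using main[OF h x] by (simp add: u_def v_def mult.assoc)
    also have "\<dots> \<le> (2 ^ (r + 1) * C1 + C2) * u + (2 ^ (r + 1) * C1 + C2) * v"
      using uv C1 C2 by (intro add_mono mult_right_mono) auto
    finally show "\<bar>sine_sum k a p x\<bar> \<le> (2 ^ (r + 1) * C1 + C2) * (x powr (1 + \<epsilon>) * (1 + 2 * h * x) + x powr (1 - \<delta>) * (1 + h powr (- \<theta>)))"
      by (simp add: u_def v_def distrib_left)
  qed
qed

theorem theorem10p10:
  fixes k :: nat and a p :: "nat \<Rightarrow> nat" and \<epsilon> :: real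
  assumes "k \<ge> 1"
    and "\<And>j. j \<in> {1..k} \<Longrightarrow> a j > 0"
    and "\<And>j. j \<in> {1..k} \<Longrightarrow> p j > 0"
    and "\<And>j. j \<in> {1..k} \<Longrightarrow> coprime (a j) (p j)"
    and "\<epsilon> > 0"
  shows "sine_sum k a p \<in> O[at_top](\<lambda>x. x powr (2 * real k / (real k + 1) + \<epsilon>))"
proof -
  \<comment> \<open>\<delta> enters the final exponent with coefficient 1, hence \<delta> \<le> \<epsilon>; the asymptotics of the gamma factor are stated for \<delta> \<le> 1/2.\<close>
  define \<delta> where "\<delta> = min (1/2) \<epsilon>"
  have \<delta>: "0 < \<delta>" "\<delta> \<le> 1/2" "\<delta> \<le> \<epsilon>" using \<open>\<epsilon> > 0\<close> by (auto simp: \<delta>_def)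
  define \<theta> where "\<theta> = (real k - 1) / 2 + (real k + 1) * \<delta>"
  have \<theta>: "\<theta> \<ge> 0" using \<delta> \<open>k \<ge> 1\<close> by (simp add: \<theta>_def)
  define E where "E = 2 * real k / (real k + 1) + \<epsilon>"
  obtain C where C: "C > 0" "\<And>h x. h > 0 \<Longrightarrow> x \<ge> 1 \<Longrightarrow>
    \<bar>sine_sum k a p x\<bar> \<le> C * (x powr (1 + \<epsilon>) * (1 + 2 * h * x) + x powr (1 - \<delta>) * (1 + h powr (- \<theta>)))"
    by (rule sine_sum_bound[OF \<open>k \<ge> 1\<close> \<delta>(1,2) \<open>\<epsilon> > 0\<close>, where a = a and p = p, folded \<theta>_def]) (rule that)
  have "norm (sine_sum k a p x) \<le> (5 * C) * norm (x powr E)" if x: "x \<ge> 1" for x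
  proof -
    \<comment> \<open>The choice that makes h x^2 and x h^(-(k - 1)/2) equal.\<close>
    define h where "h = x powr (- 2 / (real k + 1))"
    have h: "h > 0" using x by (simp add: h_def)
    have e1: "1 + (- 2 / (real k + 1) + 1) = 2 * real k / (real k + 1)" by (simp add: field_simps)
    have ge: "- 2 / (real k + 1) + 1 \<ge> 0" using \<open>k \<ge> 1\<close> by (simp add: field_simps)
    have hx: "h * x = x powr (- 2 / (real k + 1) + 1)" using x by (simp only: h_def powr_add) simp
    have hx1: "1 \<le> h * x" unfolding hx using x ge by (intro ge_one_powr_ge_zero) auto
    have "x powr (1 + \<epsilon>) * (1 + 2 * h * x) \<le> x powr (1 + \<epsilon>) * (3 * (h * x))"
      using hx1 by (intro mult_left_mono) auto
    also have "\<dots> = 3 * x powr E"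
    proof -
      have "x powr (1 + \<epsilon>) * (h * x) = x powr ((1 + \<epsilon>) + (- 2 / (real k + 1) + 1))" unfolding hx by (simp only: powr_add)
      also have "(1 + \<epsilon>) + (- 2 / (real k + 1) + 1) = E" using e1 by (simp add: E_def)
      finally show ?thesis by simp
    qed
    finally have A: "x powr (1 + \<epsilon>) * (1 + 2 * h * x) \<le> 3 * x powr E" .
    have hm: "h powr (- \<theta>) = x powr (2 * \<theta> / (real k + 1))" by (simp add: h_def powr_powr)
    have "x powr (2 * \<theta> / (real k + 1)) \<ge> 1" using x \<theta> by (intro ge_one_powr_ge_zero) auto
    then have "x powr (1 - \<delta>) * (1 + h powr (- \<theta>)) \<le> x powr (1 - \<delta>) * (2 * x powr (2 * \<theta> / (real k + 1)))"
      unfolding hm by (intro mult_left_mono) auto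
    also have "\<dots> = 2 * x powr ((1 - \<delta>) + 2 * \<theta> / (real k + 1))" by (simp add: powr_add)
    also have "\<dots> \<le> 2 * x powr E"
    proof -
      have "(1 - \<delta>) + 2 * \<theta> / (real k + 1) = 2 * real k / (real k + 1) + \<delta>"
        by (simp add: \<theta>_def field_simps)
      also have "\<dots> \<le> E" using \<delta> by (simp add: E_def)
      finally show ?thesis using x by (intro mult_left_mono powr_mono) auto
    qed
    finally have B: "x powr (1 - \<delta>) * (1 + h powr (- \<theta>)) \<le> 2 * x powr E" .
    have "\<bar>sine_sum k a p x\<bar> \<le> C * (x powr (1 + \<epsilon>) * (1 + 2 * h * x) + x powr (1 - \<delta>) * (1 + h powr (- \<theta>)))"
      by (rule C(2)[OF h x])
    also have "\<dots> \<le> C * (3 * x powr E + 2 * x powr E)" using C(1) by (intro mult_left_mono add_mono A B) auto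
    finally show ?thesis by simp
  qed
  then have "sine_sum k a p \<in> O[at_top](\<lambda>x. x powr E)"
    by (intro bigoI[where c = "5 * C"] eventually_mono[OF eventually_ge_at_top[of 1]]) auto
  then show ?thesis by (simp add: E_def)
qed

end
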